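(* A nearly cosymplectic (non-coKähler) structure on a $5$-dimensional manifold is equivalent to an $SU(2)$-structure $(\eta,\omega_1,\omega_2,\omega_3)$ satisfying $$d\eta=-2\lambda\omega_3,\qquad d\omega_1=3\lambda\,\eta\wedge\omega_2,\qquad d\omega_2=-3\lambda\,\eta\wedge\omega_1$$ for some real number $\lambda\neq0$. These $SU(2)$-structures are hypo.
   Context: All manifolds are smooth and connected; $\nabla$ is the Levi-Civita connection of $g$; $d\eta(X,Y)=X(\eta(Y))-Y(\eta(X))-\eta([X,Y])$ and $u\wedge v=u\otimes v-v\otimes u$ for $1$-forms. An almost contact metric structure $(\phi,\xi,\eta,g)$ on $M^{2n+1}$ consists of a $(1,1)$-tensor field $\phi$, a vector field $\xi$, a $1$-form $\eta$ and a Riemannian metric $g$ with $\phi^2=-I+\eta\otimes\xi$, $\eta(\xi)=1$, $g(\phi X,\phi Y)=g(X,Y)-\eta(X)\eta(Y)$. It is coKähler if $\nabla\phi=0$, and nearly cosymplectic if $(\nabla_X\phi)Y+(\nabla_Y\phi)X=0$ for all vector fields $X,Y$. An $SU(2)$-structure on a $5$-manifold is given equivalently by (i) three almost contact metric structures $(\phi_i,\xi,\eta,g)$, $i\in\{1,2,3\}$, with the same $\xi,\eta,g$ and $\phi_i\phi_j=\phi_k=-\phi_j\phi_i$ for every even permutation $(i,j,k)$ of $(1,2,3)$; or (ii) a quadruplet $(\eta,\omega_1,\omega_2,\omega_3)$ of a $1$-form and three $2$-forms with $\omega_i\wedge\omega_j=\delta_{ij}v$ for some $4$-form $v$ with $v\wedge\eta\neq0$,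 and such that $X\lrcorner\,\omega_1=Y\lrcorner\,\omega_2$ implies $\omega_3(X,Y)\ge0$. The two descriptions are related by $\omega_i(X,Y)=g(\phi_iX,Y)$. An $SU(2)$-structure $(\eta,\omega_1,\omega_2,\omega_3)$ is called hypo if $d\omega_3=0$, $d(\eta\wedge\omega_1)=0$ and $d(\eta\wedge\omega_2)=0$. *)

theory Defs
  imports "HOL-Analysis.Analysis"
begin

text \<open>For open \<open>V\<close> in a finite-dimensional space, \<open>Ck_on k V f\<close> says that \<open>f\<close> is of class
  \<open>C^k\<close> on \<open>V\<close>: all directional derivatives are of class \<open>C^(k-1)\<close>.\<close>

primrec Ck_on :: "nat \<Rightarrow> 'a::real_normed_vector set \<Rightarrow> ('a \<Rightarrow> 'b::real_normed_vector) \<Rightarrow> bool" where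
  "Ck_on 0 V f \<longleftrightarrow> continuous_on V f"
| "Ck_on (Suc k) V f \<longleftrightarrow>
     (\<forall>x\<in>V. f differentiable (at x)) \<and>
     (\<forall>v. Ck_on k V (\<lambda>x. frechet_derivative f (at x) v))"

definition smooth_on :: "'a::real_normed_vector set \<Rightarrow> ('a \<Rightarrow> 'b::real_normed_vector) \<Rightarrow> bool" where
  "smooth_on V f \<longleftrightarrow> (\<forall>k. Ck_on k V f)"

definition vfields :: "'a::real_normed_vector set \<Rightarrow> ('a \<Rightarrow> 'a) set" where
  "vfields V = {X. smooth_on V X}"

definition dirder :: "('a \<Rightarrow> 'a) \<Rightarrow> ('a::real_normed_vector \<Rightarrow> real) \<Rightarrow> 'a \<Rightarrow> real" where
  "dirder X f x = frechet_derivative f (at x) (X x)"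

definition lie_bracket :: "('a \<Rightarrow> 'a) \<Rightarrow> ('a \<Rightarrow> 'a) \<Rightarrow> 'a::real_normed_vector \<Rightarrow> 'a" where
  "lie_bracket X Y x = frechet_derivative Y (at x) (X x) - frechet_derivative X (at x) (Y x)"

text \<open>A chart is an open set with a coordinate map; only the values of the map on the open set
  matter. Charts take values in \<open>real ^ 'n\<close>, so the dimension is \<open>CARD('n)\<close>.\<close>

type_synonym ('a, 'n) chart = "'a set \<times> ('a \<Rightarrow> (real, 'n) vec)"

definition chart_image :: "('a, 'n::finite) chart \<Rightarrow> (real ^ 'n) set" where
  "chart_image c = snd c ` fst c"

definition is_chart :: "('a::topological_space, 'n::finite) chart \<Rightarrow> bool" where
  "is_chart c \<longleftrightarrow> open (fst c) \<and> open (chart_image c) \<and>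
     (\<exists>h. homeomorphism (fst c) (chart_image c) (snd c) h)"

definition overlap :: "('a, 'n::finite) chart \<Rightarrow> ('a, 'n) chart \<Rightarrow> (real ^ 'n) set" where
  "overlap c d = snd c ` (fst c \<inter> fst d)"

definition transition :: "('a, 'n::finite) chart \<Rightarrow> ('a, 'n) chart \<Rightarrow> real ^ 'n \<Rightarrow> real ^ 'n" where
  "transition c d = snd d \<circ> inv_into (fst c) (snd c)"

definition jacobian ::
    "('a, 'n::finite) chart \<Rightarrow> ('a, 'n) chart \<Rightarrow> real ^ 'n \<Rightarrow> real ^ 'n \<Rightarrow> real ^ 'n" where
  "jacobian c d x = frechet_derivative (transition c d) (at x)"

text \<open>The atlas need not be maximal: tensor fields given on one atlas extend uniquely to the
  maximal atlas containing it.\<close>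

definition smooth_atlas :: "('a::topological_space, 'n::finite) chart set \<Rightarrow> bool" where
  "smooth_atlas A \<longleftrightarrow>
     (\<forall>c\<in>A. is_chart c) \<and> (\<Union>c\<in>A. fst c) = UNIV \<and>
     (\<forall>c\<in>A. \<forall>d\<in>A. smooth_on (overlap c d) (transition c d))"

text \<open>The manifold is the whole type \<open>'a\<close>; Hausdorff and second countable by its sort.\<close>

definition connected_manifold ::
    "('a::{t2_space,second_countable_topology}, 'n::finite) chart set \<Rightarrow> bool" where
  "connected_manifold A \<longleftrightarrow> smooth_atlas A \<and> connected (UNIV :: 'a set)"

text \<open>A tensor field is a family of smooth local representatives, one on the image of each chart,
  related by the Jacobians of the transition maps. A representative is only meaningful on the
  image of its chart. Identities between such fields are required on every chart image, and where
  they involve derivatives they are tested on all smooth vector fields there; this is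
  the same as testing on global vector fields, since both sides are tensorial.\<close>

type_synonym ('a, 'n) vector_rep = "('a, 'n) chart \<Rightarrow> (real, 'n) vec \<Rightarrow> (real, 'n) vec"
type_synonym ('a, 'n) endo_rep =
  "('a, 'n) chart \<Rightarrow> (real, 'n) vec \<Rightarrow> (real, 'n) vec \<Rightarrow> (real, 'n) vec"
type_synonym ('a, 'n) cov1_rep = "('a, 'n) chart \<Rightarrow> (real, 'n) vec \<Rightarrow> (real, 'n) vec \<Rightarrow> real"
type_synonym ('a, 'n) cov2_rep =
  "('a, 'n) chart \<Rightarrow> (real, 'n) vec \<Rightarrow> (real, 'n) vec \<Rightarrow> (real, 'n) vec \<Rightarrow> real"
type_synonym ('a, 'n) cov3_rep =
  "('a, 'n) chart \<Rightarrow> (real, 'n) vec \<Rightarrow> (real, 'n) vec \<Rightarrow> (real, 'n) vec \<Rightarrow> (real, 'n) vec \<Rightarrow> real"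
type_synonym ('a, 'n) cov4_rep =
  "('a, 'n) chart \<Rightarrow> (real, 'n) vec \<Rightarrow>
     (real, 'n) vec \<Rightarrow> (real, 'n) vec \<Rightarrow> (real, 'n) vec \<Rightarrow> (real, 'n) vec \<Rightarrow> real"

definition vector_field ::
    "('a::topological_space, 'n::finite) chart set \<Rightarrow> ('a, 'n) vector_rep \<Rightarrow> bool" where
  "vector_field A X \<longleftrightarrow>
     (\<forall>c\<in>A. smooth_on (chart_image c) (X c)) \<and>
     (\<forall>c\<in>A. \<forall>d\<in>A. \<forall>x\<in>overlap c d. X d (transition c d x) = jacobian c d x (X c x))"

definition endo_field ::
    "('a::topological_space, 'n::finite) chart set \<Rightarrow> ('a, 'n) endo_rep \<Rightarrow> bool" where
  "endo_field A \<phi> \<longleftrightarrow>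
     (\<forall>c\<in>A. \<forall>x\<in>chart_image c. linear (\<phi> c x)) \<and>
     (\<forall>c\<in>A. \<forall>u. smooth_on (chart_image c) (\<lambda>x. \<phi> c x u)) \<and>
     (\<forall>c\<in>A. \<forall>d\<in>A. \<forall>x\<in>overlap c d. \<forall>u.
        \<phi> d (transition c d x) (jacobian c d x u) = jacobian c d x (\<phi> c x u))"

definition one_form ::
    "('a::topological_space, 'n::finite) chart set \<Rightarrow> ('a, 'n) cov1_rep \<Rightarrow> bool" where
  "one_form A \<eta> \<longleftrightarrow>
     (\<forall>c\<in>A. \<forall>x\<in>chart_image c. linear (\<eta> c x)) \<and>
     (\<forall>c\<in>A. \<forall>u. smooth_on (chart_image c) (\<lambda>x. \<eta> c x u)) \<and>
     (\<forall>c\<in>A. \<forall>d\<in>A. \<forall>x\<in>overlap c d. \<forall>u.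
        \<eta> d (transition c d x) (jacobian c d x u) = \<eta> c x u)"

definition cov2_field ::
    "('a::topological_space, 'n::finite) chart set \<Rightarrow> ('a, 'n) cov2_rep \<Rightarrow> bool" where
  "cov2_field A g \<longleftrightarrow>
     (\<forall>c\<in>A. \<forall>x\<in>chart_image c. bilinear (g c x)) \<and>
     (\<forall>c\<in>A. \<forall>u v. smooth_on (chart_image c) (\<lambda>x. g c x u v)) \<and>
     (\<forall>c\<in>A. \<forall>d\<in>A. \<forall>x\<in>overlap c d. \<forall>u v.
        g d (transition c d x) (jacobian c d x u) (jacobian c d x v) = g c x u v)"

definition riemannian_metric ::
    "('a::topological_space, 'n::finite) chart set \<Rightarrow> ('a, 'n) cov2_rep \<Rightarrow> bool" where
  "riemannian_metric A g \<longleftrightarrow> cov2_field A g \<and>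
     (\<forall>c\<in>A. \<forall>x\<in>chart_image c.
        (\<forall>u v. g c x u v = g c x v u) \<and> (\<forall>u. u \<noteq> 0 \<longrightarrow> 0 < g c x u u))"

text \<open>\<open>has_ext_deriv1 A \<alpha> \<beta>\<close> means \<open>d\<alpha> = \<beta>\<close> for a 1-form \<open>\<alpha>\<close> and a 2-form \<open>\<beta>\<close>; similarly in
  higher degree. The normalisation is the one without factors \<open>1/(k+1)\<close>.\<close>

definition ext_d1 ::
    "('v \<Rightarrow> 'v \<Rightarrow> real) \<Rightarrow> ('v \<Rightarrow> 'v) \<Rightarrow> ('v \<Rightarrow> 'v) \<Rightarrow> 'v::real_normed_vector \<Rightarrow> real" where
  "ext_d1 \<alpha> X Y x =
     dirder X (\<lambda>y. \<alpha> y (Y y)) x - dirder Y (\<lambda>y. \<alpha> y (X y)) x - \<alpha> x (lie_bracket X Y x)"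

definition ext_d2 ::
    "('v \<Rightarrow> 'v \<Rightarrow> 'v \<Rightarrow> real) \<Rightarrow> ('v \<Rightarrow> 'v) \<Rightarrow> ('v \<Rightarrow> 'v) \<Rightarrow> ('v \<Rightarrow> 'v) \<Rightarrow>
      'v::real_normed_vector \<Rightarrow> real" where
  "ext_d2 \<alpha> X Y Z x =
     dirder X (\<lambda>y. \<alpha> y (Y y) (Z y)) x
   - dirder Y (\<lambda>y. \<alpha> y (X y) (Z y)) x
   + dirder Z (\<lambda>y. \<alpha> y (X y) (Y y)) x
   - \<alpha> x (lie_bracket X Y x) (Z x)
   + \<alpha> x (lie_bracket X Z x) (Y x)
   - \<alpha> x (lie_bracket Y Z x) (X x)"

definition ext_d3 ::
    "('v \<Rightarrow> 'v \<Rightarrow> 'v \<Rightarrow> 'v \<Rightarrow> real) \<Rightarrow>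
      ('v \<Rightarrow> 'v) \<Rightarrow> ('v \<Rightarrow> 'v) \<Rightarrow> ('v \<Rightarrow> 'v) \<Rightarrow> ('v \<Rightarrow> 'v) \<Rightarrow> 'v::real_normed_vector \<Rightarrow> real" where
  "ext_d3 \<alpha> X Y Z W x =
     dirder X (\<lambda>y. \<alpha> y (Y y) (Z y) (W y)) x
   - dirder Y (\<lambda>y. \<alpha> y (X y) (Z y) (W y)) x
   + dirder Z (\<lambda>y. \<alpha> y (X y) (Y y) (W y)) x
   - dirder W (\<lambda>y. \<alpha> y (X y) (Y y) (Z y)) x
   - \<alpha> x (lie_bracket X Y x) (Z x) (W x)
   + \<alpha> x (lie_bracket X Z x) (Y x) (W x)
   - \<alpha> x (lie_bracket X W x) (Y x) (Z x)
   - \<alpha> x (lie_bracket Y Z x) (X x) (W x)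
   + \<alpha> x (lie_bracket Y W x) (X x) (Z x)
   - \<alpha> x (lie_bracket Z W x) (X x) (Y x)"

definition has_ext_deriv1 ::
    "('a, 'n::finite) chart set \<Rightarrow> ('a, 'n) cov1_rep \<Rightarrow> ('a, 'n) cov2_rep \<Rightarrow> bool" where
  "has_ext_deriv1 A \<alpha> \<beta> \<longleftrightarrow>
     (\<forall>c\<in>A. \<forall>X\<in>vfields (chart_image c). \<forall>Y\<in>vfields (chart_image c). \<forall>x\<in>chart_image c.
        ext_d1 (\<alpha> c) X Y x = \<beta> c x (X x) (Y x))"

definition has_ext_deriv2 ::
    "('a, 'n::finite) chart set \<Rightarrow> ('a, 'n) cov2_rep \<Rightarrow> ('a, 'n) cov3_rep \<Rightarrow> bool" where
  "has_ext_deriv2 A \<alpha> \<beta> \<longleftrightarrow>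
     (\<forall>c\<in>A. \<forall>X\<in>vfields (chart_image c). \<forall>Y\<in>vfields (chart_image c).
        \<forall>Z\<in>vfields (chart_image c). \<forall>x\<in>chart_image c.
        ext_d2 (\<alpha> c) X Y Z x = \<beta> c x (X x) (Y x) (Z x))"

definition has_ext_deriv3 ::
    "('a, 'n::finite) chart set \<Rightarrow> ('a, 'n) cov3_rep \<Rightarrow> ('a, 'n) cov4_rep \<Rightarrow> bool" where
  "has_ext_deriv3 A \<alpha> \<beta> \<longleftrightarrow>
     (\<forall>c\<in>A. \<forall>X\<in>vfields (chart_image c). \<forall>Y\<in>vfields (chart_image c).
        \<forall>Z\<in>vfields (chart_image c). \<forall>W\<in>vfields (chart_image c). \<forall>x\<in>chart_image c.
        ext_d3 (\<alpha> c) X Y Z W x = \<beta> c x (X x) (Y x) (Z x) (W x))"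

text \<open>The wedge of a 1-form and a 2-form, normalised so that
  \<open>\<alpha> \<and> (\<beta> \<and> \<gamma>) = det\<close> for 1-forms, as forced by \<open>\<beta> \<and> \<gamma> = \<beta> \<otimes> \<gamma> - \<gamma> \<otimes> \<beta>\<close> and associativity.\<close>

definition wedge12 :: "('a, 'n) cov1_rep \<Rightarrow> ('a, 'n) cov2_rep \<Rightarrow> ('a, 'n) cov3_rep" where
  "wedge12 \<alpha> \<omega> c x u v w =
     \<alpha> c x u * \<omega> c x v w + \<alpha> c x v * \<omega> c x w u + \<alpha> c x w * \<omega> c x u v"

text \<open>The Levi-Civita connection of a metric \<open>g\<close> on an open set \<open>V\<close>: a torsion-free metric affine
  connection. It is unique, as far as its values on \<open>V\<close> and on smooth fields are concerned.\<close>

definition levi_civita_on ::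
    "'v::real_normed_vector set \<Rightarrow> ('v \<Rightarrow> 'v \<Rightarrow> 'v \<Rightarrow> real) \<Rightarrow>
      (('v \<Rightarrow> 'v) \<Rightarrow> ('v \<Rightarrow> 'v) \<Rightarrow> ('v \<Rightarrow> 'v)) \<Rightarrow> bool" where
  "levi_civita_on V g D \<longleftrightarrow>
     (\<forall>X\<in>vfields V. \<forall>Y\<in>vfields V. D X Y \<in> vfields V) \<and>
     (\<forall>X\<in>vfields V. \<forall>X'\<in>vfields V. \<forall>Y\<in>vfields V. \<forall>x\<in>V.
        D (\<lambda>y. X y + X' y) Y x = D X Y x + D X' Y x) \<and>
     (\<forall>f. smooth_on V f \<longrightarrow> (\<forall>X\<in>vfields V. \<forall>Y\<in>vfields V. \<forall>x\<in>V.
        D (\<lambda>y. f y *\<^sub>R X y) Y x = f x *\<^sub>R D X Y x)) \<and>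
     (\<forall>X\<in>vfields V. \<forall>Y\<in>vfields V. \<forall>Y'\<in>vfields V. \<forall>x\<in>V.
        D X (\<lambda>y. Y y + Y' y) x = D X Y x + D X Y' x) \<and>
     (\<forall>f. smooth_on V f \<longrightarrow> (\<forall>X\<in>vfields V. \<forall>Y\<in>vfields V. \<forall>x\<in>V.
        D X (\<lambda>y. f y *\<^sub>R Y y) x = dirder X f x *\<^sub>R Y x + f x *\<^sub>R D X Y x)) \<and>
     (\<forall>X\<in>vfields V. \<forall>Y\<in>vfields V. \<forall>x\<in>V. D X Y x - D Y X x = lie_bracket X Y x) \<and>
     (\<forall>X\<in>vfields V. \<forall>Y\<in>vfields V. \<forall>Z\<in>vfields V. \<forall>x\<in>V.
        dirder X (\<lambda>y. g y (Y y) (Z y)) x = g x (D X Y x) (Z x) + g x (Y x) (D X Z x))"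

text \<open>The connection of the manifold is given through its restrictions to the chart domains; these
  agree on overlaps by uniqueness.\<close>

type_synonym ('a, 'n) connection_rep =
  "('a, 'n) chart \<Rightarrow> ((real, 'n) vec \<Rightarrow> (real, 'n) vec) \<Rightarrow>
     ((real, 'n) vec \<Rightarrow> (real, 'n) vec) \<Rightarrow> (real, 'n) vec \<Rightarrow> (real, 'n) vec"

definition levi_civita ::
    "('a, 'n::finite) chart set \<Rightarrow> ('a, 'n) cov2_rep \<Rightarrow> ('a, 'n) connection_rep \<Rightarrow> bool" where
  "levi_civita A g D \<longleftrightarrow> (\<forall>c\<in>A. levi_civita_on (chart_image c) (g c) (D c))"

definition cov_deriv_endo ::
    "(('v \<Rightarrow> 'v) \<Rightarrow> ('v \<Rightarrow> 'v) \<Rightarrow> ('v \<Rightarrow> 'v)) \<Rightarrow> ('v \<Rightarrow> 'v \<Rightarrow> 'v) \<Rightarrow>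
      ('v \<Rightarrow> 'v) \<Rightarrow> ('v \<Rightarrow> 'v) \<Rightarrow> 'v::real_normed_vector \<Rightarrow> 'v" where
  "cov_deriv_endo D \<phi> X Y x = D X (\<lambda>y. \<phi> y (Y y)) x - \<phi> x (D X Y x)"

definition almost_contact_metric ::
    "('a::topological_space, 'n::finite) chart set \<Rightarrow> ('a, 'n) endo_rep \<Rightarrow> ('a, 'n) vector_rep \<Rightarrow>
      ('a, 'n) cov1_rep \<Rightarrow> ('a, 'n) cov2_rep \<Rightarrow> bool" where
  "almost_contact_metric A \<phi> \<xi> \<eta> g \<longleftrightarrow>
     endo_field A \<phi> \<and> vector_field A \<xi> \<and> one_form A \<eta> \<and> riemannian_metric A g \<and>
     (\<forall>c\<in>A. \<forall>x\<in>chart_image c.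
        (\<forall>u. \<phi> c x (\<phi> c x u) = - u + \<eta> c x u *\<^sub>R \<xi> c x) \<and>
        \<eta> c x (\<xi> c x) = 1 \<and>
        (\<forall>u v. g c x (\<phi> c x u) (\<phi> c x v) = g c x u v - \<eta> c x u * \<eta> c x v))"

text \<open>In the next two definitions \<open>D\<close> is meant to be the Levi-Civita connection of \<open>g\<close>.\<close>

definition cokaehler ::
    "('a::topological_space, 'n::finite) chart set \<Rightarrow> ('a, 'n) connection_rep \<Rightarrow>
      ('a, 'n) endo_rep \<Rightarrow> ('a, 'n) vector_rep \<Rightarrow> ('a, 'n) cov1_rep \<Rightarrow> ('a, 'n) cov2_rep \<Rightarrow> bool" where
  "cokaehler A D \<phi> \<xi> \<eta> g \<longleftrightarrow> almost_contact_metric A \<phi> \<xi> \<eta> g \<and>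
     (\<forall>c\<in>A. \<forall>X\<in>vfields (chart_image c). \<forall>Y\<in>vfields (chart_image c). \<forall>x\<in>chart_image c.
        cov_deriv_endo (D c) (\<phi> c) X Y x = 0)"

definition nearly_cosymplectic ::
    "('a::topological_space, 'n::finite) chart set \<Rightarrow> ('a, 'n) connection_rep \<Rightarrow>
      ('a, 'n) endo_rep \<Rightarrow> ('a, 'n) vector_rep \<Rightarrow> ('a, 'n) cov1_rep \<Rightarrow> ('a, 'n) cov2_rep \<Rightarrow> bool" where
  "nearly_cosymplectic A D \<phi> \<xi> \<eta> g \<longleftrightarrow> almost_contact_metric A \<phi> \<xi> \<eta> g \<and>
     (\<forall>c\<in>A. \<forall>X\<in>vfields (chart_image c). \<forall>Y\<in>vfields (chart_image c). \<forall>x\<in>chart_image c.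
        cov_deriv_endo (D c) (\<phi> c) X Y x + cov_deriv_endo (D c) (\<phi> c) Y X x = 0)"

text \<open>An SU(2)-structure is given by three almost contact metric structures sharing \<open>\<xi>, \<eta>, g\<close> and
  satisfying the quaternionic relations. The 2-forms of the associated quadruplet
  \<open>(\<eta>, \<omega>\<^sub>1, \<omega>\<^sub>2, \<omega>\<^sub>3)\<close> are \<open>\<omega>\<^sub>i = fundamental_form g \<phi>\<^sub>i\<close>.\<close>

definition su2_structure ::
    "('a::topological_space, 5) chart set \<Rightarrow>
      ('a, 5) endo_rep \<Rightarrow> ('a, 5) endo_rep \<Rightarrow> ('a, 5) endo_rep \<Rightarrow>
      ('a, 5) vector_rep \<Rightarrow> ('a, 5) cov1_rep \<Rightarrow> ('a, 5) cov2_rep \<Rightarrow> bool" where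
  "su2_structure A \<phi>\<^sub>1 \<phi>\<^sub>2 \<phi>\<^sub>3 \<xi> \<eta> g \<longleftrightarrow>
     almost_contact_metric A \<phi>\<^sub>1 \<xi> \<eta> g \<and>
     almost_contact_metric A \<phi>\<^sub>2 \<xi> \<eta> g \<and>
     almost_contact_metric A \<phi>\<^sub>3 \<xi> \<eta> g \<and>
     (\<forall>c\<in>A. \<forall>x\<in>chart_image c. \<forall>u.
        \<phi>\<^sub>1 c x (\<phi>\<^sub>2 c x u) = \<phi>\<^sub>3 c x u \<and> \<phi>\<^sub>3 c x u = - \<phi>\<^sub>2 c x (\<phi>\<^sub>1 c x u) \<and>
        \<phi>\<^sub>2 c x (\<phi>\<^sub>3 c x u) = \<phi>\<^sub>1 c x u \<and> \<phi>\<^sub>1 c x u = - \<phi>\<^sub>3 c x (\<phi>\<^sub>2 c x u) \<and>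
        \<phi>\<^sub>3 c x (\<phi>\<^sub>1 c x u) = \<phi>\<^sub>2 c x u \<and> \<phi>\<^sub>2 c x u = - \<phi>\<^sub>1 c x (\<phi>\<^sub>3 c x u))"

definition fundamental_form :: "('a, 'n) cov2_rep \<Rightarrow> ('a, 'n) endo_rep \<Rightarrow> ('a, 'n) cov2_rep" where
  "fundamental_form g \<phi> c x u v = g c x (\<phi> c x u) v"

definition hypo ::
    "('a, 5) chart set \<Rightarrow>
      ('a, 5) cov1_rep \<Rightarrow> ('a, 5) cov2_rep \<Rightarrow> ('a, 5) cov2_rep \<Rightarrow> ('a, 5) cov2_rep \<Rightarrow> bool" where
  "hypo A \<eta> \<omega>\<^sub>1 \<omega>\<^sub>2 \<omega>\<^sub>3 \<longleftrightarrow>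
     has_ext_deriv2 A \<omega>\<^sub>3 (\<lambda>c x u v w. 0) \<and>
     has_ext_deriv3 A (wedge12 \<eta> \<omega>\<^sub>1) (\<lambda>c x u v w z. 0) \<and>
     has_ext_deriv3 A (wedge12 \<eta> \<omega>\<^sub>2) (\<lambda>c x u v w z. 0)"

definition structure_equations ::
    "('a, 5) chart set \<Rightarrow> real \<Rightarrow>
      ('a, 5) cov1_rep \<Rightarrow> ('a, 5) cov2_rep \<Rightarrow> ('a, 5) cov2_rep \<Rightarrow> ('a, 5) cov2_rep \<Rightarrow> bool" where
  "structure_equations A l \<eta> \<omega>\<^sub>1 \<omega>\<^sub>2 \<omega>\<^sub>3 \<longleftrightarrow>
     has_ext_deriv1 A \<eta> (\<lambda>c x u v. - 2 * l * \<omega>\<^sub>3 c x u v) \<and>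
     has_ext_deriv2 A \<omega>\<^sub>1 (\<lambda>c x u v w. 3 * l * wedge12 \<eta> \<omega>\<^sub>2 c x u v w) \<and>
     has_ext_deriv2 A \<omega>\<^sub>2 (\<lambda>c x u v w. - 3 * l * wedge12 \<eta> \<omega>\<^sub>1 c x u v w)"

end

theory Submission
  imports Defs
begin

text \<open>Let \<open>h = \<nabla>\<xi>\<close>. For a nearly cosymplectic structure \<open>g ((\<nabla>\<^sub>X \<phi>) Y) Z\<close> is a 3-form; in dimension 5,
  differentiating \<open>\<phi>\<^sup>2 = - I + \<eta> \<otimes> \<xi>\<close> shows that it equals \<open>\<eta> \<and> \<alpha>\<close> with \<open>\<alpha> = g (\<phi> h \<cdot>) \<cdot>\<close>, that \<open>h\<close> is skew
  and anticommutes with \<open>\<phi>\<close>, and that \<open>h\<^sup>2 = - L (I - \<eta> \<otimes> \<xi>)\<close> for a function \<open>L\<close>. Hence \<open>d\<eta> = 2 \<theta>\<close> with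
  \<open>\<theta> = g (h \<cdot>) \<cdot>\<close> and \<open>d\<omega> = 3 \<eta> \<and> \<alpha>\<close>. From \<open>d\<theta> = 0\<close> one gets \<open>\<nabla>\<^sub>\<xi> h = 0\<close>, and \<open>d(d\<omega>) = 0\<close> with
  \<open>\<theta> \<and> \<alpha> = 0\<close> then gives \<open>d\<alpha> = - 3 L \<eta> \<and> \<omega>\<close>. Now \<open>d(d\<alpha>) = 0\<close> and \<open>\<theta> \<and> \<omega> = 0\<close> force \<open>dL\<close> to vanish on
  the kernel of \<open>\<eta>\<close>, while \<open>\<nabla>\<^sub>\<xi> h = 0\<close> gives \<open>dL \<xi> = 0\<close>. So \<open>L = \<lambda>\<^sup>2\<close> is constant, nonzero unless
  \<open>\<nabla>\<phi> = 0\<close>, and \<open>\<phi>\<^sub>3 = - h / \<lambda>\<close>, \<open>\<phi>\<^sub>2 = \<phi>\<close>, \<open>\<phi>\<^sub>1 = \<phi> \<phi>\<^sub>3\<close> is the required SU(2)-structure. Conversely, \<open>d\<eta>\<close>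
  and the \<open>d\<omega>\<^sub>i\<close> determine \<open>\<nabla>\<xi>\<close> and \<open>\<nabla>\<phi>\<^sub>i\<close> at each point through a linear system, whose solution has
  \<open>g ((\<nabla>\<^sub>X \<phi>\<^sub>2) Y) Z = - \<lambda> (\<eta> \<and> \<omega>\<^sub>1) X Y Z\<close>.\<close>

section \<open>Smooth functions and directional derivatives\<close>

text \<open>Analysis and algebra are kept apart: in a chart, \<nabla>\<phi>, \<nabla>\<xi> and all
  exterior derivatives become multilinear maps on a single tangent space, and those maps are
  computed in an adapted orthonormal frame. Dimension 5 acts twice through the complex dimension 2
  of ker \<eta>: alternating complex 3-forms vanish there, and the skew maps anticommuting with
  \<phi> form a real plane, so that \<open>h\<close> has a scalar square and \<theta> is
  wedge-orthogonal to \<alpha> and \<omega>. The obstacle on the manifold is that the connection is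
  given separately in each chart, with nothing stated about overlaps. So \<open>h\<close> is
  recovered from d\<eta>, which is natural under coordinate changes, and \<open>L\<close> from
  \<open>h\<close>. The factor 3 in d\<omega> is the cyclic sum of a totally skew \<nabla>\<omega>;
  the sign in -h/\<lambda> comes from matching d\<eta> = 2\<theta> with the required structure
  equation.\<close>

lemma Ck_on_Suc_imp:
  "Ck_on (Suc k) V f \<Longrightarrow> Ck_on k V f"
proof (induction k arbitrary: f)
  case 0
  then show ?case
    by (metis Ck_on.simps continuous_at_imp_continuous_on differentiable_imp_continuous_within)
next
  case (Suc k)
  have "Ck_on k V (\<lambda>x. frechet_derivative f (at x) v)" for v
    using Suc.prems by (intro Suc.IH) simp
  then show ?case
    using Suc.prems by simp
qed

text \<open>Openness lets the values on \<open>V\<close> alone decide all derivatives at points of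
  \<open>V\<close>. Representatives carry no information outside their chart image, so identities
  valid only on \<open>V\<close> are transferred through this congruence.\<close>

lemma Ck_on_cong:
  assumes "open V" "\<And>x. x \<in> V \<Longrightarrow> f x = h x" "Ck_on k V f"
  shows "Ck_on k V h"
  using assms(2,3)
proof (induction k arbitrary: f h)
  case 0
  then show ?case
    by (metis Ck_on.simps(1) continuous_on_cong)
next
  case (Suc k)
  have fd: "frechet_derivative h (at x) = frechet_derivative f (at x)" if "x \<in> V" for x
    using frechet_derivative_transform_within_open[of f x V h] Suc.prems assms(1) that by simp
  have "h differentiable (at x)" if "x \<in> V" for x
  proof -
    have "(f has_derivative frechet_derivative f (at x)) (at x)"
      using Suc.prems that by (simp add: frechet_derivative_works)
    from has_derivative_transform_within_open[OF this assms(1) that] Suc.prems(1)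
    show ?thesis by (auto simp: differentiable_def)
  qed
  moreover have "Ck_on k V (\<lambda>x. frechet_derivative h (at x) v)" for v
    by (rule Suc.IH[of "\<lambda>x. frechet_derivative f (at x) v"]) (use Suc.prems fd in auto)
  ultimately show ?case by simp
qed

lemma frechet_derivative_scaleR:
  fixes f :: "'a::real_normed_vector \<Rightarrow> real" and X :: "'a \<Rightarrow> 'b::real_normed_vector"
  assumes "f differentiable (at x)" "X differentiable (at x)"
  shows "frechet_derivative (\<lambda>y. f y *\<^sub>R X y) (at x) v =
    f x *\<^sub>R frechet_derivative X (at x) v + frechet_derivative f (at x) v *\<^sub>R X x"
proof -
  have "((\<lambda>y. f y *\<^sub>R X y) has_derivative
      (\<lambda>v. f x *\<^sub>R frechet_derivative X (at x) v + frechet_derivative f (at x) v *\<^sub>R X x)) (at x)"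
    using assms by (intro has_derivative_scaleR) (auto simp: frechet_derivative_works)
  then show ?thesis
    by (rule fun_cong[OF frechet_derivative_at, symmetric])
qed

lemma frechet_derivative_add:
  assumes "f differentiable (at x)" "h differentiable (at x)"
  shows "frechet_derivative (\<lambda>y. f y + h y) (at x) v =
    frechet_derivative f (at x) v + frechet_derivative h (at x) v"
proof -
  have "((\<lambda>y. f y + h y) has_derivative
      (\<lambda>v. frechet_derivative f (at x) v + frechet_derivative h (at x) v)) (at x)"
    using assms by (intro has_derivative_add) (auto simp: frechet_derivative_works)
  then show ?thesis
    by (rule fun_cong[OF frechet_derivative_at, symmetric])
qed

lemma frechet_derivative_diff:
  assumes "f differentiable (at x)" "h differentiable (at x)"
  shows "frechet_derivative (\<lambda>y. f y - h y) (at x) v =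
    frechet_derivative f (at x) v - frechet_derivative h (at x) v"
proof -
  have "((\<lambda>y. f y - h y) has_derivative
      (\<lambda>v. frechet_derivative f (at x) v - frechet_derivative h (at x) v)) (at x)"
    using assms by (intro has_derivative_diff) (auto simp: frechet_derivative_works)
  then show ?thesis
    by (rule fun_cong[OF frechet_derivative_at, symmetric])
qed

lemma frechet_derivative_uminus:
  assumes "f differentiable (at x)"
  shows "frechet_derivative (\<lambda>y. - f y) (at x) v = - frechet_derivative f (at x) v"
  using frechet_derivative_diff[of "\<lambda>_. 0" x f v] assms by simp

lemma frechet_derivative_bounded_linear:
  assumes "bounded_linear T" "f differentiable (at x)"
  shows "frechet_derivative (\<lambda>y. T (f y)) (at x) v = T (frechet_derivative f (at x) v)"
proof -
  have "((\<lambda>y. T (f y)) has_derivative (\<lambda>v. T (frechet_derivative f (at x) v))) (at x)"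
    by (rule bounded_linear.has_derivative[OF assms(1)]) (use assms(2) in \<open>simp add: frechet_derivative_works\<close>)
  then show ?thesis
    by (rule fun_cong[OF frechet_derivative_at, symmetric])
qed

lemma frechet_derivative_mult:
  fixes f h :: "'a::real_normed_vector \<Rightarrow> real"
  assumes "f differentiable (at x)" "h differentiable (at x)"
  shows "frechet_derivative (\<lambda>y. f y * h y) (at x) v =
    f x * frechet_derivative h (at x) v + frechet_derivative f (at x) v * h x"
  using frechet_derivative_scaleR[OF assms] by simp

lemma Ck_on_const: "Ck_on k V (\<lambda>x. c)"
  by (induction k arbitrary: c) auto

lemma Ck_on_add:
  assumes "open V" "Ck_on k V f" "Ck_on k V h"
  shows "Ck_on k V (\<lambda>x. f x + h x)"
  using assms(2,3)
proof (induction k arbitrary: f h)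
  case 0
  then show ?case by (simp add: continuous_on_add)
next
  case (Suc k)
  have "Ck_on k V (\<lambda>x. frechet_derivative (\<lambda>y. f y + h y) (at x) v)" for v
    by (rule Ck_on_cong[OF assms(1) _ Suc.IH[of "\<lambda>x. frechet_derivative f (at x) v"
            "\<lambda>x. frechet_derivative h (at x) v"]])
      (use Suc.prems in \<open>auto simp: frechet_derivative_add\<close>)
  then show ?case
    using Suc.prems by auto
qed

lemma Ck_on_scaleR:
  fixes f :: "'a::real_normed_vector \<Rightarrow> real"
  assumes "open V" "Ck_on k V f" "Ck_on k V X"
  shows "Ck_on k V (\<lambda>x. f x *\<^sub>R X x)"
  using assms(2,3)
proof (induction k arbitrary: f X)
  case 0
  then show ?case by (simp add: continuous_on_scaleR)
next
  case (Suc k)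
  have "Ck_on k V (\<lambda>x. frechet_derivative (\<lambda>y. f y *\<^sub>R X y) (at x) v)" for v
  proof (rule Ck_on_cong[OF assms(1)])
    show "Ck_on k V (\<lambda>x. f x *\<^sub>R frechet_derivative X (at x) v + frechet_derivative f (at x) v *\<^sub>R X x)"
      using Suc.prems Ck_on_Suc_imp by (intro Ck_on_add assms Suc.IH) (auto intro: Ck_on_Suc_imp)
  qed (use Suc.prems in \<open>simp add: frechet_derivative_scaleR\<close>)
  then show ?case
    using Suc.prems by (auto intro: differentiable_scaleR)
qed

lemma Ck_on_bounded_linear:
  assumes "open V" "bounded_linear T" "Ck_on k V f"
  shows "Ck_on k V (\<lambda>x. T (f x))"
  using assms(3)
proof (induction k arbitrary: f)
  case 0
  then show ?case
    using assms(2) by (simp add: bounded_linear.continuous_on)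
next
  case (Suc k)
  have "Ck_on k V (\<lambda>x. frechet_derivative (\<lambda>y. T (f y)) (at x) v)" for v
    by (rule Ck_on_cong[OF assms(1) _ Suc.IH[of "\<lambda>x. frechet_derivative f (at x) v"]])
      (use Suc.prems in \<open>auto simp: frechet_derivative_bounded_linear[OF assms(2)]\<close>)
  moreover have "(\<lambda>x. T (f x)) differentiable (at x)" if "x \<in> V" for x
  proof -
    have "(f has_derivative frechet_derivative f (at x)) (at x)"
      using Suc.prems that by (simp add: frechet_derivative_works)
    from bounded_linear.has_derivative[OF assms(2) this] show ?thesis
      by (auto simp: differentiable_def)
  qed
  ultimately show ?case
    by auto
qed

lemma smooth_on_cong:
  "open V \<Longrightarrow> (\<And>x. x \<in> V \<Longrightarrow> f x = h x) \<Longrightarrow> smooth_on V f \<Longrightarrow> smooth_on V h"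
  unfolding smooth_on_def using Ck_on_cong by blast

lemma smooth_on_const [simp]: "smooth_on V (\<lambda>x. c)"
  by (simp add: smooth_on_def Ck_on_const)

lemma smooth_on_add:
  "open V \<Longrightarrow> smooth_on V f \<Longrightarrow> smooth_on V h \<Longrightarrow> smooth_on V (\<lambda>x. f x + h x)"
  by (simp add: smooth_on_def Ck_on_add)

lemma smooth_on_scaleR:
  fixes f :: "'a::real_normed_vector \<Rightarrow> real"
  shows "open V \<Longrightarrow> smooth_on V f \<Longrightarrow> smooth_on V X \<Longrightarrow> smooth_on V (\<lambda>x. f x *\<^sub>R X x)"
  by (simp add: smooth_on_def Ck_on_scaleR)

lemma smooth_on_mult:
  fixes f h :: "'a::real_normed_vector \<Rightarrow> real"
  shows "open V \<Longrightarrow> smooth_on V f \<Longrightarrow> smooth_on V h \<Longrightarrow> smooth_on V (\<lambda>x. f x * h x)"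
  using smooth_on_scaleR[of V f h] by simp

lemma smooth_on_bounded_linear:
  "open V \<Longrightarrow> bounded_linear T \<Longrightarrow> smooth_on V f \<Longrightarrow> smooth_on V (\<lambda>x. T (f x))"
  by (simp add: smooth_on_def Ck_on_bounded_linear)

lemma smooth_on_sum:
  "open V \<Longrightarrow> (\<And>i. i \<in> I \<Longrightarrow> smooth_on V (f i)) \<Longrightarrow> smooth_on V (\<lambda>x. \<Sum>i\<in>I. f i x)"
  by (induction I rule: infinite_finite_induct) (auto intro: smooth_on_add)

lemma smooth_on_inner:
  "open V \<Longrightarrow> smooth_on V f \<Longrightarrow> smooth_on V (\<lambda>x. f x \<bullet> b)"
  by (rule smooth_on_bounded_linear[where T="\<lambda>x. x \<bullet> b"]) (auto intro: bounded_linear_inner_left)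

lemma smooth_on_subset:
  assumes "smooth_on V f" "W \<subseteq> V"
  shows "smooth_on W f"
proof -
  have "Ck_on k W h" if "Ck_on k V h" for k and h :: "'a \<Rightarrow> 'b"
    using that assms(2) by (induction k arbitrary: h) (auto intro: continuous_on_subset)
  then show ?thesis using assms(1) by (simp add: smooth_on_def)
qed

lemma smooth_on_differentiable:
  "smooth_on V f \<Longrightarrow> x \<in> V \<Longrightarrow> f differentiable (at x)"
  unfolding smooth_on_def by (metis Ck_on.simps(2))

lemma smooth_on_frechet_derivative:
  "smooth_on V f \<Longrightarrow> smooth_on V (\<lambda>x. frechet_derivative f (at x) v)"
  unfolding smooth_on_def by (metis Ck_on.simps(2))

lemma smooth_on_continuous_on:
  "smooth_on V f \<Longrightarrow> continuous_on V f"
  unfolding smooth_on_def by (metis Ck_on.simps(1))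

text \<open>Smoothness of a field of linear maps is assumed for constant arguments only. Expanding
  \<open>Y x\<close> in the basis turns a moving argument into a finite sum of products of smooth
  functions, so no norm on the space of linear maps is involved.\<close>

lemma smooth_on_linear_apply:
  fixes Y :: "'a::real_normed_vector \<Rightarrow> 'b::euclidean_space"
  assumes "open V" "\<And>x. x \<in> V \<Longrightarrow> linear (A x)" "\<And>u. smooth_on V (\<lambda>x. A x u)" "smooth_on V Y"
  shows "smooth_on V (\<lambda>x. A x (Y x))"
proof (rule smooth_on_cong[OF assms(1)])
  show "smooth_on V (\<lambda>x. \<Sum>b\<in>Basis. (Y x \<bullet> b) *\<^sub>R A x b)"
    using assms by (intro smooth_on_sum smooth_on_scaleR smooth_on_inner) auto
  fix x assume "x \<in> V"
  then interpret linear "A x" using assms by blast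
  have "A x (Y x) = A x (\<Sum>b\<in>Basis. (Y x \<bullet> b) *\<^sub>R b)"
    by (simp add: euclidean_representation)
  then show "(\<Sum>b\<in>Basis. (Y x \<bullet> b) *\<^sub>R A x b) = A x (Y x)"
    by (simp add: sum scaleR)
qed

lemma smooth_on_bilinear_apply:
  fixes Y :: "'a::real_normed_vector \<Rightarrow> 'b::euclidean_space" and Z :: "'a \<Rightarrow> 'c::euclidean_space"
  assumes "open V" "\<And>x. x \<in> V \<Longrightarrow> bilinear (B x)" "\<And>u v. smooth_on V (\<lambda>x. B x u v)"
    "smooth_on V Y" "smooth_on V Z"
  shows "smooth_on V (\<lambda>x. B x (Y x) (Z x))"
proof (rule smooth_on_linear_apply[OF assms(1) _ _ assms(5)])
  show "linear (B x (Y x))" if "x \<in> V" for x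
    using assms(2)[OF that] by (simp add: bilinear_def)
  show "smooth_on V (\<lambda>x. B x (Y x) u)" for u
    by (rule smooth_on_linear_apply[OF assms(1) _ _ assms(4), where A="\<lambda>x y. B x y u"])
      (use assms in \<open>auto simp: bilinear_def\<close>)
qed

text \<open>The basis expansion also gives the product rule for a moving map at a moving argument;
  the first summand differentiates the map with the argument frozen at \<open>Y x\<close>.\<close>

lemma has_derivative_linear_apply:
  fixes Y :: "'a::real_normed_vector \<Rightarrow> 'b::euclidean_space" and A :: "'a \<Rightarrow> 'b \<Rightarrow> 'c::real_normed_vector"
  assumes "open V" "x \<in> V" "\<And>x. x \<in> V \<Longrightarrow> linear (A x)"
    and A: "\<And>u. (\<lambda>x. A x u) differentiable (at x)" and Y: "Y differentiable (at x)"
  shows "((\<lambda>x. A x (Y x)) has_derivative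
    (\<lambda>w. frechet_derivative (\<lambda>y. A y (Y x)) (at x) w + A x (frechet_derivative Y (at x) w))) (at x)"
proof -
  have lin: "A y v = (\<Sum>b\<in>Basis. (v \<bullet> b) *\<^sub>R A y b)" if "y \<in> V" for y v
  proof -
    interpret linear "A y" using assms that by blast
    have "A y v = A y (\<Sum>b\<in>Basis. (v \<bullet> b) *\<^sub>R b)"
      by (simp add: euclidean_representation)
    then show ?thesis by (simp add: sum scaleR)
  qed
  have dA: "((\<lambda>y. A y u) has_derivative frechet_derivative (\<lambda>y. A y u) (at x)) (at x)" for u
    using A by (simp add: frechet_derivative_works)
  have dY: "(Y has_derivative frechet_derivative Y (at x)) (at x)"
    using Y by (simp add: frechet_derivative_works)
  have D: "((\<lambda>y. \<Sum>b\<in>Basis. (Y y \<bullet> b) *\<^sub>R A y b) has_derivative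
     (\<lambda>w. \<Sum>b\<in>Basis. (Y x \<bullet> b) *\<^sub>R frechet_derivative (\<lambda>y. A y b) (at x) w +
         (frechet_derivative Y (at x) w \<bullet> b) *\<^sub>R A x b)) (at x)"
    by (intro has_derivative_sum has_derivative_scaleR has_derivative_inner_left dA dY)
  have "((\<lambda>y. \<Sum>b\<in>Basis. (Y x \<bullet> b) *\<^sub>R A y b) has_derivative
     (\<lambda>w. \<Sum>b\<in>Basis. (Y x \<bullet> b) *\<^sub>R frechet_derivative (\<lambda>y. A y b) (at x) w)) (at x)"
    by (intro has_derivative_sum has_derivative_scaleR_right dA)
  then have "((\<lambda>y. A y (Y x)) has_derivative
     (\<lambda>w. \<Sum>b\<in>Basis. (Y x \<bullet> b) *\<^sub>R frechet_derivative (\<lambda>y. A y b) (at x) w)) (at x)"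
    by (rule has_derivative_transform_within_open[OF _ assms(1,2)]) (rule lin[symmetric])
  then have fA: "frechet_derivative (\<lambda>y. A y (Y x)) (at x) =
     (\<lambda>w. \<Sum>b\<in>Basis. (Y x \<bullet> b) *\<^sub>R frechet_derivative (\<lambda>y. A y b) (at x) w)"
    by (rule frechet_derivative_at[symmetric])
  have "((\<lambda>y. A y (Y y)) has_derivative
     (\<lambda>w. \<Sum>b\<in>Basis. (Y x \<bullet> b) *\<^sub>R frechet_derivative (\<lambda>y. A y b) (at x) w +
         (frechet_derivative Y (at x) w \<bullet> b) *\<^sub>R A x b)) (at x)"
    by (rule has_derivative_transform_within_open[OF D assms(1,2)]) (rule lin[symmetric])
  moreover have "(\<lambda>w. \<Sum>b\<in>Basis. (Y x \<bullet> b) *\<^sub>R frechet_derivative (\<lambda>y. A y b) (at x) w +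
         (frechet_derivative Y (at x) w \<bullet> b) *\<^sub>R A x b) =
     (\<lambda>w. frechet_derivative (\<lambda>y. A y (Y x)) (at x) w + A x (frechet_derivative Y (at x) w))"
    by (subst lin[OF assms(2)]) (simp add: fA sum.distrib)
  ultimately show ?thesis by simp
qed

lemma frechet_derivative_linear_apply:
  fixes Y :: "'a::real_normed_vector \<Rightarrow> 'b::euclidean_space" and A :: "'a \<Rightarrow> 'b \<Rightarrow> 'c::real_normed_vector"
  assumes "open V" "x \<in> V" "\<And>x. x \<in> V \<Longrightarrow> linear (A x)"
    and "\<And>u. (\<lambda>x. A x u) differentiable (at x)" and "Y differentiable (at x)"
  shows "frechet_derivative (\<lambda>x. A x (Y x)) (at x) w =
    frechet_derivative (\<lambda>y. A y (Y x)) (at x) w + A x (frechet_derivative Y (at x) w)"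
  by (rule fun_cong[OF frechet_derivative_at[OF has_derivative_linear_apply[OF assms]], symmetric])

lemma frechet_derivative_linear_apply_linear:
  fixes A :: "'a::real_normed_vector \<Rightarrow> 'b::euclidean_space \<Rightarrow> 'c::real_normed_vector"
  assumes "open V" "x \<in> V" "\<And>x. x \<in> V \<Longrightarrow> linear (A x)"
    and A: "\<And>u. (\<lambda>x. A x u) differentiable (at x)"
  shows "linear (\<lambda>u. frechet_derivative (\<lambda>y. A y u) (at x) w)"
proof (rule linearI)
  fix u v and r :: real
  have "frechet_derivative (\<lambda>y. A y (u + v)) (at x) w = frechet_derivative (\<lambda>y. A y u + A y v) (at x) w"
    by (rule fun_cong[OF frechet_derivative_transform_within_open[OF _ assms(1,2)], symmetric])
      (use A assms(3) in \<open>auto simp: linear_add\<close>)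
  then show "frechet_derivative (\<lambda>y. A y (u + v)) (at x) w =
      frechet_derivative (\<lambda>y. A y u) (at x) w + frechet_derivative (\<lambda>y. A y v) (at x) w"
    using A by (simp add: frechet_derivative_add)
  have "frechet_derivative (\<lambda>y. A y (r *\<^sub>R u)) (at x) w = frechet_derivative (\<lambda>y. r *\<^sub>R A y u) (at x) w"
  proof -
    have "(\<lambda>y. r *\<^sub>R A y u) differentiable at x"
      using A by (intro differentiable_scaleR) auto
    then have "frechet_derivative (\<lambda>y. r *\<^sub>R A y u) (at x) = frechet_derivative (\<lambda>y. A y (r *\<^sub>R u)) (at x)"
      by (rule frechet_derivative_transform_within_open[OF _ assms(1,2)]) (use assms(3) in \<open>auto simp: linear_scale\<close>)
    then show ?thesis by simp
  qed
  then show "frechet_derivative (\<lambda>y. A y (r *\<^sub>R u)) (at x) w = r *\<^sub>R frechet_derivative (\<lambda>y. A y u) (at x) w"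
    using A by (simp add: frechet_derivative_scaleR)
qed

lemma frechet_derivative_bilinear_apply:
  fixes Y :: "'a::real_normed_vector \<Rightarrow> 'b::euclidean_space" and Z :: "'a \<Rightarrow> 'd::euclidean_space"
    and B :: "'a \<Rightarrow> 'b \<Rightarrow> 'd \<Rightarrow> 'c::real_normed_vector"
  assumes "open V" "x \<in> V" and bil: "\<And>x. x \<in> V \<Longrightarrow> bilinear (B x)"
    and B: "\<And>u v. (\<lambda>x. B x u v) differentiable (at x)"
    and "Y differentiable (at x)" "Z differentiable (at x)"
  shows "frechet_derivative (\<lambda>x. B x (Y x) (Z x)) (at x) w =
    frechet_derivative (\<lambda>y. B y (Y x) (Z x)) (at x) w + B x (frechet_derivative Y (at x) w) (Z x)
     + B x (Y x) (frechet_derivative Z (at x) w)"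
proof -
  have 1: "((\<lambda>x. B x (Y x) u) has_derivative
    (\<lambda>w. frechet_derivative (\<lambda>y. B y (Y x) u) (at x) w + B x (frechet_derivative Y (at x) w) u)) (at x)" for u
    by (rule has_derivative_linear_apply[OF assms(1,2), where A="\<lambda>x y. B x y u"])
      (use assms in \<open>auto simp: bilinear_def\<close>)
  have "frechet_derivative (\<lambda>x. B x (Y x) (Z x)) (at x) w =
     frechet_derivative (\<lambda>y. B y (Y y) (Z x)) (at x) w + B x (Y x) (frechet_derivative Z (at x) w)"
    by (rule frechet_derivative_linear_apply[OF assms(1,2)])
      (use assms(3,6) differentiableI[OF 1] in \<open>auto simp: bilinear_def\<close>)
  moreover have "frechet_derivative (\<lambda>y. B y (Y y) (Z x)) (at x) w =
      frechet_derivative (\<lambda>y. B y (Y x) (Z x)) (at x) w + B x (frechet_derivative Y (at x) w) (Z x)"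
    by (rule fun_cong[OF frechet_derivative_at[OF 1], symmetric])
  ultimately show ?thesis by simp
qed

section \<open>Symmetry of second derivatives\<close>

lemma second_difference_mean_value:
  fixes f :: "'a::real_normed_vector \<Rightarrow> real"
  assumes r: "\<And>s t. 0 \<le> s \<Longrightarrow> s \<le> r \<Longrightarrow> 0 \<le> t \<Longrightarrow> t \<le> r \<Longrightarrow> x + s *\<^sub>R u + t *\<^sub>R v \<in> V"
    and "0 < r" and f: "\<And>y. y \<in> V \<Longrightarrow> f differentiable (at y)"
    and fu: "\<And>y. y \<in> V \<Longrightarrow> (\<lambda>y. frechet_derivative f (at y) u) differentiable (at y)"
  obtains s t where "0 < s" "s < r" "0 < t" "t < r"
    "f (x + r *\<^sub>R u + r *\<^sub>R v) - f (x + r *\<^sub>R u) - f (x + r *\<^sub>R v) + f x =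
     r\<^sup>2 * frechet_derivative (\<lambda>y. frechet_derivative f (at y) u) (at (x + s *\<^sub>R u + t *\<^sub>R v)) v"
proof -
  have path: "((\<lambda>t. F (a + t *\<^sub>R w)) has_real_derivative frechet_derivative F (at (a + t *\<^sub>R w)) w) (at t)"
    if "F differentiable (at (a + t *\<^sub>R w))" for F :: "'a \<Rightarrow> real" and a w t
  proof -
    have F: "(F has_derivative frechet_derivative F (at (a + t *\<^sub>R w))) (at (a + t *\<^sub>R w))"
      using that by (simp add: frechet_derivative_works)
    have "((\<lambda>t. a + t *\<^sub>R w) has_derivative (\<lambda>h. h *\<^sub>R w)) (at t)"
      by (auto intro!: derivative_eq_intros)
    from has_derivative_compose[OF this F]
    have "((\<lambda>t. F (a + t *\<^sub>R w)) has_derivative (\<lambda>h. frechet_derivative F (at (a + t *\<^sub>R w)) (h *\<^sub>R w))) (at t)" .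
    moreover have "frechet_derivative F (at (a + t *\<^sub>R w)) (h *\<^sub>R w) = frechet_derivative F (at (a + t *\<^sub>R w)) w * h" for h
      using linear_frechet_derivative[OF that] by (simp add: linear_scale)
    ultimately show ?thesis
      by (simp add: has_field_derivative_def)
  qed
  \<comment> \<open>\<open>G\<close> is the difference across one side of a parallelogram, so
    \<open>G r - G 0\<close> is the full second difference. A mean value theorem along
    \<open>u\<close> and another along \<open>v\<close> leave one mixed derivative at an interior
    point.\<close>
  define G where "G s = f (x + r *\<^sub>R v + s *\<^sub>R u) - f (x + s *\<^sub>R u)" for s
  have "(G has_real_derivative frechet_derivative f (at (x + r *\<^sub>R v + s *\<^sub>R u)) u -
      frechet_derivative f (at (x + s *\<^sub>R u)) u) (at s)" if "0 \<le> s" "s \<le> r" for s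
    unfolding G_def using r[OF that, of r] r[OF that, of 0] \<open>0 < r\<close>
    by (intro DERIV_diff path f) (auto simp: algebra_simps)
  from MVT2[OF \<open>0 < r\<close> this] obtain s where s: "0 < s" "s < r"
    and Gs: "G r - G 0 = r * (frechet_derivative f (at (x + r *\<^sub>R v + s *\<^sub>R u)) u -
      frechet_derivative f (at (x + s *\<^sub>R u)) u)" by auto
  let ?F = "\<lambda>y. frechet_derivative f (at y) u"
  have "((\<lambda>t. ?F (x + s *\<^sub>R u + t *\<^sub>R v)) has_real_derivative
      frechet_derivative ?F (at (x + s *\<^sub>R u + t *\<^sub>R v)) v) (at t)" if "0 \<le> t" "t \<le> r" for t
    using r[of s t] s that by (intro path fu) auto
  from MVT2[OF \<open>0 < r\<close> this] obtain t where t: "0 < t" "t < r"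
    and Ft: "?F (x + s *\<^sub>R u + r *\<^sub>R v) - ?F (x + s *\<^sub>R u) =
      r * frechet_derivative ?F (at (x + s *\<^sub>R u + t *\<^sub>R v)) v" by auto
  have "x + r *\<^sub>R v + s *\<^sub>R u = x + s *\<^sub>R u + r *\<^sub>R v" by (simp add: add_ac)
  then have "G r - G 0 = r\<^sup>2 * frechet_derivative ?F (at (x + s *\<^sub>R u + t *\<^sub>R v)) v"
    using Gs Ft by (simp only: power2_eq_square mult.assoc)
  moreover have "G r - G 0 = f (x + r *\<^sub>R u + r *\<^sub>R v) - f (x + r *\<^sub>R u) - f (x + r *\<^sub>R v) + f x"
    by (simp add: G_def algebra_simps)
  ultimately show ?thesis
    using that[OF s t] by simp
qed

text \<open>Both mixed derivatives are limits of the same second difference quotient.\<close>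

lemma second_derivative_symmetric_real:
  fixes f :: "'a::real_normed_vector \<Rightarrow> real"
  assumes V: "open V" "x \<in> V" and f: "smooth_on V f"
  shows "frechet_derivative (\<lambda>y. frechet_derivative f (at y) u) (at x) v =
    frechet_derivative (\<lambda>y. frechet_derivative f (at y) v) (at x) u"
proof -
  define P where "P u v y = frechet_derivative (\<lambda>y. frechet_derivative f (at y) u) (at y) v" for u v y
  have cont: "continuous_on V (P u v)" for u v
    unfolding P_def by (rule smooth_on_continuous_on[OF smooth_on_frechet_derivative[OF smooth_on_frechet_derivative[OF f]]])
  obtain e where e: "0 < e" "ball x e \<subseteq> V"
    using V openE by blast
  \<comment> \<open>The summand 1 keeps \<open>M\<close> positive and the bound \<open>r * M\<close>
    strict even if \<open>u\<close> and \<open>v\<close> vanish.\<close>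
  define M where "M = norm u + norm v + 1"
  have "0 < M" by (simp add: M_def add_nonneg_pos)
  have inb: "dist x (x + s *\<^sub>R u + t *\<^sub>R v) < r * M"
    if "0 \<le> s" "s \<le> r" "0 \<le> t" "t \<le> r" "0 < r" for s t r
  proof -
    have "dist x (x + s *\<^sub>R u + t *\<^sub>R v) = norm (s *\<^sub>R u + t *\<^sub>R v)"
      by (simp add: dist_norm norm_minus_commute add.assoc add.commute[of "s *\<^sub>R u"])
    also have "\<dots> \<le> norm (s *\<^sub>R u) + norm (t *\<^sub>R v)" by (rule norm_triangle_ineq)
    also have "\<dots> \<le> r * norm u + r * norm v"
      using that by (intro add_mono) (auto intro: mult_right_mono)
    also have "\<dots> < r * M" using that by (simp add: M_def algebra_simps)
    finally show ?thesis .
  qed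
  have diff: "f differentiable (at y)" "(\<lambda>y. frechet_derivative f (at y) w) differentiable (at y)"
    if "y \<in> V" for y w
    by (rule smooth_on_differentiable[OF f that],
        rule smooth_on_differentiable[OF smooth_on_frechet_derivative[OF f] that])
  have ex: "\<exists>p q. dist x p < r * M \<and> dist x q < r * M \<and> P u v p = P v u q"
    if "0 < r" "r * M < e" for r
  proof -
    have sub: "x + s *\<^sub>R u + t *\<^sub>R v \<in> V" if "0 \<le> s" "s \<le> r" "0 \<le> t" "t \<le> r" for s t
      using inb[OF that \<open>0 < r\<close>] \<open>r * M < e\<close> e by (auto simp: subset_iff)
    obtain s t where st: "0 < s" "s < r" "0 < t" "t < r"
      "f (x + r *\<^sub>R u + r *\<^sub>R v) - f (x + r *\<^sub>R u) - f (x + r *\<^sub>R v) + f x =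
        r\<^sup>2 * P u v (x + s *\<^sub>R u + t *\<^sub>R v)"
      using second_difference_mean_value[of r x u v V f] sub \<open>0 < r\<close> diff unfolding P_def by blast
    have sub': "x + s *\<^sub>R v + t *\<^sub>R u \<in> V" if "0 \<le> s" "s \<le> r" "0 \<le> t" "t \<le> r" for s t
      using sub[of t s] that by (simp add: algebra_simps)
    obtain s' t' where st': "0 < s'" "s' < r" "0 < t'" "t' < r"
      "f (x + r *\<^sub>R v + r *\<^sub>R u) - f (x + r *\<^sub>R v) - f (x + r *\<^sub>R u) + f x =
        r\<^sup>2 * P v u (x + s' *\<^sub>R v + t' *\<^sub>R u)"
      using second_difference_mean_value[of r x v u V f] sub' \<open>0 < r\<close> diff unfolding P_def by blast
    have "r\<^sup>2 * P u v (x + s *\<^sub>R u + t *\<^sub>R v) = r\<^sup>2 * P v u (x + t' *\<^sub>R u + s' *\<^sub>R v)"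
      using st(5) st'(5) by (simp add: algebra_simps)
    then have "P u v (x + s *\<^sub>R u + t *\<^sub>R v) = P v u (x + t' *\<^sub>R u + s' *\<^sub>R v)"
      using \<open>0 < r\<close> by simp
    then show ?thesis
      using inb[of s r t] inb[of t' r s'] st(1-4) st'(1-4) \<open>0 < r\<close> less_imp_le by metis
  qed
  \<comment> \<open>With \<open>Suc (Suc n)\<close> the value \<open>r n * M\<close> is strictly
    below \<open>e\<close> already at \<open>n = 0\<close>.\<close>
  define r where "r n = e / M * inverse (real (Suc (Suc n)))" for n
  have rM: "r n * M = e * inverse (real (Suc (Suc n)))" for n
    using \<open>0 < M\<close> by (simp add: r_def)
  have r: "0 < r n" "r n * M < e" for n
  proof -
    show "0 < r n"
      using e \<open>0 < M\<close> by (simp add: r_def)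
    have "e * inverse (real (Suc (Suc n))) < e * 1"
      using e by (intro mult_strict_left_mono) (auto simp: inverse_less_1_iff)
    then show "r n * M < e" by (simp add: rM)
  qed
  have "\<forall>n. \<exists>p q. dist x p < r n * M \<and> dist x q < r n * M \<and> P u v p = P v u q"
    using ex r by blast
  then obtain p q where pq: "\<And>n. dist x (p n) < r n * M" "\<And>n. dist x (q n) < r n * M"
    "\<And>n. P u v (p n) = P v u (q n)" by metis
  have r0: "(\<lambda>n. r n * M) \<longlonglongrightarrow> 0"
    unfolding rM by (rule tendsto_mult_right_zero[OF LIMSEQ_Suc[OF LIMSEQ_inverse_real_of_nat]])
  have lim: "(\<lambda>n. P a b (z n)) \<longlonglongrightarrow> P a b x" if z: "\<And>n. dist x (z n) < r n * M" for z a b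
  proof -
    have "z \<longlonglongrightarrow> x"
    proof (rule metric_tendsto_imp_tendsto[OF r0 always_eventually[OF allI]])
      show "dist (z n) x \<le> dist (r n * M) 0" for n
        using z[of n] by (simp add: dist_commute dist_real_def)
    qed
    moreover have "isCont (P a b) x"
      using cont V by (simp add: continuous_on_eq_continuous_at)
    ultimately show ?thesis
      by (rule isCont_tendsto_compose[rotated])
  qed
  have "P u v x = P v u x"
    using LIMSEQ_unique[OF lim[OF pq(1), of u v]] lim[OF pq(2), of v u] pq(3) by simp
  then show ?thesis by (simp add: P_def)
qed

lemma second_derivative_symmetric:
  fixes f :: "'a::real_normed_vector \<Rightarrow> 'b::euclidean_space"
  assumes V: "open V" "x \<in> V" and f: "smooth_on V f"
  shows "frechet_derivative (\<lambda>y. frechet_derivative f (at y) u) (at x) v =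
    frechet_derivative (\<lambda>y. frechet_derivative f (at y) v) (at x) u"
proof (rule euclidean_eqI)
  fix b :: 'b
  have *: "frechet_derivative (\<lambda>y. frechet_derivative f (at y) u) (at x) v \<bullet> b =
    frechet_derivative (\<lambda>y. frechet_derivative (\<lambda>y. f y \<bullet> b) (at y) u) (at x) v" for u v
  proof -
    have "frechet_derivative (\<lambda>y. frechet_derivative f (at y) u) (at x) v \<bullet> b =
      frechet_derivative (\<lambda>y. frechet_derivative f (at y) u \<bullet> b) (at x) v"
      using smooth_on_differentiable[OF smooth_on_frechet_derivative[OF f] V(2)]
      by (simp add: frechet_derivative_bounded_linear[where T="\<lambda>x. x \<bullet> b"] bounded_linear_inner_left)
    also have "frechet_derivative (\<lambda>y. frechet_derivative f (at y) u \<bullet> b) (at x) =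
       frechet_derivative (\<lambda>y. frechet_derivative (\<lambda>y. f y \<bullet> b) (at y) u) (at x)"
      using smooth_on_differentiable[OF smooth_on_inner[OF V(1) smooth_on_frechet_derivative[OF f]] V(2)]
      by (rule frechet_derivative_transform_within_open[OF _ V])
        (simp add: frechet_derivative_bounded_linear[where T="\<lambda>x. x \<bullet> b"] bounded_linear_inner_left
          smooth_on_differentiable[OF f])
    finally show ?thesis .
  qed
  show "frechet_derivative (\<lambda>y. frechet_derivative f (at y) u) (at x) v \<bullet> b =
    frechet_derivative (\<lambda>y. frechet_derivative f (at y) v) (at x) u \<bullet> b"
    unfolding * using V smooth_on_inner[OF V(1) f] by (rule second_derivative_symmetric_real)
qed

section \<open>Exterior derivatives in coordinates\<close>

text \<open>\<open>cd1\<close>, \<open>cd2\<close> and \<open>cd3\<close> are exterior derivatives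
  evaluated on constant fields, whose Lie brackets vanish; they depend on tangent vectors at one
  point instead of on vector fields.\<close>

definition cd1 :: "('v::real_normed_vector \<Rightarrow> 'v \<Rightarrow> real) \<Rightarrow> 'v \<Rightarrow> 'v \<Rightarrow> 'v \<Rightarrow> real" where
  "cd1 \<alpha> x u v =
     frechet_derivative (\<lambda>y. \<alpha> y v) (at x) u - frechet_derivative (\<lambda>y. \<alpha> y u) (at x) v"

definition cd2 :: "('v::real_normed_vector \<Rightarrow> 'v \<Rightarrow> 'v \<Rightarrow> real) \<Rightarrow> 'v \<Rightarrow> 'v \<Rightarrow> 'v \<Rightarrow> 'v \<Rightarrow> real" where
  "cd2 \<alpha> x u v w =
     frechet_derivative (\<lambda>y. \<alpha> y v w) (at x) u - frechet_derivative (\<lambda>y. \<alpha> y u w) (at x) v +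
     frechet_derivative (\<lambda>y. \<alpha> y u v) (at x) w"

definition cd3 :: "('v::real_normed_vector \<Rightarrow> 'v \<Rightarrow> 'v \<Rightarrow> 'v \<Rightarrow> real) \<Rightarrow> 'v \<Rightarrow> 'v \<Rightarrow> 'v \<Rightarrow> 'v \<Rightarrow> 'v \<Rightarrow> real" where
  "cd3 \<alpha> x u v w z =
     frechet_derivative (\<lambda>y. \<alpha> y v w z) (at x) u - frechet_derivative (\<lambda>y. \<alpha> y u w z) (at x) v +
     frechet_derivative (\<lambda>y. \<alpha> y u v z) (at x) w - frechet_derivative (\<lambda>y. \<alpha> y u v w) (at x) z"

lemma cd2_cong:
  assumes "open V" "x \<in> V" "\<And>u v. (\<lambda>y. \<alpha> y u v) differentiable (at x)"
    "\<And>y u v. y \<in> V \<Longrightarrow> \<alpha> y u v = \<beta> y u v"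
  shows "cd2 \<alpha> x u v w = cd2 \<beta> x u v w"
proof -
  have "frechet_derivative (\<lambda>y. \<alpha> y u v) (at x) = frechet_derivative (\<lambda>y. \<beta> y u v) (at x)" for u v
    by (rule frechet_derivative_transform_within_open[OF assms(3,1,2)]) (rule assms(4))
  then show ?thesis by (simp add: cd2_def)
qed

lemma cd3_cong:
  assumes "open V" "x \<in> V" "\<And>u v w. (\<lambda>y. \<alpha> y u v w) differentiable (at x)"
    "\<And>y u v w. y \<in> V \<Longrightarrow> \<alpha> y u v w = \<beta> y u v w"
  shows "cd3 \<alpha> x u v w z = cd3 \<beta> x u v w z"
proof -
  have "frechet_derivative (\<lambda>y. \<alpha> y u v w) (at x) = frechet_derivative (\<lambda>y. \<beta> y u v w) (at x)" for u v w
    by (rule frechet_derivative_transform_within_open[OF assms(3,1,2)]) (rule assms(4))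
  then show ?thesis by (simp add: cd3_def)
qed

lemma cd2_cmult:
  assumes "\<And>u v. (\<lambda>y. \<alpha> y u v) differentiable (at x)"
  shows "cd2 (\<lambda>y u v. k * \<alpha> y u v) x u v w = k * cd2 \<alpha> x u v w"
  using assms by (simp add: cd2_def frechet_derivative_mult algebra_simps)

lemma cd3_cmult:
  assumes "\<And>u v w. (\<lambda>y. \<alpha> y u v w) differentiable (at x)"
  shows "cd3 (\<lambda>y u v w. k * \<alpha> y u v w) x u v w z = k * cd3 \<alpha> x u v w z"
  using assms by (simp add: cd3_def frechet_derivative_mult algebra_simps)

text \<open>Written out, there are six second derivatives, which cancel in pairs by symmetry; in
  \<open>cd3_cd2\<close> there are twelve.\<close>

lemma cd2_cd1:
  fixes \<alpha> :: "'v::real_normed_vector \<Rightarrow> 'v \<Rightarrow> real"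
  assumes V: "open V" "x \<in> V" and \<alpha>: "\<And>u. smooth_on V (\<lambda>y. \<alpha> y u)"
  shows "cd2 (cd1 \<alpha>) x u v w = 0"
proof -
  have d: "(\<lambda>y. frechet_derivative (\<lambda>y. \<alpha> y u) (at y) v) differentiable (at x)" for u v
    by (rule smooth_on_differentiable[OF smooth_on_frechet_derivative[OF \<alpha>] V(2)])
  have s: "frechet_derivative (\<lambda>y. frechet_derivative (\<lambda>y. \<alpha> y u) (at y) v) (at x) w =
      frechet_derivative (\<lambda>y. frechet_derivative (\<lambda>y. \<alpha> y u) (at y) w) (at x) v" for u v w
    by (rule second_derivative_symmetric[OF V \<alpha>])
  show ?thesis
    unfolding cd2_def cd1_def
    using s[of w u v] s[of v u w] s[of u v w] by (simp add: frechet_derivative_diff d)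
qed

lemma cd3_cd2:
  fixes \<alpha> :: "'v::real_normed_vector \<Rightarrow> 'v \<Rightarrow> 'v \<Rightarrow> real"
  assumes V: "open V" "x \<in> V" and \<alpha>: "\<And>u v. smooth_on V (\<lambda>y. \<alpha> y u v)"
  shows "cd3 (cd2 \<alpha>) x u v w z = 0"
proof -
  have d: "(\<lambda>y. frechet_derivative (\<lambda>y. \<alpha> y u v) (at y) w) differentiable (at x)" for u v w
    by (rule smooth_on_differentiable[OF smooth_on_frechet_derivative[OF \<alpha>] V(2)])
  have s: "frechet_derivative (\<lambda>y. frechet_derivative (\<lambda>y. \<alpha> y a b) (at y) v) (at x) w =
      frechet_derivative (\<lambda>y. frechet_derivative (\<lambda>y. \<alpha> y a b) (at y) w) (at x) v" for a b v w
    by (rule second_derivative_symmetric[OF V \<alpha>])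
  show ?thesis
    unfolding cd3_def cd2_def
    using s[of w z u v] s[of v z u w] s[of v w u z] s[of u z v w] s[of u w v z] s[of u v w z]
    by (simp add: frechet_derivative_diff frechet_derivative_add d)
qed

definition wedge_1_2 :: "('v \<Rightarrow> 'v \<Rightarrow> real) \<Rightarrow> ('v \<Rightarrow> 'v \<Rightarrow> 'v \<Rightarrow> real) \<Rightarrow> 'v \<Rightarrow> 'v \<Rightarrow> 'v \<Rightarrow> 'v \<Rightarrow> real" where
  "wedge_1_2 \<alpha> \<omega> x u v w = \<alpha> x u * \<omega> x v w + \<alpha> x v * \<omega> x w u + \<alpha> x w * \<omega> x u v"

text \<open>Shuffle sums in the normalisation of \<open>wedge_1_2\<close>. The factors are forms at
  a single point, because these products are never differentiated.\<close>

definition wedge_1_3 :: "('v \<Rightarrow> real) \<Rightarrow> ('v \<Rightarrow> 'v \<Rightarrow> 'v \<Rightarrow> real) \<Rightarrow> 'v \<Rightarrow> 'v \<Rightarrow> 'v \<Rightarrow> 'v \<Rightarrow> real" where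
  "wedge_1_3 a \<beta> u v w z = a u * \<beta> v w z - a v * \<beta> u w z + a w * \<beta> u v z - a z * \<beta> u v w"

definition wedge_2_2 :: "('v \<Rightarrow> 'v \<Rightarrow> real) \<Rightarrow> ('v \<Rightarrow> 'v \<Rightarrow> real) \<Rightarrow> 'v \<Rightarrow> 'v \<Rightarrow> 'v \<Rightarrow> 'v \<Rightarrow> real" where
  "wedge_2_2 \<rho> \<sigma> u v w z = \<rho> u v * \<sigma> w z - \<rho> u w * \<sigma> v z + \<rho> u z * \<sigma> v w
     + \<rho> v w * \<sigma> u z - \<rho> v z * \<sigma> u w + \<rho> w z * \<sigma> u v"

text \<open>The Leibniz rule d(\<alpha> \<and> \<omega>) = d\<alpha> \<and> \<omega> - \<alpha>
  \<and> d\<omega>. Antisymmetry is required on all of \<open>V\<close> because the cyclic form of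
  \<open>wedge_1_2\<close> puts \<omega>(w,u) under the derivative.\<close>

lemma cd3_wedge_1_2:
  fixes \<alpha> :: "'v::real_normed_vector \<Rightarrow> 'v \<Rightarrow> real"
  assumes V: "open V" "x \<in> V" and \<alpha>: "\<And>u. (\<lambda>y. \<alpha> y u) differentiable (at x)"
    and \<omega>: "\<And>u v. (\<lambda>y. \<omega> y u v) differentiable (at x)"
    and anti: "\<And>y u v. y \<in> V \<Longrightarrow> \<omega> y u v = - \<omega> y v u"
  shows "cd3 (wedge_1_2 \<alpha> \<omega>) x u v w z =
    wedge_2_2 (cd1 \<alpha> x) (\<omega> x) u v w z - wedge_1_3 (\<alpha> x) (cd2 \<omega> x) u v w z"
proof -
  have "frechet_derivative (\<lambda>y. \<omega> y u v) (at x) = frechet_derivative (\<lambda>y. - \<omega> y v u) (at x)" for u v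
    by (rule frechet_derivative_transform_within_open[OF \<omega> V]) (rule anti)
  then have a: "frechet_derivative (\<lambda>y. \<omega> y u v) (at x) w = - frechet_derivative (\<lambda>y. \<omega> y v u) (at x) w" for u v w
    using frechet_derivative_uminus[OF \<omega>, of v u w] by metis
  show ?thesis
    unfolding cd3_def wedge_1_2_def wedge_1_3_def wedge_2_2_def cd2_def cd1_def
    apply (simp add: frechet_derivative_mult frechet_derivative_add \<alpha> \<omega>)
    apply (simp add: a[of w u] a[of z u] a[of z v] a[of z w] a[of v u] a[of w v]
        anti[OF V(2), of w u] anti[OF V(2), of z u] anti[OF V(2), of z v] anti[OF V(2), of z w]
        anti[OF V(2), of v u] anti[OF V(2), of w v] algebra_simps)
    done
qed

text \<open>Tensoriality: the product rule produces derivatives of \<open>X\<close> and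
  \<open>Y\<close> in exactly the combination that the bracket term cancels, so only the values at
  \<open>x\<close> survive.\<close>

lemma ext_d1_eq_cd1:
  fixes \<alpha> :: "'v::euclidean_space \<Rightarrow> 'v \<Rightarrow> real"
  assumes V: "open V" "x \<in> V" and lin: "\<And>y. y \<in> V \<Longrightarrow> linear (\<alpha> y)"
    and \<alpha>: "\<And>u. smooth_on V (\<lambda>y. \<alpha> y u)" and X: "X \<in> vfields V" "Y \<in> vfields V"
  shows "ext_d1 \<alpha> X Y x = cd1 \<alpha> x (X x) (Y x)"
proof -
  have dX: "X differentiable (at x)" "Y differentiable (at x)"
    using X V by (auto simp: vfields_def smooth_on_differentiable)
  have d: "(\<lambda>y. \<alpha> y u) differentiable (at x)" for u
    by (rule smooth_on_differentiable[OF \<alpha> V(2)])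
  have L: "frechet_derivative (\<lambda>y. \<alpha> y (P y)) (at x) w =
      frechet_derivative (\<lambda>y. \<alpha> y (P x)) (at x) w + \<alpha> x (frechet_derivative P (at x) w)"
    if "P differentiable (at x)" for P w
    by (rule frechet_derivative_linear_apply[OF V _ _ that]) (use lin d in auto)
  show ?thesis
    unfolding ext_d1_def dirder_def lie_bracket_def cd1_def L[OF dX(1)] L[OF dX(2)]
      linear_diff[OF lin[OF V(2)]] by simp
qed

lemma ext_d2_eq_cd2:
  fixes \<alpha> :: "'v::euclidean_space \<Rightarrow> 'v \<Rightarrow> 'v \<Rightarrow> real"
  assumes V: "open V" "x \<in> V" and bil: "\<And>y. y \<in> V \<Longrightarrow> bilinear (\<alpha> y)"
    and \<alpha>: "\<And>u v. smooth_on V (\<lambda>y. \<alpha> y u v)" and X: "X \<in> vfields V" "Y \<in> vfields V" "Z \<in> vfields V"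
    and anti: "\<And>u v. \<alpha> x u v = - \<alpha> x v u"
  shows "ext_d2 \<alpha> X Y Z x = cd2 \<alpha> x (X x) (Y x) (Z x)"
proof -
  have dX: "X differentiable (at x)" "Y differentiable (at x)" "Z differentiable (at x)"
    using X V by (auto simp: vfields_def smooth_on_differentiable)
  have d: "(\<lambda>y. \<alpha> y u v) differentiable (at x)" for u v
    by (rule smooth_on_differentiable[OF \<alpha> V(2)])
  have b: "frechet_derivative (\<lambda>y. \<alpha> y (P y) (Q y)) (at x) w =
      frechet_derivative (\<lambda>y. \<alpha> y (P x) (Q x)) (at x) w + \<alpha> x (frechet_derivative P (at x) w) (Q x)
      + \<alpha> x (P x) (frechet_derivative Q (at x) w)"
    if "P differentiable (at x)" "Q differentiable (at x)" for P Q w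
    by (rule frechet_derivative_bilinear_apply[OF V _ _ that]) (use bil d in auto)
  have lsub: "\<alpha> x (a - b) c = \<alpha> x a c - \<alpha> x b c" for a b c
    using bil[OF V(2)] by (simp add: bilinear_lsub)
  show ?thesis
    unfolding ext_d2_def dirder_def lie_bracket_def cd2_def
      b[OF dX(2,3)] b[OF dX(1,3)] b[OF dX(1,2)] lsub
    using anti[of "Y x"] anti[of "X x"] by simp
qed

lemma ext_d3_eq_cd3:
  fixes \<alpha> :: "'v::euclidean_space \<Rightarrow> 'v \<Rightarrow> 'v \<Rightarrow> 'v \<Rightarrow> real"
  assumes V: "open V" "x \<in> V" and bil: "\<And>y u. y \<in> V \<Longrightarrow> bilinear (\<alpha> y u)"
    and lin: "\<And>y u v. y \<in> V \<Longrightarrow> linear (\<lambda>w. \<alpha> y w u v)"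
    and \<alpha>: "\<And>u v w. smooth_on V (\<lambda>y. \<alpha> y u v w)"
    and X: "X \<in> vfields V" "Y \<in> vfields V" "Z \<in> vfields V" "W \<in> vfields V"
    and anti: "\<And>u v w. \<alpha> x u v w = - \<alpha> x v u w" "\<And>u v w. \<alpha> x u v w = - \<alpha> x u w v"
  shows "ext_d3 \<alpha> X Y Z W x = cd3 \<alpha> x (X x) (Y x) (Z x) (W x)"
proof -
  have dX: "X differentiable (at x)" "Y differentiable (at x)" "Z differentiable (at x)" "W differentiable (at x)"
    using X V by (auto simp: vfields_def smooth_on_differentiable)
  have d: "(\<lambda>y. \<alpha> y u v w) differentiable (at x)" for u v w
    by (rule smooth_on_differentiable[OF \<alpha> V(2)])
  have b: "frechet_derivative (\<lambda>y. \<alpha> y (P y) (Q y) (R y)) (at x) w =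
     frechet_derivative (\<lambda>y. \<alpha> y (P x) (Q x) (R x)) (at x) w
     + \<alpha> x (frechet_derivative P (at x) w) (Q x) (R x)
     + \<alpha> x (P x) (frechet_derivative Q (at x) w) (R x)
     + \<alpha> x (P x) (Q x) (frechet_derivative R (at x) w)"
    if P: "P \<in> vfields V" "Q \<in> vfields V" "R \<in> vfields V" for P Q R w
  proof -
    have dP: "P differentiable (at x)" "Q differentiable (at x)" "R differentiable (at x)"
      using P V by (auto simp: vfields_def smooth_on_differentiable)
    have bl: "bilinear (\<lambda>u v. \<alpha> y u v z)" if "y \<in> V" for y z
      using bil[OF that] lin[OF that] by (auto simp: bilinear_def)
    have 1: "frechet_derivative (\<lambda>y. \<alpha> y (P y) (Q y) (R y)) (at x) w =
       frechet_derivative (\<lambda>y. \<alpha> y (P y) (Q y) (R x)) (at x) w + \<alpha> x (P x) (Q x) (frechet_derivative R (at x) w)"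
    proof (rule frechet_derivative_linear_apply[OF V])
      show "linear (\<alpha> y (P y) (Q y))" if "y \<in> V" for y
        using bil[OF that] by (simp add: bilinear_def)
      show "(\<lambda>y. \<alpha> y (P y) (Q y) u) differentiable at x" for u
        by (rule smooth_on_differentiable[OF smooth_on_bilinear_apply[OF V(1) bl] V(2)])
          (use P \<alpha> in \<open>auto simp: vfields_def\<close>)
    qed (rule dP)
    show ?thesis
      unfolding 1 using frechet_derivative_bilinear_apply[where B="\<lambda>y u v. \<alpha> y u v (R x)", OF V bl d dP(1,2), of w] by simp
  qed
  have lsub: "\<alpha> x (a - b) c e = \<alpha> x a c e - \<alpha> x b c e" for a b c e
    by (rule linear_diff[OF lin[OF V(2)]])
  \<comment> \<open>Cyclic shifts and transpositions bring each differentiated argument to the first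
    slot, where the bracket terms have it.\<close>
  have cyc: "\<alpha> x u v w = \<alpha> x w u v" for u v w
    using anti(1)[of u w v] anti(2)[of u v w] by simp
  show ?thesis
    unfolding ext_d3_def dirder_def lie_bracket_def cd3_def b[OF X(2,3,4)] b[OF X(1,3,4)]
      b[OF X(1,2,4)] b[OF X(1,2,3)] lsub
    using cyc[of "Y x" "Z x"] cyc[of "X x" "Z x"] cyc[of "X x" "Y x"]
      anti(1)[of "Y x" _ "W x"] anti(1)[of "X x" _ "W x"] anti(1)[of "X x" _ "Z x"] anti(1)[of "Y x" _ "Z x"]
    by simp
qed

text \<open>Naturality of d on 1-forms. Differentiating the pulled-back form produces an extra term,
  \<alpha> applied to the second derivative of \<tau>; it is symmetric in \<open>u\<close> and
  \<open>v\<close> and drops out on alternation.\<close>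

lemma cd1_pullback:
  fixes \<tau> :: "'v::euclidean_space \<Rightarrow> 'v"
  assumes U: "open U" "x \<in> U" and V: "open V" and \<tau>: "smooth_on U \<tau>" "\<And>y. y \<in> U \<Longrightarrow> \<tau> y \<in> V"
    and lin: "\<And>y. y \<in> V \<Longrightarrow> linear (\<alpha> y)" and \<alpha>: "\<And>u. smooth_on V (\<lambda>y. \<alpha> y u)"
    and \<beta>: "\<And>u. smooth_on U (\<lambda>y. \<beta> y u)"
    and pull: "\<And>y u. y \<in> U \<Longrightarrow> \<alpha> (\<tau> y) (frechet_derivative \<tau> (at y) u) = \<beta> y u"
  shows "cd1 \<alpha> (\<tau> x) (frechet_derivative \<tau> (at x) u) (frechet_derivative \<tau> (at x) v) = cd1 \<beta> x u v"
proof -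
  let ?J = "\<lambda>u y. frechet_derivative \<tau> (at y) u"
  have dt: "(\<tau> has_derivative frechet_derivative \<tau> (at x)) (at x)"
    using smooth_on_differentiable[OF \<tau>(1) U(2)] by (simp add: frechet_derivative_works)
  have ch: "((\<lambda>y. \<alpha> (\<tau> y) w) has_derivative (\<lambda>u. frechet_derivative (\<lambda>z. \<alpha> z w) (at (\<tau> x)) (?J u x))) (at x)" for w
  proof (rule has_derivative_compose[OF dt])
    show "((\<lambda>z. \<alpha> z w) has_derivative frechet_derivative (\<lambda>z. \<alpha> z w) (at (\<tau> x))) (at (\<tau> x))"
      using smooth_on_differentiable[OF \<alpha> \<tau>(2)[OF U(2)]] by (simp add: frechet_derivative_works)
  qed
  have "frechet_derivative (\<lambda>y. \<beta> y v) (at x) u = frechet_derivative (\<lambda>z. \<alpha> z (?J v x)) (at (\<tau> x)) (?J u x)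
      + \<alpha> (\<tau> x) (frechet_derivative (?J v) (at x) u)" for u v
  proof -
    have "frechet_derivative (\<lambda>y. \<beta> y v) (at x) u = frechet_derivative (\<lambda>y. \<alpha> (\<tau> y) (?J v y)) (at x) u"
      by (rule fun_cong, rule frechet_derivative_transform_within_open[OF smooth_on_differentiable[OF \<beta> U(2)] U])
        (rule pull[symmetric])
    also have "\<dots> = frechet_derivative (\<lambda>y. \<alpha> (\<tau> y) (?J v x)) (at x) u + \<alpha> (\<tau> x) (frechet_derivative (?J v) (at x) u)"
    proof (rule frechet_derivative_linear_apply[OF U])
      show "(\<lambda>y. \<alpha> (\<tau> y) w) differentiable at x" for w
        using ch by (rule differentiableI)
    qed (use lin \<tau>(2) smooth_on_differentiable[OF smooth_on_frechet_derivative[OF \<tau>(1)] U(2)] in auto)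
    also have "frechet_derivative (\<lambda>y. \<alpha> (\<tau> y) (?J v x)) (at x) u = frechet_derivative (\<lambda>z. \<alpha> z (?J v x)) (at (\<tau> x)) (?J u x)"
      by (rule fun_cong[OF frechet_derivative_at[OF ch], symmetric])
    finally show ?thesis .
  qed
  then show ?thesis
    unfolding cd1_def using second_derivative_symmetric[OF U \<tau>(1), of u v] by simp
qed

section \<open>Contact metric linear algebra in dimension 5\<close>

locale inner_form =
  fixes g :: "'v::euclidean_space \<Rightarrow> 'v \<Rightarrow> real"
  assumes bilinear: "bilinear g" and sym: "g u v = g v u" and pos: "u \<noteq> 0 \<Longrightarrow> 0 < g u u"
begin

lemma add_left: "g (u + v) w = g u w + g v w"
  and add_right: "g w (u + v) = g w u + g w v"
  and scale_left: "g (r *\<^sub>R u) w = r * g u w"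
  and scale_right: "g w (r *\<^sub>R u) = r * g w u"
  and minus_left: "g (- u) w = - g u w"
  and minus_right: "g w (- u) = - g w u"
  and diff_left: "g (u - v) w = g u w - g v w"
  and diff_right: "g w (u - v) = g w u - g w v"
  and zero_left: "g 0 w = 0"
  and zero_right: "g w 0 = 0"
  using bilinear by (simp_all add: bilinear_ladd bilinear_radd bilinear_lmul bilinear_rmul
      bilinear_lneg bilinear_rneg bilinear_lsub bilinear_rsub bilinear_lzero bilinear_rzero)

lemmas expand = add_left add_right scale_left scale_right minus_left minus_right
  diff_left diff_right zero_left zero_right

lemma eq_zero_iff: "g u u = 0 \<longleftrightarrow> u = 0"
  using pos[of u] zero_left[of u] by (cases "u = 0") auto

lemma eqI:
  assumes "\<And>w. g u w = g v w"
  shows "u = v"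
proof -
  have "g (u - v) (u - v) = 0"
    using assms[of "u - v"] by (simp add: diff_left)
  then show ?thesis by (simp add: eq_zero_iff)
qed

lemma linear_left: "linear (\<lambda>u. g u w)" and linear_right: "linear (g w)"
  using bilinear by (simp_all add: bilinear_def)

lemma orthogonal_independent:
  assumes "finite S" "0 \<notin> S" "\<And>a b. a \<in> S \<Longrightarrow> b \<in> S \<Longrightarrow> a \<noteq> b \<Longrightarrow> g a b = 0"
  shows "independent S"
proof
  assume "dependent S"
  then obtain c v where v: "v \<in> S" "c v \<noteq> 0" "(\<Sum>a\<in>S. c a *\<^sub>R a) = 0"
    using dependent_finite[OF assms(1)] by auto
  have "0 = g (\<Sum>a\<in>S. c a *\<^sub>R a) v"
    using v by (simp add: zero_left)
  also have "\<dots> = (\<Sum>a\<in>S. c a * g a v)"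
    by (simp add: linear_sum[OF linear_left] scale_left)
  also have "\<dots> = (\<Sum>a\<in>S. if a = v then c v * g v v else 0)"
    using assms(3) v by (intro sum.cong) auto
  also have "\<dots> = c v * g v v"
    using v assms(1) by simp
  finally show False
    using v assms(2) by (metis eq_zero_iff mult_eq_0_iff)
qed

definition orthonormal_frame :: "'v \<Rightarrow> 'v \<Rightarrow> 'v \<Rightarrow> 'v \<Rightarrow> 'v \<Rightarrow> bool" where
  "orthonormal_frame e0 e1 e2 e3 e4 \<longleftrightarrow>
     g e0 e0 = 1 \<and> g e1 e1 = 1 \<and> g e2 e2 = 1 \<and> g e3 e3 = 1 \<and> g e4 e4 = 1 \<and>
     g e0 e1 = 0 \<and> g e0 e2 = 0 \<and> g e0 e3 = 0 \<and> g e0 e4 = 0 \<and>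
     g e1 e2 = 0 \<and> g e1 e3 = 0 \<and> g e1 e4 = 0 \<and> g e2 e3 = 0 \<and> g e2 e4 = 0 \<and> g e3 e4 = 0"

lemma frame_expand:
  assumes dim: "DIM('v) = 5" and fr: "orthonormal_frame e0 e1 e2 e3 e4"
  shows "u = g u e0 *\<^sub>R e0 + g u e1 *\<^sub>R e1 + g u e2 *\<^sub>R e2 + g u e3 *\<^sub>R e3 + g u e4 *\<^sub>R e4"
proof (rule ccontr)
  note e = fr[unfolded orthonormal_frame_def]
  note e' = e sym[of e1 e0] sym[of e2 e0] sym[of e3 e0] sym[of e4 e0] sym[of e2 e1] sym[of e3 e1]
    sym[of e4 e1] sym[of e3 e2] sym[of e4 e2] sym[of e4 e3]
  define r where "r = u - (g u e0 *\<^sub>R e0 + g u e1 *\<^sub>R e1 + g u e2 *\<^sub>R e2 + g u e3 *\<^sub>R e3 + g u e4 *\<^sub>R e4)"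
  assume "u \<noteq> g u e0 *\<^sub>R e0 + g u e1 *\<^sub>R e1 + g u e2 *\<^sub>R e2 + g u e3 *\<^sub>R e3 + g u e4 *\<^sub>R e4"
  then have "r \<noteq> 0" by (simp add: r_def)
  have r: "g r e0 = 0" "g r e1 = 0" "g r e2 = 0" "g r e3 = 0" "g r e4 = 0"
    unfolding r_def using e' by (simp_all add: expand)
  note r' = r sym[of e0 r] sym[of e1 r] sym[of e2 r] sym[of e3 r] sym[of e4 r]
  have d: "a \<noteq> b" if "g a b = 0" "a \<noteq> 0" for a b
    using that by (auto simp: eq_zero_iff)
  have nz: "e0 \<noteq> 0" "e1 \<noteq> 0" "e2 \<noteq> 0" "e3 \<noteq> 0" "e4 \<noteq> 0"
    using e zero_left by (metis zero_neq_one)+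
  \<comment> \<open>A nonzero remainder would be a sixth independent vector.\<close>
  have "independent {r, e0, e1, e2, e3, e4}"
    using e' r' nz \<open>r \<noteq> 0\<close> by (intro orthogonal_independent) auto
  then have "card {r, e0, e1, e2, e3, e4} \<le> 5"
    using independent_bound dim by metis
  moreover have "r \<notin> {e0, e1, e2, e3, e4}" "e0 \<notin> {e1, e2, e3, e4}" "e1 \<notin> {e2, e3, e4}" "e2 \<notin> {e3, e4}" "e3 \<noteq> e4"
    using d[OF _ \<open>r \<noteq> 0\<close>] r d[OF _ nz(1)] d[OF _ nz(2)] d[OF _ nz(3)] d[OF _ nz(4)] e by auto
  ultimately show False by simp
qed

lemma frame_inner:
  assumes "DIM('v) = 5" "orthonormal_frame e0 e1 e2 e3 e4"
  shows "g u v = g u e0 * g v e0 + g u e1 * g v e1 + g u e2 * g v e2 + g u e3 * g v e3 + g u e4 * g v e4"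
proof -
  have "g u v = g (g u e0 *\<^sub>R e0 + g u e1 *\<^sub>R e1 + g u e2 *\<^sub>R e2 + g u e3 *\<^sub>R e3 + g u e4 *\<^sub>R e4) v"
    by (rule arg_cong[OF frame_expand[OF assms]])
  also have "\<dots> = g u e0 * g v e0 + g u e1 * g v e1 + g u e2 * g v e2 + g u e3 * g v e3 + g u e4 * g v e4"
    unfolding add_left scale_left by (simp add: sym[of _ v])
  finally show ?thesis .
qed

lemma frame_linear_zero:
  assumes "DIM('v) = 5" "orthonormal_frame e0 e1 e2 e3 e4" "linear F"
    "F e0 = 0" "F e1 = 0" "F e2 = 0" "F e3 = 0" "F e4 = 0"
  shows "F u = 0"
proof -
  have "F u = F (g u e0 *\<^sub>R e0 + g u e1 *\<^sub>R e1 + g u e2 *\<^sub>R e2 + g u e3 *\<^sub>R e3 + g u e4 *\<^sub>R e4)"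
    by (rule arg_cong[OF frame_expand[OF assms(1,2)]])
  then show ?thesis
    using assms(4-) by (simp add: linear_add[OF assms(3)] linear_scale[OF assms(3)])
qed

lemma frame_eqI:
  assumes "DIM('v) = 5" "orthonormal_frame e0 e1 e2 e3 e4"
    "g u e0 = g v e0" "g u e1 = g v e1" "g u e2 = g v e2" "g u e3 = g v e3" "g u e4 = g v e4"
  shows "u = v"
proof -
  have "u = g u e0 *\<^sub>R e0 + g u e1 *\<^sub>R e1 + g u e2 *\<^sub>R e2 + g u e3 *\<^sub>R e3 + g u e4 *\<^sub>R e4"
    by (rule frame_expand[OF assms(1,2)])
  also have "\<dots> = g v e0 *\<^sub>R e0 + g v e1 *\<^sub>R e1 + g v e2 *\<^sub>R e2 + g v e3 *\<^sub>R e3 + g v e4 *\<^sub>R e4"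
    by (simp only: assms(3-))
  also have "\<dots> = v"
    by (rule frame_expand[OF assms(1,2), symmetric])
  finally show ?thesis .
qed

text \<open>One Gram-Schmidt step: fewer than \<open>DIM('v)\<close> vectors leave some
  \<open>x\<close> outside their span.\<close>

lemma exists_unit_orthogonal:
  assumes S: "finite S" "card S < DIM('v)" "\<And>a. a \<in> S \<Longrightarrow> g a a = 1"
    "\<And>a b. a \<in> S \<Longrightarrow> b \<in> S \<Longrightarrow> a \<noteq> b \<Longrightarrow> g a b = 0"
  obtains e where "g e e = 1" "\<And>a. a \<in> S \<Longrightarrow> g e a = 0"
proof -
  have "span S \<noteq> UNIV"
    using dim_le_card'[OF S(1)] S(2) by (metis dim_UNIV dim_span leD)
  then obtain x where x: "x \<notin> span S" by blast
  define r where "r = x - (\<Sum>a\<in>S. g x a *\<^sub>R a)"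
  have "(\<Sum>a\<in>S. g x a *\<^sub>R a) \<in> span S"
    by (intro span_sum span_scale span_base)
  then have "r \<noteq> 0"
    using x by (auto simp: r_def)
  have r: "g r a = 0" if "a \<in> S" for a
  proof -
    have "(\<Sum>b\<in>S. g x b * g b a) = (\<Sum>b\<in>S. if b = a then g x a else 0)"
      using S that by (intro sum.cong) auto
    then show ?thesis
      using S(1) that by (simp add: r_def diff_left linear_sum[OF linear_left] scale_left)
  qed
  show ?thesis
  proof
    show "g ((1 / sqrt (g r r)) *\<^sub>R r) ((1 / sqrt (g r r)) *\<^sub>R r) = 1"
      using pos[OF \<open>r \<noteq> 0\<close>] by (simp add: scale_left scale_right)
    show "g ((1 / sqrt (g r r)) *\<^sub>R r) a = 0" if "a \<in> S" for a
      using r[OF that] by (simp add: scale_left)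
  qed
qed

end

section \<open>Almost contact metric structures on one tangent space\<close>

locale contact_form = inner_form g for g :: "'v::euclidean_space \<Rightarrow> 'v \<Rightarrow> real" +
  fixes \<phi> :: "'v \<Rightarrow> 'v" and \<xi> :: 'v and \<eta> :: "'v \<Rightarrow> real"
  assumes dim: "DIM('v) = 5" and linear_phi: "linear \<phi>" and linear_eta: "linear \<eta>"
    and phi_phi: "\<phi> (\<phi> u) = - u + \<eta> u *\<^sub>R \<xi>" and eta_xi: "\<eta> \<xi> = 1"
    and compatible: "g (\<phi> u) (\<phi> v) = g u v - \<eta> u * \<eta> v"
begin

text \<open>Since \<phi> kills \<phi> \<xi>, the formula for the square of \<phi>, applied to \<phi>
  \<xi>, gives \<phi> \<xi> = c \<xi> with c = \<eta> (\<phi> \<xi>). One more \<phi> gives c \<phi>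
  \<xi> = 0, and either factor being zero suffices.\<close>

lemma phi_xi: "\<phi> \<xi> = 0"
proof -
  have "\<phi> (\<phi> \<xi>) = 0" by (simp add: phi_phi eta_xi)
  then have "\<phi> \<xi> = \<eta> (\<phi> \<xi>) *\<^sub>R \<xi>"
    using phi_phi[of "\<phi> \<xi>"] linear_0[OF linear_phi] by simp
  then have "\<eta> (\<phi> \<xi>) *\<^sub>R \<phi> \<xi> = 0"
    using linear_scale[OF linear_phi, of "\<eta> (\<phi> \<xi>)" \<xi>] \<open>\<phi> (\<phi> \<xi>) = 0\<close> by simp
  then show ?thesis
    using \<open>\<phi> \<xi> = \<eta> (\<phi> \<xi>) *\<^sub>R \<xi>\<close> by auto
qed

lemma eta_eq: "\<eta> u = g u \<xi>"
  using compatible[of u \<xi>] by (simp add: phi_xi eta_xi zero_right)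

lemma xi_right: "g u \<xi> = \<eta> u" and xi_left: "g \<xi> u = \<eta> u"
  using eta_eq sym by simp_all

lemma xi_nonzero: "\<xi> \<noteq> 0"
  using eta_xi linear_0[OF linear_eta] by auto

text \<open>The two ways of evaluating a triple application of \<phi> differ by \<eta> (\<phi> u)
  \<xi>.\<close>

lemma eta_phi: "\<eta> (\<phi> u) = 0"
proof -
  have "\<phi> (\<phi> (\<phi> u)) = - \<phi> u"
    by (simp add: phi_phi[of u] linear_diff[OF linear_phi] linear_scale[OF linear_phi] phi_xi)
  then show ?thesis
    using phi_phi[of "\<phi> u"] xi_nonzero by simp
qed

lemma skew: "g (\<phi> u) v = - g u (\<phi> v)"
  using compatible[of "\<phi> u" v] 
  by (simp add: phi_phi eta_phi expand sym[of \<xi>] eta_eq[symmetric])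

lemma g_phi_self: "g (\<phi> u) u = 0"
  using skew[of u u] by (simp add: sym[of u])

text \<open>Only \<open>e\<close> and \<open>f\<close> have to be chosen. \<phi> is skew and
  isometric on ker \<eta>, so \<phi> f is automatically a unit vector orthogonal to the rest once
  \<open>f\<close> is orthogonal to \<xi>, e and \<phi> e.\<close>

lemma exists_frame:
  obtains e f where "\<eta> e = 0" "\<eta> f = 0" "orthonormal_frame \<xi> e (\<phi> e) f (\<phi> f)"
proof -
  have xx: "g \<xi> \<xi> = 1"
    by (simp add: xi_right eta_xi)
  obtain e where "g e e = 1" "\<And>a. a \<in> {\<xi>} \<Longrightarrow> g e a = 0"
    by (rule exists_unit_orthogonal[of "{\<xi>}"]) (auto simp: dim xx)
  then have e: "g e e = 1" "\<eta> e = 0" by (simp_all add: xi_right)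
  have pe: "g (\<phi> e) (\<phi> e) = 1" "g (\<phi> e) e = 0" "g e (\<phi> e) = 0"
    using e g_phi_self[of e] skew[of e e] by (simp_all add: compatible)
  have "card {\<xi>, e, \<phi> e} < DIM('v)"
    using card_insert_le_m1[of 3 "{e, \<phi> e}" \<xi>] card_insert_le_m1[of 2 "{\<phi> e}" e] by (simp add: dim)
  then obtain f where f: "g f f = 1" "\<And>a. a \<in> {\<xi>, e, \<phi> e} \<Longrightarrow> g f a = 0"
    by (rule exists_unit_orthogonal[of "{\<xi>, e, \<phi> e}", rotated])
      (use e pe xx in \<open>auto simp: xi_right xi_left eta_phi\<close>)
  have f': "\<eta> f = 0" "g f e = 0" "g f (\<phi> e) = 0"
    using f(2) by (auto simp: xi_right[symmetric])
  then have f'': "g e f = 0" "g (\<phi> e) f = 0"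
    by (metis sym)+
  have "g e (\<phi> f) = 0"
    using skew[of e f] f'' by simp
  moreover have "g (\<phi> e) (\<phi> f) = 0" "g (\<phi> f) (\<phi> f) = 1"
    using f(1) e f' f'' by (simp_all add: compatible)
  moreover have "g f (\<phi> f) = 0"
    using g_phi_self[of f] skew[of f f] by simp
  ultimately have "orthonormal_frame \<xi> e (\<phi> e) f (\<phi> f)"
    using e pe f(1) f' f'' xx by (simp add: orthonormal_frame_def xi_left eta_phi)
  then show ?thesis
    using that e(2) f'(1) by blast
qed

end

lemmas bilinear_expand = bilinear_ladd bilinear_radd bilinear_lmul bilinear_rmul
      bilinear_lneg bilinear_rneg bilinear_lsub bilinear_rsub bilinear_lzero bilinear_rzero

lemmas linear_expand = linear_add linear_scale linear_neg linear_diff linear_0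

context contact_form
begin

text \<open>On ker \<eta> a skew map anticommuting with \<phi> has two free entries, so its square
  is scalar. Up to scale \<phi>, \<open>h\<close> and \<open>\<phi> h\<close> behave like the
  imaginary quaternions on a 4-dimensional space; their 2-forms are mutually orthogonal in a
  definite 3-dimensional space of 2-forms, whence the vanishing products.\<close>

lemma wedge_identities:
  assumes "linear h" and h_skew: "\<And>u v. g (h u) v = - g (h v) u" and h_xi: "h \<xi> = 0"
    and h_phi: "\<And>u. h (\<phi> u) = - \<phi> (h u)"
  shows "\<exists>L\<ge>0. \<forall>u. h (h u) = (- L) *\<^sub>R (u - \<eta> u *\<^sub>R \<xi>)"
    and "wedge_2_2 (\<lambda>u v. g (h u) v) (\<lambda>u v. g (\<phi> (h u)) v) u v w z = 0"
    and "wedge_2_2 (\<lambda>u v. g (h u) v) (\<lambda>u v. g (\<phi> u) v) u v w z = 0"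
proof -
  obtain e f where e: "\<eta> e = 0" "\<eta> f = 0" and fr: "orthonormal_frame \<xi> e (\<phi> e) f (\<phi> f)"
    by (rule exists_frame)
  note on = fr[unfolded orthonormal_frame_def]
  have hxi: "\<eta> (h u) = 0" for u
    using h_skew[of u \<xi>] by (simp add: h_xi xi_right zero_left)
  \<comment> \<open>\<open>g (h a) (\<phi> b)\<close> is skew too. Hence \<open>h e\<close> is
    orthogonal to \<open>\<phi> e\<close> as well as to \<open>e\<close>, and only its components
    \<open>p\<close>, \<open>q\<close> along \<open>f\<close> and \<open>\<phi> f\<close>
    remain.\<close>
  have sk: "g (h a) (\<phi> b) = - g (h b) (\<phi> a)" for a b
    using h_skew[of a "\<phi> b"] skew[of "h b" a] by (simp add: h_phi minus_left)
  define p q where "p = g (h e) f" and "q = g (h e) (\<phi> f)"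
  define c1 c2 c3 c4 where "c1 u = g u e" and "c2 u = g u (\<phi> e)" and "c3 u = g u f" and "c4 u = g u (\<phi> f)" for u
  note c = c1_def c2_def c3_def c4_def
  have inner: "g u v = \<eta> u * \<eta> v + c1 u * c1 v + c2 u * c2 v + c3 u * c3 v + c4 u * c4 v" for u v
    unfolding c using frame_inner[OF dim fr, of u v] by (simp only: xi_right)
  have phi: "c1 (\<phi> u) = - c2 u" "c2 (\<phi> u) = c1 u" "c3 (\<phi> u) = - c4 u" "c4 (\<phi> u) = c3 u" for u
    by (simp_all add: c skew[of u e] skew[of u f] compatible e)
  have he: "c1 (h e) = 0" "c2 (h e) = 0" "c3 (h e) = p" "c4 (h e) = q"
    using h_skew[of e e] sk[of e e] by (simp_all add: c p_def q_def)
  have hf: "c1 (h f) = - p" "c2 (h f) = - q" "c3 (h f) = 0" "c4 (h f) = 0"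
    using h_skew[of f f] sk[of f f] h_skew[of f e] sk[of f e] by (simp_all add: c p_def q_def)
  have h: "c1 (h u) = - (p * c3 u + q * c4 u)" "c2 (h u) = p * c4 u - q * c3 u"
    "c3 (h u) = p * c1 u + q * c2 u" "c4 (h u) = q * c1 u - p * c2 u" for u
  proof -
    have "c1 (h u) = - g (h e) u" "c2 (h u) = - g (h e) (\<phi> u)" "c3 (h u) = - g (h f) u" "c4 (h u) = - g (h f) (\<phi> u)"
      unfolding c by (rule h_skew sk)+
    then show "c1 (h u) = - (p * c3 u + q * c4 u)" "c2 (h u) = p * c4 u - q * c3 u"
      "c3 (h u) = p * c1 u + q * c2 u" "c4 (h u) = q * c1 u - p * c2 u"
      by (simp_all add: inner he hf phi hxi)
  qed
  show "\<exists>L\<ge>0. \<forall>u. h (h u) = (- L) *\<^sub>R (u - \<eta> u *\<^sub>R \<xi>)"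
  \<comment> \<open>The witness is the squared length of \<open>h e\<close>; \<open>h\<close>
    exchanges the plane of \<open>e\<close>, \<open>\<phi> e\<close> with that of \<open>f\<close>,
    \<open>\<phi> f\<close>.\<close>
  proof (intro exI[of _ "p\<^sup>2 + q\<^sup>2"] conjI allI)
    fix u
    have xc: "c1 \<xi> = 0" "c2 \<xi> = 0" "c3 \<xi> = 0" "c4 \<xi> = 0"
      using on by (simp_all add: c)
    have lin: "ck ((- L) *\<^sub>R (u - r *\<^sub>R \<xi>)) = - L * (ck u - r * ck \<xi>)" if "\<And>u. ck u = g u b" for ck b r L
      by (simp add: that expand)
    have eq: "c1 (h (h u)) = c1 ((- (p\<^sup>2 + q\<^sup>2)) *\<^sub>R (u - \<eta> u *\<^sub>R \<xi>))"
      "c2 (h (h u)) = c2 ((- (p\<^sup>2 + q\<^sup>2)) *\<^sub>R (u - \<eta> u *\<^sub>R \<xi>))"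
      "c3 (h (h u)) = c3 ((- (p\<^sup>2 + q\<^sup>2)) *\<^sub>R (u - \<eta> u *\<^sub>R \<xi>))"
      "c4 (h (h u)) = c4 ((- (p\<^sup>2 + q\<^sup>2)) *\<^sub>R (u - \<eta> u *\<^sub>R \<xi>))"
      unfolding lin[OF c1_def] lin[OF c2_def] lin[OF c3_def] lin[OF c4_def] h xc
      by (simp_all add: algebra_simps power2_eq_square)
    have "\<eta> (h (h u)) = \<eta> ((- (p\<^sup>2 + q\<^sup>2)) *\<^sub>R (u - \<eta> u *\<^sub>R \<xi>))"
      by (simp add: hxi linear_expand[OF linear_eta] eta_xi)
    then show "h (h u) = (- (p\<^sup>2 + q\<^sup>2)) *\<^sub>R (u - \<eta> u *\<^sub>R \<xi>)"
      using eq unfolding c by (intro frame_eqI[OF dim fr]) (simp_all only: xi_right)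
  qed simp
  show "wedge_2_2 (\<lambda>u v. g (h u) v) (\<lambda>u v. g (\<phi> (h u)) v) u v w z = 0"
    unfolding wedge_2_2_def inner by (simp add: eta_phi hxi phi h) algebra
  show "wedge_2_2 (\<lambda>u v. g (h u) v) (\<lambda>u v. g (\<phi> u) v) u v w z = 0"
    unfolding wedge_2_2_def inner by (simp add: eta_phi hxi phi h) algebra
qed

end

text \<open>Here \<open>h\<close> and \<open>N\<close> stand for \<open>\<nabla>\<xi>\<close> and \<open>\<nabla>\<phi>\<close> at a point; \<open>N_phi\<close> is the derivative of
  \<open>\<phi>\<^sup>2 = - I + \<eta> \<otimes> \<xi>\<close>.\<close>

locale contact_derivative = contact_form g \<phi> \<xi> \<eta>
  for g :: "'v::euclidean_space \<Rightarrow> 'v \<Rightarrow> real" and \<phi> \<xi> \<eta> +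
  fixes h :: "'v \<Rightarrow> 'v" and N :: "'v \<Rightarrow> 'v \<Rightarrow> 'v"
  assumes bilinear_N: "bilinear N" and linear_h: "linear h"
    and N_skew: "g (N w u) v = - g (N w v) u"
    and N_phi: "N w (\<phi> u) + \<phi> (N w u) = \<eta> u *\<^sub>R h w + g (h w) u *\<^sub>R \<xi>"
begin

text \<open>At \<open>u = \<xi>\<close> both right-hand terms of \<open>N_phi\<close> have the
  \<eta>-value \<eta> (h w), while the left-hand side has none. Geometrically, a unit field has
  derivative orthogonal to itself.\<close>

lemma eta_h: "\<eta> (h w) = 0"
  using arg_cong[OF N_phi[of w \<xi>], of \<eta>] bilinear_N
  by (simp add: phi_xi eta_phi eta_xi linear_expand[OF linear_eta] bilinear_expand xi_right)

lemma h_eq: "h w = \<phi> (N w \<xi>)"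
  using N_phi[of w \<xi>] eta_h[of w] bilinear_N by (simp add: phi_xi eta_xi bilinear_expand xi_right)

lemma N_xi_right: "N w \<xi> = - \<phi> (h w)"
  using N_skew[of w \<xi> \<xi>] by (simp add: h_eq phi_phi xi_right)

lemma N_move: "g (N w (\<phi> u)) v = g (N w u) (\<phi> v) + \<eta> u * g (h w) v + g (h w) u * \<eta> v"
  using arg_cong[OF N_phi[of w u], of "\<lambda>x. g x v"] skew[of "N w u" v]
  by (simp add: add_left scale_left xi_left)

end

locale nearly_cosymplectic_form = contact_derivative +
  assumes N_swap: "N u v = - N v u"
begin

lemma N_self: "N u u = 0"
  using N_swap[of u u] by (metis eqI minus_left equal_neg_zero zero_left)

text \<open>Skew in the first two slots by \<open>N_swap\<close> and in the last two by
  \<open>N_skew\<close>, the trilinear form is totally skew.\<close>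

lemma N_cyc: "g (N u v) w = g (N v w) u"
  using N_skew[of u v w] N_skew[of w u v] N_swap[of u w] N_swap[of w v] N_skew[of v w u] N_swap[of u v]
  by (simp add: minus_left)

lemma h_xi: "h \<xi> = 0"
  by (simp add: h_eq N_self linear_expand[OF linear_phi])

lemma h_N: "g (h u) v = g (N \<xi> u) (\<phi> v)"
  using skew[of "N u \<xi>" v] N_swap[of u \<xi>] by (simp add: h_eq minus_left)

text \<open>Geometrically, \<xi> is a Killing field. \<open>h \<xi> = 0\<close> removes the
  correction terms of \<open>N_move\<close>, so \<phi> passes freely across
  \<open>N \<xi>\<close>.\<close>

lemma h_skew: "g (h u) v = - g (h v) u"
proof -
  have "g (h v) u = g (N \<xi> v) (\<phi> u)" by (rule h_N)
  also have "\<dots> = - g (N \<xi> (\<phi> u)) v" by (rule N_skew)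
  also have "\<dots> = - g (N \<xi> u) (\<phi> v)" by (simp add: N_move h_xi zero_left)
  finally show ?thesis by (simp add: h_N)
qed

lemma N_xi: "N \<xi> u = \<phi> (h u)"
proof (rule eqI)
  fix w
  have "g (N \<xi> u) \<xi> = 0"
    using N_skew[of \<xi> u \<xi>] by (simp add: N_self zero_left)
  then have "g (N \<xi> u) w = - g (N \<xi> u) (\<phi> (\<phi> w))"
    by (simp add: phi_phi expand)
  also have "\<dots> = g (\<phi> (h u)) w"
    using skew[of "h u" w] by (simp add: h_N)
  finally show "g (N \<xi> u) w = g (\<phi> (h u)) w" .
qed

text \<open>\<open>N \<xi>\<close> is skew and equals the product of \<phi> and \<open>h\<close>,
  which are skew themselves; a product of two skew maps is skew only if they anticommute.\<close>

lemma h_phi: "h (\<phi> u) = - \<phi> (h u)"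
proof (rule eqI)
  fix w
  have "g (h (\<phi> u)) w = - g (h w) (\<phi> u)" by (rule h_skew)
  also have "\<dots> = g (\<phi> (h w)) u" using skew[of "h w" u] by simp
  also have "\<dots> = - g (\<phi> (h u)) w" using N_skew[of \<xi> w u] by (simp add: N_xi)
  finally show "g (h (\<phi> u)) w = g (- \<phi> (h u)) w" by (simp add: minus_left)
qed

text \<open>On the kernel of \<open>\<eta>\<close> the form \<open>g (N u v) w\<close> is complex trilinear and alternating, hence zero
  because that space has complex dimension 2.\<close>

lemma N_eq:
  "g (N u v) w = \<eta> u * g (\<phi> (h v)) w + \<eta> v * g (\<phi> (h w)) u + \<eta> w * g (\<phi> (h u)) v"
proof -
  obtain e f where e: "\<eta> e = 0" "\<eta> f = 0" and fr: "orthonormal_frame \<xi> e (\<phi> e) f (\<phi> f)"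
    by (rule exists_frame)
  have self: "g (N a b) b = 0" "g (N a b) a = 0" "g (N a a) b = 0" for a b
    using N_skew[of a b b] N_cyc[of a b a] N_skew[of b a a] by (simp_all add: N_self zero_left)
  \<comment> \<open>For \<open>b\<close> in ker \<eta>, moving \<phi> from one argument to the other
    keeps the value by \<open>N_move\<close> and reverses its sign by \<open>N_skew\<close>.\<close>
  have pair: "g (N a b) (\<phi> b) = 0" "g (N a (\<phi> b)) b = 0" if "\<eta> b = 0" for a b
    using N_move[of a b b] N_skew[of a b "\<phi> b"] that by auto
  have pair': "g (N b (\<phi> b)) a = 0" "g (N (\<phi> b) b) a = 0" "g (N b a) (\<phi> b) = 0" "g (N (\<phi> b) a) b = 0"
    if "\<eta> b = 0" for a b
    using pair[OF that, of a] N_cyc by metis+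
  note z = self pair[OF e(1)] pair[OF e(2)] pair'[OF e(1)] pair'[OF e(2)]
  \<comment> \<open>\<open>F\<close> is the defect of the claimed identity; being trilinear, it only
    has to vanish on triples from the frame.\<close>
  define F where "F u v w = g (N u v) w - (\<eta> u * g (\<phi> (h v)) w + \<eta> v * g (\<phi> (h w)) u + \<eta> w * g (\<phi> (h u)) v)" for u v w
  note lin = bilinear_expand[OF bilinear_N] linear_expand[OF linear_phi] linear_expand[OF linear_h]
    linear_expand[OF linear_eta] expand
  have l1: "linear (\<lambda>u. F u v w)" and l2: "linear (\<lambda>v. F u v w)" and l3: "linear (\<lambda>w. F u v w)" for u v w
    unfolding F_def by (rule linearI; simp add: lin algebra_simps)+
  have N0: "g (N a \<xi>) b = - g (\<phi> (h a)) b" "\<eta> (N a b) = g (\<phi> (h a)) b" for a b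
    using N_swap[of a \<xi>] N_xi[of a] N_cyc[of \<xi> a b] by (simp_all add: minus_left xi_right)
  have sk: "g (\<phi> (h a)) b = - g (\<phi> (h b)) a" for a b
    using N_skew[of \<xi> a b] by (simp add: N_xi)
  have F0: "F \<xi> a b = 0" "F a \<xi> b = 0" "F a b \<xi> = 0" for a b
    unfolding F_def using sk[of a b] 
    by (simp_all add: N_xi N0 eta_xi h_xi phi_xi lin xi_right eta_phi)
  \<comment> \<open>Three distinct vectors among \<open>e\<close>, \<open>\<phi> e\<close>,
    \<open>f\<close>, \<open>\<phi> f\<close> always contain some \<open>b\<close> together with
    \<open>\<phi> b\<close>, which is the vanishing case of \<open>pair\<close>. This is where
    dimension 5 enters.\<close>
  have F1: "F a b c = 0" if "a \<in> {\<xi>, e, \<phi> e, f, \<phi> f}" "b \<in> {\<xi>, e, \<phi> e, f, \<phi> f}" "c \<in> {\<xi>, e, \<phi> e, f, \<phi> f}" for a b c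
  proof (cases "\<xi> \<in> {a, b, c}")
    case True
    then show ?thesis using F0 by auto
  next
    case False
    then have "a \<in> {e, \<phi> e, f, \<phi> f}" "b \<in> {e, \<phi> e, f, \<phi> f}" "c \<in> {e, \<phi> e, f, \<phi> f}"
      using that by auto
    then show ?thesis
      unfolding F_def by (elim insertE emptyE; simp add: e eta_phi z)
  qed
  have F2: "F a b w = 0" if ab: "a \<in> {\<xi>, e, \<phi> e, f, \<phi> f}" "b \<in> {\<xi>, e, \<phi> e, f, \<phi> f}" for a b
    by (rule frame_linear_zero[OF dim fr l3]; rule F1[OF ab]; simp)
  have F3: "F a v w = 0" if a: "a \<in> {\<xi>, e, \<phi> e, f, \<phi> f}" for a
    by (rule frame_linear_zero[OF dim fr l2]; rule F2[OF a]; simp)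
  have "F u v w = 0"
    by (rule frame_linear_zero[OF dim fr l1]; rule F3; simp)
  then show ?thesis by (simp add: F_def)
qed

end

section \<open>SU(2)-structures on one tangent space\<close>

locale su2_form =
  C1: contact_form g \<phi>\<^sub>1 \<xi> \<eta> + C2: contact_form g \<phi>\<^sub>2 \<xi> \<eta> + C3: contact_form g \<phi>\<^sub>3 \<xi> \<eta>
  for g :: "'v::euclidean_space \<Rightarrow> 'v \<Rightarrow> real" and \<phi>\<^sub>1 \<phi>\<^sub>2 \<phi>\<^sub>3 \<xi> \<eta> +
  assumes quat: "\<phi>\<^sub>1 (\<phi>\<^sub>2 u) = \<phi>\<^sub>3 u" "\<phi>\<^sub>2 (\<phi>\<^sub>1 u) = - \<phi>\<^sub>3 u"
    "\<phi>\<^sub>2 (\<phi>\<^sub>3 u) = \<phi>\<^sub>1 u" "\<phi>\<^sub>3 (\<phi>\<^sub>2 u) = - \<phi>\<^sub>1 u"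
    "\<phi>\<^sub>3 (\<phi>\<^sub>1 u) = \<phi>\<^sub>2 u" "\<phi>\<^sub>1 (\<phi>\<^sub>3 u) = - \<phi>\<^sub>2 u"
begin

text \<open>ker \<eta> is a quaternionic line, so a single unit vector and its three images span
  it.\<close>

lemma su2_frame:
  obtains e where "\<eta> e = 0" "C1.orthonormal_frame \<xi> e (\<phi>\<^sub>1 e) (\<phi>\<^sub>2 e) (\<phi>\<^sub>3 e)"
proof -
  have xx: "g \<xi> \<xi> = 1"
    by (simp add: C1.xi_right C1.eta_xi)
  obtain e where "g e e = 1" "\<And>a. a \<in> {\<xi>} \<Longrightarrow> g e a = 0"
    by (rule C1.exists_unit_orthogonal[of "{\<xi>}"]) (auto simp: C1.dim xx)
  then have e: "g e e = 1" "\<eta> e = 0" by (simp_all add: C1.xi_right)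
  have 0: "g e (\<phi>\<^sub>1 e) = 0" "g e (\<phi>\<^sub>2 e) = 0" "g e (\<phi>\<^sub>3 e) = 0"
    using C1.g_phi_self[of e] C2.g_phi_self[of e] C3.g_phi_self[of e] C1.sym[of e] by auto
  have "C1.orthonormal_frame \<xi> e (\<phi>\<^sub>1 e) (\<phi>\<^sub>2 e) (\<phi>\<^sub>3 e)"
    unfolding C1.orthonormal_frame_def
    using e xx 0 C1.skew[of e "\<phi>\<^sub>2 e"] C1.skew[of e "\<phi>\<^sub>3 e"] C2.skew[of e "\<phi>\<^sub>3 e"]
    by (simp add: C1.xi_left C1.compatible C2.compatible C3.compatible C1.eta_phi C2.eta_phi C3.eta_phi
        quat C1.minus_right)
  then show ?thesis using that e(2) by blast
qed

end

text \<open>\<open>N_prod\<close> is the derivative of the relation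
  \<open>\<phi>\<^sub>1 \<phi>\<^sub>2 = \<phi>\<^sub>3\<close>. The cyclic sums are the exterior
  derivatives of the fundamental forms, expressed through a torsion-free metric connection.\<close>

locale su2_derivative = su2_form +
  N1: contact_derivative g \<phi>\<^sub>1 \<xi> \<eta> h N\<^sub>1 + N2: contact_derivative g \<phi>\<^sub>2 \<xi> \<eta> h N\<^sub>2 +
  N3: contact_derivative g \<phi>\<^sub>3 \<xi> \<eta> h N\<^sub>3
  for h N\<^sub>1 N\<^sub>2 N\<^sub>3 +
  fixes l :: real
  assumes N_prod: "N\<^sub>1 w (\<phi>\<^sub>2 u) + \<phi>\<^sub>1 (N\<^sub>2 w u) = N\<^sub>3 w u"
    and d_eta: "g (h u) v - g (h v) u = - 2 * l * g (\<phi>\<^sub>3 u) v"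
    and d_omega1: "g (N\<^sub>1 u v) w + g (N\<^sub>1 v w) u + g (N\<^sub>1 w u) v =
      3 * l * (\<eta> u * g (\<phi>\<^sub>2 v) w + \<eta> v * g (\<phi>\<^sub>2 w) u + \<eta> w * g (\<phi>\<^sub>2 u) v)"
    and d_omega2: "g (N\<^sub>2 u v) w + g (N\<^sub>2 v w) u + g (N\<^sub>2 w u) v =
      - 3 * l * (\<eta> u * g (\<phi>\<^sub>1 v) w + \<eta> v * g (\<phi>\<^sub>1 w) u + \<eta> w * g (\<phi>\<^sub>1 u) v)"
    and d_omega3: "g (N\<^sub>3 u v) w + g (N\<^sub>3 v w) u + g (N\<^sub>3 w u) v = 0"
begin

lemma h_xi: "h \<xi> = 0"
proof (rule C1.eqI)
  fix w
  show "g (h \<xi>) w = g 0 w"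
    using d_eta[of \<xi> w] N1.eta_h[of w] by (simp add: C3.phi_xi C1.zero_left C1.xi_right)
qed

text \<open>Restricted to the kernel of \<open>\<eta>\<close>, the derivatives \<open>N\<^sub>i\<close> are given by a skew matrix of 1-forms in
  terms of the \<open>\<phi>\<^sub>j\<close>. The forms \<open>d\<omega>\<^sub>i\<close> together with \<open>d\<eta>\<close> determine this matrix and \<open>h\<close>.\<close>

lemma h_N2_eq: "h u = (- l) *\<^sub>R \<phi>\<^sub>3 u" "N\<^sub>2 u v = - l *\<^sub>R (\<eta> u *\<^sub>R \<phi>\<^sub>1 v - \<eta> v *\<^sub>R \<phi>\<^sub>1 u + g (\<phi>\<^sub>1 u) v *\<^sub>R \<xi>)"
proof -
  obtain e where e: "\<eta> e = 0" and fr: "C1.orthonormal_frame \<xi> e (\<phi>\<^sub>1 e) (\<phi>\<^sub>2 e) (\<phi>\<^sub>3 e)"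
    by (rule su2_frame)
  define f1 f2 f3 where "f1 = \<phi>\<^sub>1 e" and "f2 = \<phi>\<^sub>2 e" and "f3 = \<phi>\<^sub>3 e"
  note fr = fr[folded f1_def f2_def f3_def]
  note on = fr[unfolded C1.orthonormal_frame_def]
  have ph: "\<phi>\<^sub>1 e = f1" "\<phi>\<^sub>1 f1 = - e" "\<phi>\<^sub>1 f2 = f3" "\<phi>\<^sub>1 f3 = - f2"
    "\<phi>\<^sub>2 e = f2" "\<phi>\<^sub>2 f1 = - f3" "\<phi>\<^sub>2 f2 = - e" "\<phi>\<^sub>2 f3 = f1"
    "\<phi>\<^sub>3 e = f3" "\<phi>\<^sub>3 f1 = f2" "\<phi>\<^sub>3 f2 = - f1" "\<phi>\<^sub>3 f3 = - e"
    by (simp_all add: f1_def f2_def f3_def quat C1.phi_phi C2.phi_phi C3.phi_phi e)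
  have et: "\<eta> e = 0" "\<eta> f1 = 0" "\<eta> f2 = 0" "\<eta> f3 = 0" "\<eta> \<xi> = 1"
    by (simp_all add: e f1_def f2_def f3_def C1.eta_phi C2.eta_phi C3.eta_phi C1.eta_xi)
  note on' = on C1.sym[of e \<xi>] C1.sym[of f1 \<xi>] C1.sym[of f2 \<xi>] C1.sym[of f3 \<xi>] C1.sym[of f1 e]
    C1.sym[of f2 e] C1.sym[of f3 e] C1.sym[of f2 f1] C1.sym[of f3 f1] C1.sym[of f3 f2]
  have sk0: "g (N\<^sub>1 w u) u = 0" "g (N\<^sub>2 w u) u = 0" "g (N\<^sub>3 w u) u = 0" for w u
    using N1.N_skew[of w u u] N2.N_skew[of w u u] N3.N_skew[of w u u] by simp_all
  \<comment> \<open>The tables that follow say that on ker \<eta>, up to \<xi>-components,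
    \<open>N\<^sub>1 = a \<phi>\<^sub>2 + b \<phi>\<^sub>3\<close>,
    \<open>N\<^sub>2 = - a \<phi>\<^sub>1 + c \<phi>\<^sub>3\<close> and
    \<open>N\<^sub>3 = - b \<phi>\<^sub>1 - c \<phi>\<^sub>2\<close>. Differentiating the
    quaternionic relations leaves no other freedom.\<close>
  define a b c where "a w = g (N\<^sub>1 w e) f2" and "b w = g (N\<^sub>1 w e) f3" and "c w = g (N\<^sub>2 w e) f3" for w
  have n1: "g (N\<^sub>1 w e) f1 = 0" "g (N\<^sub>1 w f2) f3 = 0" "g (N\<^sub>1 w e) f2 = a w" "g (N\<^sub>1 w f1) f3 = - a w"
    "g (N\<^sub>1 w e) f3 = b w" "g (N\<^sub>1 w f1) f2 = b w" for w
    using N1.N_move[of w e e] N1.N_move[of w f2 f2] N1.N_move[of w e f2] N1.N_move[of w e f3]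
      N1.N_skew[of w f1 e] N1.N_skew[of w f3 f2]
    by (simp_all add: ph et C1.minus_right a_def b_def)
  have n2: "g (N\<^sub>2 w e) f2 = 0" "g (N\<^sub>2 w f1) f3 = 0" "g (N\<^sub>2 w e) f3 = c w" "g (N\<^sub>2 w f1) f2 = c w"
    "g (N\<^sub>2 w e) f1 = - a w" "g (N\<^sub>2 w f2) f3 = - a w" for w
  proof -
    have "g (N\<^sub>1 w f2) e = g (N\<^sub>2 w e) f1"
      using arg_cong[OF N_prod[of w e], of "\<lambda>x. g x e"] C1.skew[of "N\<^sub>2 w e" e]
      by (simp add: ph C1.expand sk0)
    then show *: "g (N\<^sub>2 w e) f1 = - a w"
      using N1.N_skew[of w e f2] by (simp add: a_def)
    show "g (N\<^sub>2 w e) f2 = 0" "g (N\<^sub>2 w f1) f3 = 0" "g (N\<^sub>2 w e) f3 = c w" "g (N\<^sub>2 w f1) f2 = c w"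
       "g (N\<^sub>2 w f2) f3 = - a w"
      using N2.N_move[of w e e] N2.N_move[of w f1 f1] N2.N_move[of w e f1] N2.N_move[of w e f3]
        N2.N_skew[of w f2 e] N2.N_skew[of w f3 f1] N2.N_skew[of w f2 f1] *
      by (simp_all add: ph et C1.minus_right C1.minus_left c_def bilinear_rneg[OF N2.bilinear_N])
  qed
  have n3: "g (N\<^sub>3 w e) f3 = 0" "g (N\<^sub>3 w f1) f2 = 0" "g (N\<^sub>3 w e) f1 = - b w" "g (N\<^sub>3 w f2) f3 = - b w"
    "g (N\<^sub>3 w e) f2 = - c w" "g (N\<^sub>3 w f1) f3 = c w" for w
  proof -
    have "g (N\<^sub>3 w e) f1 = g (N\<^sub>1 w f2) f1" "g (N\<^sub>3 w e) f2 = - g (N\<^sub>2 w e) f3"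
      using arg_cong[OF N_prod[of w e], of "\<lambda>x. g x f1"] arg_cong[OF N_prod[of w e], of "\<lambda>x. g x f2"]
        C1.skew[of "N\<^sub>2 w e" f1] C1.skew[of "N\<^sub>2 w e" f2]
      by (simp_all add: ph C1.expand sk0)
    then show *: "g (N\<^sub>3 w e) f1 = - b w" "g (N\<^sub>3 w e) f2 = - c w"
      using N1.N_skew[of w f2 f1] n1[of w] n2[of w] by simp_all
    show "g (N\<^sub>3 w e) f3 = 0" "g (N\<^sub>3 w f1) f2 = 0" "g (N\<^sub>3 w f2) f3 = - b w" "g (N\<^sub>3 w f1) f3 = c w"
      using N3.N_move[of w e e] N3.N_move[of w f1 f1] N3.N_move[of w e f1] N3.N_move[of w e f2]
        N3.N_skew[of w f3 e] N3.N_skew[of w f2 f1] N3.N_skew[of w f3 f2] N3.N_skew[of w f3 f1] *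
      by (simp_all add: ph et C1.minus_right)
  qed
  have n1': "g (N\<^sub>1 w f1) e = 0" "g (N\<^sub>1 w f3) f2 = 0" "g (N\<^sub>1 w f2) e = - a w" "g (N\<^sub>1 w f3) f1 = a w" "g (N\<^sub>1 w f3) e = - b w" "g (N\<^sub>1 w f2) f1 = - b w" for w
    using N1.N_skew[of w f1 e] N1.N_skew[of w f3 f2] N1.N_skew[of w f2 e] N1.N_skew[of w f3 f1] N1.N_skew[of w f3 e] N1.N_skew[of w f2 f1] n1[of w] by simp_all
  have n2': "g (N\<^sub>2 w f2) e = 0" "g (N\<^sub>2 w f3) f1 = 0" "g (N\<^sub>2 w f3) e = - c w" "g (N\<^sub>2 w f2) f1 = - c w" "g (N\<^sub>2 w f1) e = a w" "g (N\<^sub>2 w f3) f2 = a w" for w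
    using N2.N_skew[of w f2 e] N2.N_skew[of w f3 f1] N2.N_skew[of w f3 e] N2.N_skew[of w f2 f1] N2.N_skew[of w f1 e] N2.N_skew[of w f3 f2] n2[of w] by simp_all
  have n3': "g (N\<^sub>3 w f3) e = 0" "g (N\<^sub>3 w f2) f1 = 0" "g (N\<^sub>3 w f1) e = b w" "g (N\<^sub>3 w f3) f2 = b w" "g (N\<^sub>3 w f2) e = c w" "g (N\<^sub>3 w f3) f1 = - c w" for w
    using N3.N_skew[of w f3 e] N3.N_skew[of w f2 f1] N3.N_skew[of w f1 e] N3.N_skew[of w f3 f2] N3.N_skew[of w f2 e] N3.N_skew[of w f3 f1] n3[of w] by simp_all
  \<comment> \<open>The \<xi>-components are governed by \<open>h\<close>, not by \<open>a\<close>,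
    \<open>b\<close>, \<open>c\<close>.\<close>
  have vertical: "g (N\<^sub>1 w u) \<xi> = - g (h w) (\<phi>\<^sub>1 u)" "g (N\<^sub>2 w u) \<xi> = - g (h w) (\<phi>\<^sub>2 u)"
    "g (N\<^sub>3 w u) \<xi> = - g (h w) (\<phi>\<^sub>3 u)" for w u
    using N1.N_skew[of w u \<xi>] N2.N_skew[of w u \<xi>] N3.N_skew[of w u \<xi>]
    by (simp_all add: N1.N_xi_right N2.N_xi_right N3.N_xi_right C1.minus_left C1.skew C2.skew C3.skew)
  have vertical': "g (N\<^sub>1 w \<xi>) u = g (h w) (\<phi>\<^sub>1 u)" "g (N\<^sub>2 w \<xi>) u = g (h w) (\<phi>\<^sub>2 u)"
    "g (N\<^sub>3 w \<xi>) u = g (h w) (\<phi>\<^sub>3 u)" for w u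
    by (simp_all add: N1.N_xi_right N2.N_xi_right N3.N_xi_right C1.minus_left C1.skew C2.skew C3.skew)
  note tables = n1 n1' n2 n2' n3 n3' vertical vertical' et ph on' C1.minus_left C1.minus_right
  \<comment> \<open>Twelve unknown values against the twelve equations not involving \<xi>; every
    right-hand side vanishes because it carries a factor \<eta>.\<close>
  have horizontal: "a e = 0" "a f1 = 0" "a f2 = 0" "a f3 = 0" "b e = 0" "b f1 = 0" "b f2 = 0" "b f3 = 0" "c e = 0" "c f1 = 0" "c f2 = 0" "c f3 = 0"
    using d_omega1[of e f1 f2] d_omega1[of e f1 f3] d_omega1[of e f2 f3] d_omega1[of f1 f2 f3]
      d_omega2[of e f1 f2] d_omega2[of e f1 f3] d_omega2[of e f2 f3] d_omega2[of f1 f2 f3]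
      d_omega3[of e f1 f2] d_omega3[of e f1 f3] d_omega3[of e f2 f3] d_omega3[of f1 f2 f3]
    by (simp_all add: tables)
  \<comment> \<open>\<open>d_eta\<close> fixes only the skew part of \<open>h\<close>. The equations
    with \<xi> in one slot remove its symmetric part and give the values of \<open>a\<close>,
    \<open>b\<close>, \<open>c\<close> at \<xi>.\<close>
  have vert: "a \<xi> = l" "b \<xi> = 0" "c \<xi> = 0"
    "g (h e) e = 0" "g (h e) f1 = 0" "g (h e) f2 = 0" "g (h e) f3 = - l"
    "g (h f1) e = 0" "g (h f1) f1 = 0" "g (h f1) f2 = - l" "g (h f1) f3 = 0"
    "g (h f2) e = 0" "g (h f2) f1 = l" "g (h f2) f2 = 0" "g (h f2) f3 = 0"
    "g (h f3) e = l" "g (h f3) f1 = 0" "g (h f3) f2 = 0" "g (h f3) f3 = 0"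
    using d_omega1[of \<xi> e f1] d_omega1[of \<xi> e f2] d_omega1[of \<xi> e f3] d_omega1[of \<xi> f1 f2] d_omega1[of \<xi> f1 f3] d_omega1[of \<xi> f2 f3]
      d_omega2[of \<xi> e f1] d_omega2[of \<xi> e f2] d_omega2[of \<xi> e f3] d_omega2[of \<xi> f1 f2] d_omega2[of \<xi> f1 f3] d_omega2[of \<xi> f2 f3]
      d_omega3[of \<xi> e f1] d_omega3[of \<xi> e f2] d_omega3[of \<xi> e f3] d_omega3[of \<xi> f1 f2] d_omega3[of \<xi> f1 f3] d_omega3[of \<xi> f2 f3]
      d_eta[of e f1] d_eta[of e f2] d_eta[of e f3] d_eta[of f1 f2] d_eta[of f1 f3] d_eta[of f2 f3]
    by (simp_all add: tables)
  have h_frame: "h e = (- l) *\<^sub>R \<phi>\<^sub>3 e" "h f1 = (- l) *\<^sub>R \<phi>\<^sub>3 f1" "h f2 = (- l) *\<^sub>R \<phi>\<^sub>3 f2" "h f3 = (- l) *\<^sub>R \<phi>\<^sub>3 f3"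
    by (rule C1.frame_eqI[OF C1.dim fr]; simp add: vert ph on' C1.expand C1.xi_right[of "h _"] N1.eta_h)+
  have h: "h u = (- l) *\<^sub>R \<phi>\<^sub>3 u" for u
  proof -
    have "h u - (- l) *\<^sub>R \<phi>\<^sub>3 u = 0"
    proof (rule C1.frame_linear_zero[OF C1.dim fr, where F = "\<lambda>u. h u - (- l) *\<^sub>R \<phi>\<^sub>3 u"])
      show "linear (\<lambda>u. h u - (- l) *\<^sub>R \<phi>\<^sub>3 u)"
        by (intro linear_compose_sub N1.linear_h linear_compose_scale_right C3.linear_phi)
    qed (simp_all add: h_frame h_xi C3.phi_xi)
    then show ?thesis by (simp only: right_minus_eq)
  qed
  note lin = bilinear_expand[OF N1.bilinear_N] bilinear_expand[OF N2.bilinear_N] linear_expand[OF C1.linear_eta]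
    linear_expand[OF C1.linear_phi] C1.expand
  have ac: "a w = l * \<eta> w" "c w = 0" for w
  proof -
    have "a w - l * \<eta> w = 0"
      by (rule C1.frame_linear_zero[OF C1.dim fr, where F = "\<lambda>w. a w - l * \<eta> w"])
        (simp_all add: linear_iff a_def lin algebra_simps, simp_all add: a_def[symmetric] horizontal vert et)
    then show "a w = l * \<eta> w" by simp
    show "c w = 0"
      by (rule C1.frame_linear_zero[OF C1.dim fr, where F = c])
        (simp_all add: linear_iff c_def lin algebra_simps, simp_all add: c_def[symmetric] horizontal vert et)
  qed
  \<comment> \<open>Horizontal \<open>v\<close> suffice here; for \<open>v = \<xi>\<close> the value
    follows from \<open>N_xi_right\<close> and the formula for \<open>h\<close>.\<close>
  have N_frame: "N\<^sub>2 u v = - l *\<^sub>R (\<eta> u *\<^sub>R \<phi>\<^sub>1 v - \<eta> v *\<^sub>R \<phi>\<^sub>1 u + g (\<phi>\<^sub>1 u) v *\<^sub>R \<xi>)"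
    if "v \<in> {e, f1, f2, f3}" for u v
    using that
    by (elim insertE emptyE; hypsubst; intro C1.frame_eqI[OF C1.dim fr])
      (simp_all add: n2 n2' vertical ac h et ph on' C1.expand C1.skew C3.skew sk0)
  show "h u = (- l) *\<^sub>R \<phi>\<^sub>3 u" by (rule h)
  have "N\<^sub>2 u v - (- l *\<^sub>R (\<eta> u *\<^sub>R \<phi>\<^sub>1 v - \<eta> v *\<^sub>R \<phi>\<^sub>1 u + g (\<phi>\<^sub>1 u) v *\<^sub>R \<xi>)) = 0"
  proof (rule C1.frame_linear_zero[OF C1.dim fr, where
        F = "\<lambda>v. N\<^sub>2 u v - (- l *\<^sub>R (\<eta> u *\<^sub>R \<phi>\<^sub>1 v - \<eta> v *\<^sub>R \<phi>\<^sub>1 u + g (\<phi>\<^sub>1 u) v *\<^sub>R \<xi>))"])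
    show "linear (\<lambda>v. N\<^sub>2 u v - (- l *\<^sub>R (\<eta> u *\<^sub>R \<phi>\<^sub>1 v - \<eta> v *\<^sub>R \<phi>\<^sub>1 u + g (\<phi>\<^sub>1 u) v *\<^sub>R \<xi>)))"
      by (rule linearI) (simp_all add: lin algebra_simps)
  qed (simp_all add: N_frame N2.N_xi_right h et C1.phi_xi C1.xi_right C1.eta_phi quat
      linear_expand[OF C2.linear_phi])
  then show "N\<^sub>2 u v = - l *\<^sub>R (\<eta> u *\<^sub>R \<phi>\<^sub>1 v - \<eta> v *\<^sub>R \<phi>\<^sub>1 u + g (\<phi>\<^sub>1 u) v *\<^sub>R \<xi>)"
    by (simp only: right_minus_eq)
qed

end

section \<open>The Levi-Civita connection in a chart\<close>

definition endo_on :: "'v::euclidean_space set \<Rightarrow> ('v \<Rightarrow> 'v \<Rightarrow> 'v) \<Rightarrow> bool" where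
  "endo_on V \<psi> \<longleftrightarrow> (\<forall>x\<in>V. linear (\<psi> x)) \<and> (\<forall>u. smooth_on V (\<lambda>x. \<psi> x u))"

lemma endo_onD:
  assumes "endo_on V \<psi>"
  shows "x \<in> V \<Longrightarrow> linear (\<psi> x)" "smooth_on V (\<lambda>x. \<psi> x u)" "x \<in> V \<Longrightarrow> (\<lambda>x. \<psi> x u) differentiable (at x)"
  using assms smooth_on_differentiable[of V "\<lambda>x. \<psi> x u"] by (auto simp: endo_on_def)

lemma endo_on_comp:
  assumes "open V" "endo_on V \<psi>" "endo_on V \<kappa>"
  shows "endo_on V (\<lambda>x u. \<psi> x (\<kappa> x u))"
proof -
  have "linear (\<lambda>u. \<psi> x (\<kappa> x u))" if "x \<in> V" for x
    using linear_compose[OF endo_onD(1)[OF assms(3) that] endo_onD(1)[OF assms(2) that]] by (simp add: o_def)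
  moreover have "smooth_on V (\<lambda>x. \<psi> x (\<kappa> x u))" for u
    by (rule smooth_on_linear_apply[OF assms(1) endo_onD(1)[OF assms(2)] endo_onD(2)[OF assms(2)] endo_onD(2)[OF assms(3)]])
  ultimately show ?thesis by (simp add: endo_on_def)
qed

lemma endo_on_scale:
  assumes "open V" "endo_on V \<psi>"
  shows "endo_on V (\<lambda>x u. r *\<^sub>R \<psi> x u)"
  using assms by (auto simp: endo_on_def intro: linear_compose_scale_right smooth_on_scaleR)

locale riemannian_chart =
  fixes V :: "'v::euclidean_space set" and g :: "'v \<Rightarrow> 'v \<Rightarrow> 'v \<Rightarrow> real"
  assumes open_V: "open V" and smooth_g: "smooth_on V (\<lambda>x. g x u v)"
    and inner_form: "x \<in> V \<Longrightarrow> inner_form (g x)"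
begin

lemma form_smooth:
  assumes \<psi>: "endo_on V \<psi>"
  shows "smooth_on V (\<lambda>y. g y (\<psi> y u) v)"
  by (rule smooth_on_linear_apply[where A="\<lambda>y u. g y u v", OF open_V _ smooth_g endo_onD(2)[OF \<psi>]])
    (rule inner_form.linear_left[OF inner_form])

end

locale metric_chart = riemannian_chart V g for V :: "'v::euclidean_space set" and g +
  fixes D :: "('v \<Rightarrow> 'v) \<Rightarrow> ('v \<Rightarrow> 'v) \<Rightarrow> 'v \<Rightarrow> 'v"
  assumes levi_civita: "levi_civita_on V g D"
begin

text \<open>The Christoffel symbols in coordinate-free notation, since constant fields are the
  coordinate fields of the chart.\<close>

definition christoffel :: "'v \<Rightarrow> 'v \<Rightarrow> 'v \<Rightarrow> 'v" where
  "christoffel x u v = D (\<lambda>_. u) (\<lambda>_. v) x"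

lemma const_vfields [simp]: "(\<lambda>_. u) \<in> vfields V"
  by (simp add: vfields_def)

lemma D_closed: "X \<in> vfields V \<Longrightarrow> Y \<in> vfields V \<Longrightarrow> D X Y \<in> vfields V"
  and D_add_left: "X \<in> vfields V \<Longrightarrow> X' \<in> vfields V \<Longrightarrow> Y \<in> vfields V \<Longrightarrow> x \<in> V \<Longrightarrow>
    D (\<lambda>y. X y + X' y) Y x = D X Y x + D X' Y x"
  and D_scale_left: "smooth_on V f \<Longrightarrow> X \<in> vfields V \<Longrightarrow> Y \<in> vfields V \<Longrightarrow> x \<in> V \<Longrightarrow>
    D (\<lambda>y. f y *\<^sub>R X y) Y x = f x *\<^sub>R D X Y x"
  and D_add_right: "X \<in> vfields V \<Longrightarrow> Y \<in> vfields V \<Longrightarrow> Y' \<in> vfields V \<Longrightarrow> x \<in> V \<Longrightarrow>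
    D X (\<lambda>y. Y y + Y' y) x = D X Y x + D X Y' x"
  and D_scale_right: "smooth_on V f \<Longrightarrow> X \<in> vfields V \<Longrightarrow> Y \<in> vfields V \<Longrightarrow> x \<in> V \<Longrightarrow>
    D X (\<lambda>y. f y *\<^sub>R Y y) x = dirder X f x *\<^sub>R Y x + f x *\<^sub>R D X Y x"
  and D_torsion: "X \<in> vfields V \<Longrightarrow> Y \<in> vfields V \<Longrightarrow> x \<in> V \<Longrightarrow> D X Y x - D Y X x = lie_bracket X Y x"
  and D_metric: "X \<in> vfields V \<Longrightarrow> Y \<in> vfields V \<Longrightarrow> Z \<in> vfields V \<Longrightarrow> x \<in> V \<Longrightarrow>
    dirder X (\<lambda>y. g y (Y y) (Z y)) x = g x (D X Y x) (Z x) + g x (Y x) (D X Z x)"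
  using levi_civita by (simp_all add: levi_civita_on_def)

lemma christoffel_sym:
  assumes "x \<in> V" shows "christoffel x u v = christoffel x v u"
  using D_torsion[OF const_vfields const_vfields assms, of u v]
  by (simp add: christoffel_def lie_bracket_def)

lemma christoffel_bilinear:
  assumes x: "x \<in> V" shows "bilinear (christoffel x)"
proof -
  have "linear (\<lambda>u. christoffel x u v)" for v
    using D_add_left[OF const_vfields const_vfields const_vfields x]
      D_scale_left[OF smooth_on_const const_vfields const_vfields x]
    by (intro linearI) (simp_all add: christoffel_def)
  moreover have "linear (christoffel x u)" for u
  proof -
    have "christoffel x u = (\<lambda>v. christoffel x v u)"
      by (rule ext) (rule christoffel_sym[OF x])
    then show ?thesis using \<open>linear (\<lambda>v. christoffel x v u)\<close> by simp
  qed
  ultimately show ?thesis by (simp add: bilinear_def)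
qed

lemma metric_derivative:
  assumes x: "x \<in> V"
  shows "frechet_derivative (\<lambda>y. g y u v) (at x) w = g x (christoffel x w u) v + g x u (christoffel x w v)"
  using D_metric[OF const_vfields const_vfields const_vfields x, of w u v]
  by (simp add: christoffel_def dirder_def)

lemma D_frame_left:
  assumes x: "x \<in> V" and Y: "Y \<in> vfields V" and "finite B" and f: "\<And>b. b \<in> B \<Longrightarrow> smooth_on V (f b)"
  shows "D (\<lambda>y. \<Sum>b\<in>B. f b y *\<^sub>R b) Y x = (\<Sum>b\<in>B. f b x *\<^sub>R D (\<lambda>_. b) Y x)"
  using \<open>finite B\<close> f
proof (induction B)
  case empty
  show ?case
    using D_scale_left[OF smooth_on_const const_vfields Y x, of 0 0] by simp
next
  case (insert b B)
  have v: "(\<lambda>y. f b y *\<^sub>R b) \<in> vfields V" "(\<lambda>y. \<Sum>b\<in>B. f b y *\<^sub>R b) \<in> vfields V"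
    using insert.prems by (auto simp: vfields_def intro!: smooth_on_scaleR smooth_on_sum open_V)
  show ?case
    using insert D_add_left[OF v Y x] D_scale_left[OF _ const_vfields Y x, of "f b" b]
    by simp
qed

lemma D_frame_right:
  assumes x: "x \<in> V" and X: "X \<in> vfields V" and "finite B" and f: "\<And>b. b \<in> B \<Longrightarrow> smooth_on V (f b)"
  shows "D X (\<lambda>y. \<Sum>b\<in>B. f b y *\<^sub>R b) x = (\<Sum>b\<in>B. dirder X (f b) x *\<^sub>R b + f b x *\<^sub>R D X (\<lambda>_. b) x)"
  using \<open>finite B\<close> f
proof (induction B)
  case empty
  show ?case
    using D_scale_right[OF smooth_on_const X const_vfields x, of 0 0] by (simp add: dirder_def)
next
  case (insert b B)
  have v: "(\<lambda>y. f b y *\<^sub>R b) \<in> vfields V" "(\<lambda>y. \<Sum>b\<in>B. f b y *\<^sub>R b) \<in> vfields V"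
    using insert.prems by (auto simp: vfields_def intro!: smooth_on_scaleR smooth_on_sum open_V)
  show ?case
    using insert D_add_right[OF X v x] D_scale_right[OF _ X const_vfields x, of "f b" b]
    by simp
qed

text \<open>Every field on a chart is a smooth combination of constant basis fields, so the axioms
  of a connection determine \<open>D X Y\<close> pointwise without cutoff functions or a separate
  locality argument.\<close>

lemma D_eq:
  assumes X: "X \<in> vfields V" and Y: "Y \<in> vfields V" and x: "x \<in> V"
  shows "D X Y x = frechet_derivative Y (at x) (X x) + christoffel x (X x) (Y x)"
proof -
  have sm: "smooth_on V (\<lambda>y. Z y \<bullet> b)" if "Z \<in> vfields V" for Z b
    using that by (intro smooth_on_inner open_V) (simp add: vfields_def)
  have rep: "D Z W = D (\<lambda>y. \<Sum>b\<in>Basis. (Z y \<bullet> b) *\<^sub>R b) W" "D W Z = D W (\<lambda>y. \<Sum>b\<in>Basis. (Z y \<bullet> b) *\<^sub>R b)" for Z W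
    by (simp_all add: euclidean_representation)
  note bil = christoffel_bilinear[OF x]
  have lin: "linear (\<lambda>u. christoffel x u v)" "linear (christoffel x u)" for u v
    using bil by (simp_all add: bilinear_def)
  have left: "D X (\<lambda>_. b) x = christoffel x (X x) b" for b
  proof -
    have "D X (\<lambda>_. b) x = (\<Sum>c\<in>Basis. (X x \<bullet> c) *\<^sub>R christoffel x c b)"
      unfolding rep(1)[of X] christoffel_def by (rule D_frame_left) (auto simp: x sm X)
    also have "\<dots> = christoffel x (\<Sum>c\<in>Basis. (X x \<bullet> c) *\<^sub>R c) b"
      by (simp add: linear_sum[OF lin(1)] linear_scale[OF lin(1)])
    finally show ?thesis by (simp add: euclidean_representation)
  qed
  have dY: "Y differentiable (at x)"
    using Y x by (auto simp: vfields_def smooth_on_differentiable)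
  have "D X Y x = (\<Sum>b\<in>Basis. dirder X (\<lambda>y. Y y \<bullet> b) x *\<^sub>R b + (Y x \<bullet> b) *\<^sub>R D X (\<lambda>_. b) x)"
    unfolding rep(2)[of X Y] by (rule D_frame_right) (auto simp: x sm X Y)
  also have "\<dots> = (\<Sum>b\<in>Basis. (frechet_derivative Y (at x) (X x) \<bullet> b) *\<^sub>R b)
      + (\<Sum>b\<in>Basis. (Y x \<bullet> b) *\<^sub>R christoffel x (X x) b)"
    by (simp add: sum.distrib left dirder_def
        frechet_derivative_bounded_linear[OF bounded_linear_inner_left dY])
  also have "(\<Sum>b\<in>Basis. (Y x \<bullet> b) *\<^sub>R christoffel x (X x) b) = christoffel x (X x) (\<Sum>b\<in>Basis. (Y x \<bullet> b) *\<^sub>R b)"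
    by (simp add: linear_sum[OF lin(2)] linear_scale[OF lin(2)])
  finally show ?thesis by (simp add: euclidean_representation)
qed

definition nabla :: "('v \<Rightarrow> 'v \<Rightarrow> 'v) \<Rightarrow> 'v \<Rightarrow> 'v \<Rightarrow> 'v \<Rightarrow> 'v" where
  "nabla \<psi> x w u = frechet_derivative (\<lambda>y. \<psi> y u) (at x) w + christoffel x w (\<psi> x u) - \<psi> x (christoffel x w u)"

lemma cov_deriv_endo_eq:
  assumes \<psi>: "endo_on V \<psi>" and X: "X \<in> vfields V" and Y: "Y \<in> vfields V" and x: "x \<in> V"
  shows "cov_deriv_endo D \<psi> X Y x = nabla \<psi> x (X x) (Y x)"
proof -
  note l = endo_onD(1)[OF \<psi>] and s = endo_onD(2)[OF \<psi>]
  have Yv: "(\<lambda>y. \<psi> y (Y y)) \<in> vfields V"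
    using smooth_on_linear_apply[OF open_V l s, of Y] Y by (simp add: vfields_def)
  have dY: "Y differentiable (at x)"
    using Y x by (auto simp: vfields_def smooth_on_differentiable)
  have "frechet_derivative (\<lambda>y. \<psi> y (Y y)) (at x) (X x) =
      frechet_derivative (\<lambda>y. \<psi> y (Y x)) (at x) (X x) + \<psi> x (frechet_derivative Y (at x) (X x))"
    by (rule frechet_derivative_linear_apply[OF open_V x _ _ dY]) (use l endo_onD(3)[OF \<psi> x] in auto)
  then show ?thesis
    using linear_add[OF l[OF x]]
    by (simp add: cov_deriv_endo_def D_eq[OF X Yv x] D_eq[OF X Y x] nabla_def)
qed

lemma nabla_bilinear:
  assumes \<psi>: "endo_on V \<psi>" and x: "x \<in> V"
  shows "bilinear (nabla \<psi> x)"
proof -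
  note l = endo_onD(1)[OF \<psi> x]
  have 1: "linear (\<lambda>u. frechet_derivative (\<lambda>y. \<psi> y u) (at x) w)" for w
    by (rule frechet_derivative_linear_apply_linear[OF open_V x]) (use endo_onD[OF \<psi>] x in auto)
  have 2: "linear (frechet_derivative (\<lambda>y. \<psi> y u) (at x))" for u
    by (rule linear_frechet_derivative[OF endo_onD(3)[OF \<psi> x]])
  note e = linear_expand[OF 1] linear_expand[OF 2] linear_expand[OF l] bilinear_expand[OF christoffel_bilinear[OF x]]
  show ?thesis
    unfolding bilinear_def nabla_def by (intro conjI allI linearI) (simp_all add: e algebra_simps)
qed

lemma nabla_comp:
  assumes \<psi>: "endo_on V \<psi>" and \<kappa>: "endo_on V \<kappa>" and x: "x \<in> V"
  shows "nabla (\<lambda>y u. \<psi> y (\<kappa> y u)) x w u = nabla \<psi> x w (\<kappa> x u) + \<psi> x (nabla \<kappa> x w u)"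
proof -
  have "frechet_derivative (\<lambda>y. \<psi> y (\<kappa> y u)) (at x) w =
      frechet_derivative (\<lambda>y. \<psi> y (\<kappa> x u)) (at x) w + \<psi> x (frechet_derivative (\<lambda>y. \<kappa> y u) (at x) w)"
    by (rule frechet_derivative_linear_apply[OF open_V x]) (use endo_onD[OF \<psi>] endo_onD[OF \<kappa>] x in auto)
  then show ?thesis
    by (simp add: nabla_def linear_expand[OF endo_onD(1)[OF \<psi> x]])
qed

lemma nabla_cong:
  assumes \<psi>: "endo_on V \<psi>" and eq: "\<And>y u. y \<in> V \<Longrightarrow> \<psi> y u = \<kappa> y u" and x: "x \<in> V"
  shows "nabla \<psi> x w u = nabla \<kappa> x w u"
proof -
  have "frechet_derivative (\<lambda>y. \<psi> y u) (at x) = frechet_derivative (\<lambda>y. \<kappa> y u) (at x)"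
    by (rule frechet_derivative_transform_within_open[OF endo_onD(3)[OF \<psi> x] open_V x]) (rule eq)
  then show ?thesis using eq[OF x] by (simp add: nabla_def)
qed

lemma form_derivative:
  assumes \<psi>: "endo_on V \<psi>" and x: "x \<in> V"
  shows "frechet_derivative (\<lambda>y. g y (\<psi> y u) v) (at x) w =
    g x (nabla \<psi> x w u) v + g x (\<psi> x (christoffel x w u)) v + g x (\<psi> x u) (christoffel x w v)"
proof -
  interpret inner_form "g x" by (rule inner_form[OF x])
  have "frechet_derivative (\<lambda>y. g y (\<psi> y u) v) (at x) w =
      frechet_derivative (\<lambda>y. g y (\<psi> x u) v) (at x) w + g x (frechet_derivative (\<lambda>y. \<psi> y u) (at x) w) v"
    by (rule frechet_derivative_linear_apply[OF open_V x, where A="\<lambda>y u. g y u v"])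
      (use inner_form.linear_left[OF inner_form] smooth_on_differentiable[OF smooth_g x] endo_onD(3)[OF \<psi> x] in auto)
  then show ?thesis
    by (simp add: metric_derivative[OF x] nabla_def expand)
qed

text \<open>The metric is parallel, so skewness survives covariant differentiation: in coordinates
  the Christoffel terms on the two sides match by skewness of \<psi>.\<close>

lemma nabla_skew:
  assumes \<psi>: "endo_on V \<psi>" and x: "x \<in> V"
    and sk: "\<And>y u v. y \<in> V \<Longrightarrow> g y (\<psi> y u) v = - g y (\<psi> y v) u"
  shows "g x (nabla \<psi> x w u) v = - g x (nabla \<psi> x w v) u"
proof -
  have "frechet_derivative (\<lambda>y. g y (\<psi> y u) v) (at x) w = - frechet_derivative (\<lambda>y. g y (\<psi> y v) u) (at x) w"
    using fun_cong[OF frechet_derivative_transform_within_open[OF smooth_on_differentiable[OF form_smooth[OF \<psi>] x] open_V x sk], of u v w]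
      frechet_derivative_uminus[OF smooth_on_differentiable[OF form_smooth[OF \<psi>] x], of v u w] by simp
  then show ?thesis
    unfolding form_derivative[OF \<psi> x] using sk[OF x, of "christoffel x w u" v] sk[OF x, of u "christoffel x w v"]
    by simp
qed

text \<open>For a torsion-free connection d is the alternation of \<nabla>: the six Christoffel
  terms cancel by symmetry, and \<open>nabla_skew\<close> turns the alternating sum into a cyclic
  one.\<close>

lemma cd2_form:
  assumes \<psi>: "endo_on V \<psi>" and x: "x \<in> V"
    and sk: "\<And>y u v. y \<in> V \<Longrightarrow> g y (\<psi> y u) v = - g y (\<psi> y v) u"
  shows "cd2 (\<lambda>y u v. g y (\<psi> y u) v) x u v w =
    g x (nabla \<psi> x u v) w + g x (nabla \<psi> x v w) u + g x (nabla \<psi> x w u) v"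
  unfolding cd2_def form_derivative[OF \<psi> x]
  using nabla_skew[OF assms, of v u w] christoffel_sym[OF x, of u v] christoffel_sym[OF x, of u w]
    christoffel_sym[OF x, of v w] sk[OF x, of u "christoffel x v w"] sk[OF x, of u "christoffel x w v"]
    sk[OF x, of v "christoffel x u w"] sk[OF x, of w "christoffel x u v"]
    sk[OF x, of "christoffel x u w" v] sk[OF x, of "christoffel x u v" w] sk[OF x, of "christoffel x v w" u]
  by simp

end

section \<open>Nearly cosymplectic structures in a chart\<close>

context metric_chart
begin

definition nabla_vec :: "('v \<Rightarrow> 'v) \<Rightarrow> 'v \<Rightarrow> 'v \<Rightarrow> 'v" where
  "nabla_vec \<xi> x w = D (\<lambda>_. w) \<xi> x"

lemma nabla_vec_eq:
  assumes "smooth_on V \<xi>" "x \<in> V"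
  shows "nabla_vec \<xi> x w = frechet_derivative \<xi> (at x) w + christoffel x w (\<xi> x)"
  using D_eq[OF const_vfields _ assms(2), of \<xi> w] assms(1) by (simp add: nabla_vec_def vfields_def)

lemma nabla_vec_endo:
  assumes "smooth_on V \<xi>"
  shows "endo_on V (nabla_vec \<xi>)"
proof -
  have \<xi>: "\<xi> \<in> vfields V" using assms by (simp add: vfields_def)
  have "linear (nabla_vec \<xi> x)" if x: "x \<in> V" for x
    using D_add_left[OF const_vfields const_vfields \<xi> x] D_scale_left[OF smooth_on_const const_vfields \<xi> x]
    by (intro linearI) (simp_all add: nabla_vec_def)
  moreover have "smooth_on V (\<lambda>x. nabla_vec \<xi> x u)" for u
    using D_closed[OF const_vfields \<xi>, of u] by (simp add: nabla_vec_def vfields_def)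
  ultimately show ?thesis by (simp add: endo_on_def)
qed

text \<open>The Leibniz rule for \<psi> \<xi>; the first two summands on the right are its covariant
  derivative.\<close>

lemma nabla_apply_vec:
  assumes \<psi>: "endo_on V \<psi>" and \<xi>: "smooth_on V \<xi>" and x: "x \<in> V"
  shows "nabla \<psi> x w (\<xi> x) = frechet_derivative (\<lambda>y. \<psi> y (\<xi> y)) (at x) w
    + christoffel x w (\<psi> x (\<xi> x)) - \<psi> x (nabla_vec \<xi> x w)"
proof -
  have "frechet_derivative (\<lambda>y. \<psi> y (\<xi> y)) (at x) w =
      frechet_derivative (\<lambda>y. \<psi> y (\<xi> x)) (at x) w + \<psi> x (frechet_derivative \<xi> (at x) w)"
    by (rule frechet_derivative_linear_apply[OF open_V x])
      (use endo_onD[OF \<psi>] x smooth_on_differentiable[OF \<xi> x] in auto)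
  then show ?thesis
    by (simp add: nabla_def nabla_vec_eq[OF \<xi> x] linear_expand[OF endo_onD(1)[OF \<psi> x]])
qed

end

section \<open>Almost contact metric structures in a chart\<close>

locale contact_chart = metric_chart V g D
  for V :: "'v::euclidean_space set" and g D +
  fixes \<phi> :: "'v \<Rightarrow> 'v \<Rightarrow> 'v" and \<xi> :: "'v \<Rightarrow> 'v" and \<eta> :: "'v \<Rightarrow> 'v \<Rightarrow> real"
  assumes phi_endo: "endo_on V \<phi>" and smooth_xi: "smooth_on V \<xi>"
    and contact: "x \<in> V \<Longrightarrow> contact_form (g x) (\<phi> x) (\<xi> x) (\<eta> x)"
begin

abbreviation "h \<equiv> nabla_vec \<xi>"

lemmas h_endo = nabla_vec_endo[OF smooth_xi]

lemma eta_eq: "x \<in> V \<Longrightarrow> \<eta> x u = g x u (\<xi> x)"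
  using contact_form.eta_eq[OF contact] .

lemma smooth_eta: "smooth_on V (\<lambda>x. \<eta> x u)"
proof (rule smooth_on_cong[OF open_V])
  show "smooth_on V (\<lambda>x. g x u (\<xi> x))"
    by (rule smooth_on_linear_apply[where A="\<lambda>x. g x u", OF open_V _ smooth_g smooth_xi])
      (rule inner_form.linear_right[OF inner_form])
qed (rule eta_eq[symmetric])

text \<open>\<eta> is metrically dual to \<xi> and the metric is parallel, so \<nabla>\<eta> is dual
  to \<open>h\<close>; the other summand is the coordinate correction.\<close>

lemma eta_derivative:
  assumes x: "x \<in> V"
  shows "frechet_derivative (\<lambda>y. \<eta> y u) (at x) w = \<eta> x (christoffel x w u) + g x u (h x w)"
proof -
  interpret inner_form "g x" by (rule inner_form[OF x])
  have "frechet_derivative (\<lambda>y. \<eta> y u) (at x) w = frechet_derivative (\<lambda>y. g y u (\<xi> y)) (at x) w"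
    by (rule fun_cong[OF frechet_derivative_transform_within_open[OF smooth_on_differentiable[OF smooth_eta x] open_V x eta_eq]])
  also have "\<dots> = frechet_derivative (\<lambda>y. g y u (\<xi> x)) (at x) w + g x u (frechet_derivative \<xi> (at x) w)"
    by (rule frechet_derivative_linear_apply[OF open_V x])
      (use inner_form.linear_right[OF inner_form] smooth_on_differentiable[OF smooth_g x]
        smooth_on_differentiable[OF smooth_xi x] in auto)
  finally show ?thesis
    by (simp add: metric_derivative[OF x] eta_eq[OF x] nabla_vec_eq[OF smooth_xi x] expand)
qed

lemma cd1_eta:
  assumes x: "x \<in> V"
  shows "cd1 \<eta> x u v = g x (h x u) v - g x (h x v) u"
  using christoffel_sym[OF x, of u v] inner_form.sym[OF inner_form[OF x]]
  by (simp add: cd1_def eta_derivative[OF x])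

lemma phi_skew:
  assumes x: "x \<in> V"
  shows "g x (\<phi> x u) v = - g x (\<phi> x v) u"
proof -
  interpret contact_form "g x" "\<phi> x" "\<xi> x" "\<eta> x" by (rule contact[OF x])
  show ?thesis using skew[of u v] sym[of u "\<phi> x v"] by linarith
qed

lemma contact_derivative:
  assumes x: "x \<in> V"
  shows "contact_derivative (g x) (\<phi> x) (\<xi> x) (\<eta> x) (h x) (nabla \<phi> x)"
proof -
  interpret contact_form "g x" "\<phi> x" "\<xi> x" "\<eta> x" by (rule contact[OF x])
  note chr = bilinear_expand[OF christoffel_bilinear[OF x]]
  show ?thesis
  proof (intro contact_derivative.intro contact_form_axioms contact_derivative_axioms.intro)
    show "bilinear (nabla \<phi> x)" by (rule nabla_bilinear[OF phi_endo x])
    show "linear (h x)" by (rule endo_onD(1)[OF h_endo x])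
    show "g x (nabla \<phi> x w u) v = - g x (nabla \<phi> x w v) u" for w u v
      by (rule nabla_skew[OF phi_endo x phi_skew])
    fix w u
    have d: "(\<lambda>y. \<eta> y u *\<^sub>R \<xi> y) differentiable (at x)"
      by (rule smooth_on_differentiable[OF smooth_on_scaleR[OF open_V smooth_eta smooth_xi] x])
    have "frechet_derivative (\<lambda>y. \<eta> y u *\<^sub>R \<xi> y - u) (at x) w =
        \<eta> x u *\<^sub>R frechet_derivative \<xi> (at x) w + (\<eta> x (christoffel x w u) + g x u (h x w)) *\<^sub>R \<xi> x"
      using d smooth_on_differentiable[OF smooth_eta x] smooth_on_differentiable[OF smooth_xi x]
      by (simp add: frechet_derivative_diff frechet_derivative_scaleR eta_derivative[OF x])
    \<comment> \<open>The identity part contributes nothing: it is parallel, so its two Christoffel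
      terms cancel.\<close>
    then have 1: "nabla (\<lambda>y u. \<eta> y u *\<^sub>R \<xi> y - u) x w u =
        \<eta> x u *\<^sub>R h x w + g x (h x w) u *\<^sub>R \<xi> x"
      by (simp add: nabla_def nabla_vec_eq[OF smooth_xi x] chr algebra_simps sym[of u])
    have "nabla \<phi> x w (\<phi> x u) + \<phi> x (nabla \<phi> x w u) = nabla (\<lambda>y u. \<phi> y (\<phi> y u)) x w u"
      by (rule nabla_comp[OF phi_endo phi_endo x, symmetric])
    also have "\<dots> = nabla (\<lambda>y u. \<eta> y u *\<^sub>R \<xi> y - u) x w u"
      by (rule nabla_cong[OF endo_on_comp[OF open_V phi_endo phi_endo] _ x])
        (simp add: contact_form.phi_phi[OF contact])
    also note 1
    finally show "nabla \<phi> x w (\<phi> x u) + \<phi> x (nabla \<phi> x w u) = \<eta> x u *\<^sub>R h x w + g x (h x w) u *\<^sub>R \<xi> x" .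
  qed
qed

end

locale nearly_chart = contact_chart V g D \<phi> \<xi> \<eta>
  for V :: "'v::euclidean_space set" and g D \<phi> \<xi> \<eta> +
  assumes nabla_swap: "x \<in> V \<Longrightarrow> nabla \<phi> x u v = - nabla \<phi> x v u"
begin

lemma nearly_form:
  assumes "x \<in> V"
  shows "nearly_cosymplectic_form (g x) (\<phi> x) (\<xi> x) (\<eta> x) (h x) (nabla \<phi> x)"
  by (intro nearly_cosymplectic_form.intro nearly_cosymplectic_form_axioms.intro
      contact_derivative nabla_swap assms)

definition \<omega> :: "'v \<Rightarrow> 'v \<Rightarrow> 'v \<Rightarrow> real" where "\<omega> x u v = g x (\<phi> x u) v"

definition \<alpha> :: "'v \<Rightarrow> 'v \<Rightarrow> 'v \<Rightarrow> real" where "\<alpha> x u v = g x (\<phi> x (h x u)) v"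

text \<open>\<open>- L\<close> is the eigenvalue of \<open>h\<^sup>2\<close> on the kernel of \<open>\<eta>\<close>; as a trace it is visibly smooth.\<close>

definition L :: "'v \<Rightarrow> real" where
  "L x = - (\<Sum>b\<in>Basis. h x (h x b) \<bullet> b) / 4"

lemma h_skew: "x \<in> V \<Longrightarrow> g x (h x u) v = - g x (h x v) u"
  and h_xi: "x \<in> V \<Longrightarrow> h x (\<xi> x) = 0"
  and h_phi: "x \<in> V \<Longrightarrow> h x (\<phi> x u) = - \<phi> x (h x u)"
  by (rule nearly_cosymplectic_form.h_skew[OF nearly_form] nearly_cosymplectic_form.h_xi[OF nearly_form]
      nearly_cosymplectic_form.h_phi[OF nearly_form], assumption)+

lemma h_square:
  assumes x: "x \<in> V"
  shows "h x (h x u) = - L x *\<^sub>R (u - \<eta> x u *\<^sub>R \<xi> x)" and "0 \<le> L x"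
proof -
  interpret nearly_cosymplectic_form "g x" "\<phi> x" "\<xi> x" "\<eta> x" "h x" "nabla \<phi> x"
    by (rule nearly_form[OF x])
  obtain L0 where L0: "0 \<le> L0" "\<And>u. h x (h x u) = - L0 *\<^sub>R (u - \<eta> x u *\<^sub>R \<xi> x)"
    using wedge_identities(1)[OF linear_h h_skew h_xi h_phi] by auto
  \<comment> \<open>This is the trace of \<eta> \<otimes> \<xi>. The projection onto ker \<eta> then
    has trace 5 - 1, which explains the division by 4 in \<open>L\<close>.\<close>
  have "(\<Sum>b\<in>Basis. \<eta> x b * (\<xi> x \<bullet> b)) = \<eta> x (\<Sum>b\<in>Basis. (\<xi> x \<bullet> b) *\<^sub>R b)"
    by (simp add: linear_sum[OF linear_eta] linear_scale[OF linear_eta] mult.commute)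
  then have 1: "(\<Sum>b\<in>Basis. \<eta> x b * (\<xi> x \<bullet> b)) = 1"
    by (simp add: euclidean_representation eta_xi)
  have "(\<Sum>b\<in>Basis. h x (h x b) \<bullet> b) = (\<Sum>b\<in>Basis. - L0 * (1 - \<eta> x b * (\<xi> x \<bullet> b)))"
    by (intro sum.cong) (auto simp: L0 inner_diff_left)
  also have "\<dots> = - L0 * (5 - 1)"
    unfolding sum_distrib_left[symmetric] sum_subtractf 1 using dim by simp
  finally have "L x = L0" by (simp add: L_def)
  then show "h x (h x u) = - L x *\<^sub>R (u - \<eta> x u *\<^sub>R \<xi> x)" "0 \<le> L x"
    using L0 by simp_all
qed

lemma smooth_L: "smooth_on V L"
proof -
  have "smooth_on V (\<lambda>x. (- 1 / 4) * (\<Sum>b\<in>Basis. h x (h x b) \<bullet> b))"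
    by (intro smooth_on_mult smooth_on_const smooth_on_sum smooth_on_inner open_V
        endo_onD(2)[OF endo_on_comp[OF open_V h_endo h_endo]])
  moreover have "(\<lambda>x. (- 1 / 4) * (\<Sum>b\<in>Basis. h x (h x b) \<bullet> b)) = L"
    by (auto simp: L_def)
  ultimately show ?thesis by simp
qed

lemma cd1_eta_eq: "x \<in> V \<Longrightarrow> cd1 \<eta> x u v = 2 * g x (h x u) v"
  using h_skew[of x v u] by (simp add: cd1_eta)

text \<open>By \<open>N_eq\<close> each of the three cyclic terms is the same 3-form \<eta> \<and>
  \<alpha>.\<close>

lemma cd2_omega: "x \<in> V \<Longrightarrow> cd2 \<omega> x u v w = 3 * wedge_1_2 \<eta> \<alpha> x u v w"
  unfolding \<omega>_def
  using nearly_cosymplectic_form.N_eq[OF nearly_form, of x u v w]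
    nearly_cosymplectic_form.N_eq[OF nearly_form, of x v w u]
    nearly_cosymplectic_form.N_eq[OF nearly_form, of x w u v]
  by (simp add: cd2_form[OF phi_endo _ phi_skew] wedge_1_2_def \<alpha>_def)

text \<open>The 2-form \<open>g (h u) v\<close> is half of d\<eta>, hence closed;
  \<open>cd2_form\<close> reads this as an identity for \<nabla>h.\<close>

lemma nabla_h_cyc:
  assumes x: "x \<in> V"
  shows "g x (nabla h x u v) w + g x (nabla h x v w) u + g x (nabla h x w u) v = 0"
proof -
  have d: "(\<lambda>y. g y (h y u) v) differentiable (at x)" for u v
    by (rule smooth_on_differentiable[OF form_smooth[OF h_endo] x])
  have "2 * cd2 (\<lambda>y u v. g y (h y u) v) x u v w = cd2 (\<lambda>y u v. 2 * g y (h y u) v) x u v w"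
    by (rule cd2_cmult[OF d, symmetric])
  also have "\<dots> = cd2 (cd1 \<eta>) x u v w"
    by (rule cd2_cong[OF open_V x]) (use d cd1_eta_eq in auto)
  also have "\<dots> = 0"
    by (rule cd2_cd1[OF open_V x smooth_eta])
  finally show ?thesis
    by (simp add: cd2_form[OF h_endo x h_skew])
qed

text \<open>The covariant derivative of \<open>h \<xi> = 0\<close>, where \<nabla>\<xi> is
  \<open>h\<close> again.\<close>

lemma nabla_h_xi_right:
  assumes x: "x \<in> V"
  shows "nabla h x w (\<xi> x) = - h x (h x w)"
proof -
  have "(\<lambda>y. h y (\<xi> y)) differentiable (at x)"
    by (rule smooth_on_differentiable[OF smooth_on_linear_apply[OF open_V endo_onD(1,2)[OF h_endo] smooth_xi] x])
  then have "frechet_derivative (\<lambda>y. h y (\<xi> y)) (at x) = frechet_derivative (\<lambda>y. 0) (at x)"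
    by (rule frechet_derivative_transform_within_open[OF _ open_V x]) (rule h_xi)
  then show ?thesis
    using nabla_apply_vec[OF h_endo smooth_xi x] 
    by (simp add: h_xi[OF x] bilinear_expand[OF christoffel_bilinear[OF x]])
qed

text \<open>In the cyclic identity at \<xi>, u, w the other two terms are
  \<open>g (h (h u)) w\<close> and \<open>- g (h (h w)) u\<close>, which cancel because the square
  of a skew map is symmetric.\<close>

lemma nabla_h_xi_left:
  assumes x: "x \<in> V"
  shows "nabla h x (\<xi> x) u = 0"
proof -
  interpret inner_form "g x" by (rule inner_form[OF x])
  show ?thesis
  proof (rule eqI)
    fix w
    show "g x (nabla h x (\<xi> x) u) w = g x 0 w"
    proof -
      have 1: "g x (nabla h x u w) (\<xi> x) = g x (h x (h x u)) w"
        using nabla_skew[OF h_endo x h_skew, of u w "\<xi> x"] by (simp add: nabla_h_xi_right[OF x] minus_left)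
      have 2: "g x (nabla h x w (\<xi> x)) u = - g x (h x (h x w)) u"
        by (simp only: nabla_h_xi_right[OF x] minus_left)
      have "g x (h x (h x w)) u = - g x (h x u) (h x w)" by (rule h_skew[OF x])
      also have "\<dots> = - g x (h x w) (h x u)" by (simp only: sym)
      also have "\<dots> = g x (h x (h x u)) w" using h_skew[OF x, of "h x u" w] by linarith
      finally show ?thesis
        using nabla_h_cyc[OF x, of "\<xi> x" u w] 1 2 zero_left[of w] by linarith
    qed
  qed
qed

lemma alpha_endo: "endo_on V (\<lambda>x u. \<phi> x (h x u))"
  by (rule endo_on_comp[OF open_V phi_endo h_endo])

lemma alpha_skew:
  assumes x: "x \<in> V"
  shows "g x (\<phi> x (h x u)) v = - g x (\<phi> x (h x v)) u"
proof -
  interpret inner_form "g x" by (rule inner_form[OF x])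
  have "g x (\<phi> x (h x u)) v = - g x (\<phi> x v) (h x u)" by (rule phi_skew[OF x])
  also have "\<dots> = g x (h x (\<phi> x v)) u"
    using h_skew[OF x, of u "\<phi> x v"] sym[of "\<phi> x v" "h x u"] by linarith
  also have "\<dots> = - g x (\<phi> x (h x v)) u"
    by (simp add: h_phi[OF x] minus_left)
  finally show ?thesis .
qed

end

section \<open>The exterior derivative of \<alpha> and the differential of \<open>L\<close>\<close>

context nearly_chart
begin

lemma smooth_omega: "smooth_on V (\<lambda>y. \<omega> y u v)"
  unfolding \<omega>_def by (rule form_smooth[OF phi_endo])

lemma smooth_alpha: "smooth_on V (\<lambda>y. \<alpha> y u v)"
  unfolding \<alpha>_def by (rule form_smooth[OF alpha_endo])

lemma omega_anti: "x \<in> V \<Longrightarrow> \<omega> x u v = - \<omega> x v u"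
  unfolding \<omega>_def by (rule phi_skew)

lemma alpha_anti: "x \<in> V \<Longrightarrow> \<alpha> x u v = - \<alpha> x v u"
  unfolding \<alpha>_def by (rule alpha_skew)

lemma phi_h_square:
  assumes x: "x \<in> V"
  shows "\<phi> x (h x (h x u)) = - L x *\<^sub>R \<phi> x u"
proof -
  interpret contact_form "g x" "\<phi> x" "\<xi> x" "\<eta> x" by (rule contact[OF x])
  show ?thesis
    by (simp add: h_square[OF x] linear_expand[OF linear_phi] phi_xi)
qed

lemma wedge_zero:
  assumes x: "x \<in> V"
  shows "wedge_2_2 (cd1 \<eta> x) (\<alpha> x) u v w z = 0" "wedge_2_2 (cd1 \<eta> x) (\<omega> x) u v w z = 0"
proof -
  interpret nearly_cosymplectic_form "g x" "\<phi> x" "\<xi> x" "\<eta> x" "h x" "nabla \<phi> x"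
    by (rule nearly_form[OF x])
  note w = wedge_identities(2,3)[OF linear_h h_skew h_xi h_phi, of u v w z]
  have "wedge_2_2 (cd1 \<eta> x) \<sigma> u v w z = 2 * wedge_2_2 (\<lambda>u v. g x (h x u) v) \<sigma> u v w z" for \<sigma>
    by (simp add: wedge_2_2_def cd1_eta_eq[OF x] algebra_simps)
  then show "wedge_2_2 (cd1 \<eta> x) (\<alpha> x) u v w z = 0" "wedge_2_2 (cd1 \<eta> x) (\<omega> x) u v w z = 0"
    using w by (simp_all add: \<alpha>_def[abs_def] \<omega>_def[abs_def])
qed

text \<open>Each term of the cyclic sum contributes - L \<omega>(v,w): the first through \<nabla>h =
  0 in direction \<xi> and \<open>N_xi\<close>, the second through \<open>N_eq\<close>, the third
  through \<open>nabla_h_xi_right\<close>.\<close>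

lemma cd2_alpha_xi:
  assumes x: "x \<in> V"
  shows "cd2 \<alpha> x (\<xi> x) v w = - 3 * L x * \<omega> x v w"
proof -
  interpret nearly_cosymplectic_form "g x" "\<phi> x" "\<xi> x" "\<eta> x" "h x" "nabla \<phi> x"
    by (rule nearly_form[OF x])
  have n: "nabla (\<lambda>x u. \<phi> x (h x u)) x a b = nabla \<phi> x a (h x b) + \<phi> x (nabla h x a b)" for a b
    by (rule nabla_comp[OF phi_endo h_endo x])
  have 1: "g x (nabla (\<lambda>x u. \<phi> x (h x u)) x (\<xi> x) v) w = - L x * \<omega> x v w"
    by (simp add: n nabla_h_xi_left[OF x] N_xi phi_h_square[OF x] linear_expand[OF linear_phi] scale_left minus_left \<omega>_def)
  have "g x (nabla (\<lambda>x u. \<phi> x (h x u)) x v w) (\<xi> x) = g x (\<phi> x (h x v)) (h x w)"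
    using N_eq[of v "h x w" "\<xi> x"] phi_h_square[OF x, of v]
    by (simp add: n add_left xi_right eta_phi eta_xi eta_h h_square[OF x] phi_xi zero_left
        linear_expand[OF linear_eta] linear_expand[OF linear_phi] linear_expand[OF linear_h] h_xi)
  also have "\<dots> = - L x * \<omega> x v w"
    using sym[of "\<phi> x (h x v)" "h x w"] h_skew[of w "\<phi> x (h x v)"]
    by (simp add: h_phi phi_h_square[OF x] minus_left scale_left \<omega>_def)
  finally have 2: "g x (nabla (\<lambda>x u. \<phi> x (h x u)) x v w) (\<xi> x) = - L x * \<omega> x v w" .
  have 3: "g x (nabla (\<lambda>x u. \<phi> x (h x u)) x w (\<xi> x)) v = - L x * \<omega> x v w"
    using omega_anti[OF x, of w v]
    by (simp add: n h_xi nabla_h_xi_right[OF x] bilinear_expand[OF bilinear_N] linear_neg[OF linear_phi]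
       phi_h_square[OF x] scale_left minus_left \<omega>_def)
  have "cd2 \<alpha> x (\<xi> x) v w = g x (nabla (\<lambda>x u. \<phi> x (h x u)) x (\<xi> x) v) w +
      g x (nabla (\<lambda>x u. \<phi> x (h x u)) x v w) (\<xi> x) + g x (nabla (\<lambda>x u. \<phi> x (h x u)) x w (\<xi> x)) v"
    unfolding \<alpha>_def by (rule cd2_form[OF alpha_endo x alpha_skew])
  then show ?thesis
    using 1 2 3 by simp
qed

text \<open>The vanishing of d(\<eta> \<and> \<alpha>) and of d\<eta> \<and> \<alpha> leaves \<eta>
  \<and> d\<alpha> = 0. Contracting with \<xi> shows that d\<alpha> is \<eta> wedged with its own
  contraction, so its values on \<xi> suffice.\<close>

lemma cd2_alpha:
  assumes x: "x \<in> V"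
  shows "cd2 \<alpha> x u v w = - 3 * L x * wedge_1_2 \<eta> \<omega> x u v w"
proof -
  interpret contact_form "g x" "\<phi> x" "\<xi> x" "\<eta> x" by (rule contact[OF x])
  have dw: "(\<lambda>y. wedge_1_2 \<eta> \<alpha> y u v w) differentiable (at x)" for u v w
    unfolding wedge_1_2_def
    by (intro differentiable_add differentiable_mult smooth_on_differentiable[OF smooth_eta x]
        smooth_on_differentiable[OF smooth_alpha x])
  have "3 * cd3 (wedge_1_2 \<eta> \<alpha>) x (\<xi> x) u v w = cd3 (\<lambda>y u v w. 3 * wedge_1_2 \<eta> \<alpha> y u v w) x (\<xi> x) u v w"
    by (rule cd3_cmult[OF dw, symmetric])
  also have "\<dots> = cd3 (cd2 \<omega>) x (\<xi> x) u v w"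
    by (rule cd3_cong[OF open_V x]) (use dw cd2_omega in auto)
  also have "\<dots> = 0"
    by (rule cd3_cd2[OF open_V x smooth_omega])
  finally have "wedge_2_2 (cd1 \<eta> x) (\<alpha> x) (\<xi> x) u v w - wedge_1_3 (\<eta> x) (cd2 \<alpha> x) (\<xi> x) u v w = 0"
    using cd3_wedge_1_2[OF open_V x smooth_on_differentiable[OF smooth_eta x] smooth_on_differentiable[OF smooth_alpha x] alpha_anti]
    by simp
  then have "wedge_1_3 (\<eta> x) (cd2 \<alpha> x) (\<xi> x) u v w = 0"
    by (simp add: wedge_zero[OF x])
  then show ?thesis
    using omega_anti[OF x, of w u]
    by (simp add: wedge_1_3_def wedge_1_2_def cd2_alpha_xi[OF x] eta_xi algebra_simps)
qed

text \<open>The Leibniz rule is applied with the 1-form L\<eta>. Of the resulting terms, L d\<eta>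
  \<and> \<omega> vanishes by \<open>wedge_zero\<close>, and \<eta> \<and> d\<omega> vanishes
  because d\<omega> contains \<eta>.\<close>

lemma L_derivative_wedge:
  assumes x: "x \<in> V"
  shows "wedge_2_2 (\<lambda>u v. frechet_derivative L (at x) u * \<eta> x v - frechet_derivative L (at x) v * \<eta> x u) (\<omega> x) u v w z = 0"
proof -
  have dL: "L differentiable (at x)" by (rule smooth_on_differentiable[OF smooth_L x])
  have de: "(\<lambda>y. \<eta> y u) differentiable (at x)" for u by (rule smooth_on_differentiable[OF smooth_eta x])
  have do: "(\<lambda>y. \<omega> y u v) differentiable (at x)" for u v by (rule smooth_on_differentiable[OF smooth_omega x])
  have dLe: "(\<lambda>y. L y * \<eta> y u) differentiable (at x)" for u using dL de by simp
  have dw: "(\<lambda>y. wedge_1_2 (\<lambda>y u. L y * \<eta> y u) \<omega> y u v w) differentiable (at x)" for u v w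
    unfolding wedge_1_2_def by (intro differentiable_add differentiable_mult dL de do)
  have "- 3 * cd3 (wedge_1_2 (\<lambda>y u. L y * \<eta> y u) \<omega>) x u v w z =
      cd3 (\<lambda>y u v w. - 3 * wedge_1_2 (\<lambda>y u. L y * \<eta> y u) \<omega> y u v w) x u v w z"
    by (rule cd3_cmult[OF dw, symmetric])
  also have "\<dots> = cd3 (cd2 \<alpha>) x u v w z"
  proof (rule cd3_cong[OF open_V x])
    show "(\<lambda>y. - 3 * wedge_1_2 (\<lambda>y u. L y * \<eta> y u) \<omega> y u v w) differentiable (at x)" for u v w
      by (rule differentiable_mult[OF differentiable_const dw])
    show "- 3 * wedge_1_2 (\<lambda>y u. L y * \<eta> y u) \<omega> y u v w = cd2 \<alpha> y u v w" if "y \<in> V" for y u v w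
      by (simp add: cd2_alpha[OF that] wedge_1_2_def algebra_simps)
  qed
  also have "\<dots> = 0"
    by (rule cd3_cd2[OF open_V x smooth_alpha])
  finally have "wedge_2_2 (cd1 (\<lambda>y u. L y * \<eta> y u) x) (\<omega> x) u v w z
      = wedge_1_3 (\<lambda>u. L x * \<eta> x u) (cd2 \<omega> x) u v w z"
    using cd3_wedge_1_2[OF open_V x dLe do omega_anti] by simp
  moreover have "wedge_1_3 (\<lambda>u. L x * \<eta> x u) (cd2 \<omega> x) u v w z = 0"
    using alpha_anti[OF x, of w v] alpha_anti[OF x, of w u] alpha_anti[OF x, of v u]
      alpha_anti[OF x, of z u] alpha_anti[OF x, of z v] alpha_anti[OF x, of z w]
    by (simp add: wedge_1_3_def cd2_omega[OF x] wedge_1_2_def algebra_simps)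
  moreover have c: "cd1 (\<lambda>y u. L y * \<eta> y u) x a b = (frechet_derivative L (at x) a * \<eta> x b
     - frechet_derivative L (at x) b * \<eta> x a) + L x * cd1 \<eta> x a b" for a b
    by (simp add: cd1_def frechet_derivative_mult dL de algebra_simps)
  have "wedge_2_2 (cd1 (\<lambda>y u. L y * \<eta> y u) x) (\<omega> x) u v w z =
     wedge_2_2 (\<lambda>u v. frechet_derivative L (at x) u * \<eta> x v - frechet_derivative L (at x) v * \<eta> x u) (\<omega> x) u v w z
     + L x * wedge_2_2 (cd1 \<eta> x) (\<omega> x) u v w z"
    unfolding wedge_2_2_def c by (simp add: algebra_simps)
  ultimately show ?thesis
    by (simp add: wedge_zero[OF x])
qed

text \<open>The component of dL along \<eta> is invisible in dL \<and> \<eta>, so this direction is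
  treated separately: the square of \<open>h\<close> is parallel along \<xi>.\<close>

lemma L_derivative_xi:
  assumes x: "x \<in> V"
  shows "frechet_derivative L (at x) (\<xi> x) = 0"
proof -
  interpret nearly_cosymplectic_form "g x" "\<phi> x" "\<xi> x" "\<eta> x" "h x" "nabla \<phi> x"
    by (rule nearly_form[OF x])
  obtain e f where "\<eta> x e = 0" and fr: "orthonormal_frame (\<xi> x) e (\<phi> x e) f (\<phi> x f)"
    using exists_frame by blast
  then have e: "\<eta> x e = 0" "g x e e = 1" by (simp_all add: orthonormal_frame_def)
  note hh = endo_on_comp[OF open_V h_endo h_endo]
  have dL: "L differentiable (at x)" by (rule smooth_on_differentiable[OF smooth_L x])
  have de: "(\<lambda>y. \<eta> y u) differentiable (at x)" for u by (rule smooth_on_differentiable[OF smooth_eta x])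
  have dg: "(\<lambda>y. g y u v) differentiable (at x)" for u v by (rule smooth_on_differentiable[OF smooth_g x])
  let ?w = "\<xi> x"
  have "nabla (\<lambda>y u. h y (h y u)) x ?w e = 0"
    by (simp add: nabla_comp[OF h_endo h_endo x] nabla_h_xi_left[OF x] linear_expand[OF linear_h])
  then have 1: "frechet_derivative (\<lambda>y. g y (h y (h y e)) e) (at x) ?w =
      g x (h x (h x (christoffel x ?w e))) e + g x (h x (h x e)) (christoffel x ?w e)"
    by (simp add: form_derivative[OF hh x] zero_left)
  \<comment> \<open>\<open>e\<close> is extended as a constant vector, so it is unit and horizontal
    at \<open>x\<close> only; \<open>g y e e\<close> and \<open>\<eta> y e\<close> have to be kept
    under the derivative.\<close>
  have "frechet_derivative (\<lambda>y. g y (h y (h y e)) e) (at x) =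
     frechet_derivative (\<lambda>y. - L y * (g y e e - \<eta> y e * \<eta> y e)) (at x)"
  proof (rule frechet_derivative_transform_within_open[OF smooth_on_differentiable[OF form_smooth[OF hh] x] open_V x])
    fix y assume y: "y \<in> V"
    interpret y: contact_form "g y" "\<phi> y" "\<xi> y" "\<eta> y" by (rule contact[OF y])
    show "g y (h y (h y e)) e = - L y * (g y e e - \<eta> y e * \<eta> y e)"
      by (simp add: h_square[OF y] y.expand y.xi_left algebra_simps)
  qed
  then have 2: "frechet_derivative (\<lambda>y. g y (h y (h y e)) e) (at x) ?w =
     - frechet_derivative L (at x) ?w - L x * (2 * g x (christoffel x ?w e) e)"
    using sym[of e "christoffel x ?w e"]
    by (simp add: frechet_derivative_mult frechet_derivative_diff frechet_derivative_uminus dL de dg e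
        metric_derivative[OF x])
  show ?thesis
    using 1 2 sym[of e "christoffel x ?w e"] e
    by (simp add: h_square[OF x] expand xi_left)
qed

lemma L_derivative:
  assumes x: "x \<in> V"
  shows "frechet_derivative L (at x) u = 0"
proof -
  interpret nearly_cosymplectic_form "g x" "\<phi> x" "\<xi> x" "\<eta> x" "h x" "nabla \<phi> x"
    by (rule nearly_form[OF x])
  obtain e f where ef: "\<eta> x e = 0" "\<eta> x f = 0" and fr: "orthonormal_frame (\<xi> x) e (\<phi> x e) f (\<phi> x f)"
    using exists_frame by blast
  note on = fr[unfolded orthonormal_frame_def]
  note on' = on sym[of e "\<xi> x"] sym[of "\<phi> x e" "\<xi> x"] sym[of f "\<xi> x"] sym[of "\<phi> x f" "\<xi> x"] sym[of "\<phi> x e" e]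
    sym[of f e] sym[of "\<phi> x f" e] sym[of f "\<phi> x e"] sym[of "\<phi> x f" "\<phi> x e"] sym[of "\<phi> x f" f]
  note s = \<omega>_def eta_xi eta_phi ef phi_xi phi_phi minus_left zero_left on'
  show ?thesis
  proof (rule frame_linear_zero[OF dim fr])
    show "linear (frechet_derivative L (at x))"
      by (rule linear_frechet_derivative[OF smooth_on_differentiable[OF smooth_L x]])
    show "frechet_derivative L (at x) (\<xi> x) = 0" by (rule L_derivative_xi[OF x])
    \<comment> \<open>Against \<xi>, f, \<phi> f only the pairing of the first vector with \<xi>
      survives, multiplied by \<omega>(f, \<phi> f) = 1. Exchanging the two \<phi>-planes covers
      \<open>f\<close> and \<open>\<phi> f\<close>.\<close>
    show "frechet_derivative L (at x) e = 0" "frechet_derivative L (at x) (\<phi> x e) = 0"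
      using L_derivative_wedge[OF x, of e "\<xi> x" f "\<phi> x f"] L_derivative_wedge[OF x, of "\<phi> x e" "\<xi> x" f "\<phi> x f"]
      by (simp_all add: wedge_2_2_def s)
    show "frechet_derivative L (at x) f = 0" "frechet_derivative L (at x) (\<phi> x f) = 0"
      using L_derivative_wedge[OF x, of f "\<xi> x" e "\<phi> x e"] L_derivative_wedge[OF x, of "\<phi> x f" "\<xi> x" e "\<phi> x e"]
      by (simp_all add: wedge_2_2_def s)
  qed
qed

end

section \<open>SU(2)-structures\<close>

context nearly_cosymplectic_form
begin

text \<open>Divided by \<open>l\<close>, \<open>h\<close> becomes a complex structure on ker \<eta>
  anticommuting with \<phi>, and the product of the two is the third. The minus sign gives
  \<open>2 * g (h u) v\<close> the form \<open>- 2 * l\<close> times the third fundamental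
  form.\<close>

lemma su2_form_of_h:
  assumes sq: "\<And>u. h (h u) = - (l\<^sup>2) *\<^sub>R (u - \<eta> u *\<^sub>R \<xi>)" and "l \<noteq> 0"
  shows "su2_form g (\<lambda>u. (- 1 / l) *\<^sub>R \<phi> (h u)) \<phi> (\<lambda>u. (- 1 / l) *\<^sub>R h u) \<xi> \<eta>"
proof -
  define k where "k = - 1 / l"
  have k: "k * (k * l\<^sup>2) = 1" using \<open>l \<noteq> 0\<close> by (simp add: k_def power2_eq_square)
  note lin = linear_expand[OF linear_phi] linear_expand[OF linear_h]
  have k': "k *\<^sub>R (k *\<^sub>R (l\<^sup>2 *\<^sub>R v)) = v" for v :: 'a
    by (simp only: scaleR_scaleR k scaleR_one)
  have k'': "k * (k * (l\<^sup>2 * r)) = r" for r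
    using k by (metis mult.assoc mult_1)
  have pp: "\<phi> (\<phi> (h u)) = - h u" for u
    by (simp add: phi_phi eta_h)
  have hhp: "k *\<^sub>R k *\<^sub>R h (h v) = \<eta> v *\<^sub>R \<xi> - v" for v
    using k'[of "\<eta> v *\<^sub>R \<xi> - v"] by (simp add: sq algebra_simps)
  have pq: "\<phi> (h (\<phi> (h u))) = h (h u)" for u
    by (simp add: h_phi lin pp)
  have hh: "g (h u) (h v) = l\<^sup>2 * (g u v - \<eta> u * \<eta> v)" for u v
    using h_skew[of "h u" v] sym[of "h u" "h v"] h_skew[of v "h u"]
    by (simp add: sq expand xi_left algebra_simps)
  have C3: "contact_form g (\<lambda>u. k *\<^sub>R h u) \<xi> \<eta>"
  proof (intro contact_form.intro inner_form_axioms contact_form_axioms.intro)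
    show "linear (\<lambda>u. k *\<^sub>R h u)" by (rule linear_compose_scale_right[OF linear_h])
    show "k *\<^sub>R h (k *\<^sub>R h u) = - u + \<eta> u *\<^sub>R \<xi>" for u
      using hhp[of u] by (simp add: lin)
    show "g (k *\<^sub>R h u) (k *\<^sub>R h v) = g u v - \<eta> u * \<eta> v" for u v
      by (simp add: scale_left scale_right hh k'')
  qed (simp_all add: dim linear_eta eta_xi)
  have C1: "contact_form g (\<lambda>u. k *\<^sub>R \<phi> (h u)) \<xi> \<eta>"
  proof (intro contact_form.intro inner_form_axioms contact_form_axioms.intro)
    show "linear (\<lambda>u. k *\<^sub>R \<phi> (h u))"
      using linear_compose_scale_right[OF linear_compose[OF linear_h linear_phi], of k] by (simp add: o_def)
    show "k *\<^sub>R \<phi> (h (k *\<^sub>R \<phi> (h u))) = - u + \<eta> u *\<^sub>R \<xi>" for u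
      using hhp[of u] by (simp add: linear_scale[OF linear_phi] linear_scale[OF linear_h] pq)
    show "g (k *\<^sub>R \<phi> (h u)) (k *\<^sub>R \<phi> (h v)) = g u v - \<eta> u * \<eta> v" for u v
      by (simp add: scale_left scale_right compatible eta_h hh k'')
  qed (simp_all add: dim linear_eta eta_xi)
  have "su2_form g (\<lambda>u. k *\<^sub>R \<phi> (h u)) \<phi> (\<lambda>u. k *\<^sub>R h u) \<xi> \<eta>"
  proof (intro su2_form.intro su2_form_axioms.intro C1 C3 contact_form_axioms)
    fix u
    show "k *\<^sub>R \<phi> (h (\<phi> u)) = k *\<^sub>R h u" "\<phi> (k *\<^sub>R \<phi> (h u)) = - (k *\<^sub>R h u)"
      "\<phi> (k *\<^sub>R h u) = k *\<^sub>R \<phi> (h u)" "k *\<^sub>R h (\<phi> u) = - (k *\<^sub>R \<phi> (h u))"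
      by (simp_all add: lin h_phi pp)
    show "k *\<^sub>R h (k *\<^sub>R \<phi> (h u)) = \<phi> u" 
      using arg_cong[OF hhp[of u], of \<phi>] by (simp add: lin h_phi phi_xi) 
    show "k *\<^sub>R \<phi> (h (k *\<^sub>R h u)) = - \<phi> u"
      using arg_cong[OF hhp[of u], of \<phi>] by (simp add: lin phi_xi)
  qed
  then show ?thesis by (simp add: k_def)
qed

end

context su2_form
begin

text \<open>An instance of \<open>wedge_identities\<close> with \<open>\<phi>\<^sub>3\<close> as
  \<open>h\<close> and \<open>\<phi>\<^sub>2\<close> as \<phi>, so that \<open>\<phi> h\<close> is
  \<open>\<phi>\<^sub>1\<close>.\<close>

lemma wedge_zero:
  "wedge_2_2 (\<lambda>u v. g (\<phi>\<^sub>3 u) v) (\<lambda>u v. g (\<phi>\<^sub>1 u) v) u v w z = 0"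
  "wedge_2_2 (\<lambda>u v. g (\<phi>\<^sub>3 u) v) (\<lambda>u v. g (\<phi>\<^sub>2 u) v) u v w z = 0"
proof -
  have sk: "g (\<phi>\<^sub>3 u) v = - g (\<phi>\<^sub>3 v) u" for u v
    using C3.skew[of u v] C1.sym[of u "\<phi>\<^sub>3 v"] by linarith
  have "\<phi>\<^sub>3 (\<phi>\<^sub>2 u) = - \<phi>\<^sub>2 (\<phi>\<^sub>3 u)" for u by (simp add: quat)
  note w = C2.wedge_identities(2,3)[OF C3.linear_phi sk C3.phi_xi this]
  show "wedge_2_2 (\<lambda>u v. g (\<phi>\<^sub>3 u) v) (\<lambda>u v. g (\<phi>\<^sub>1 u) v) u v w z = 0"
    "wedge_2_2 (\<lambda>u v. g (\<phi>\<^sub>3 u) v) (\<lambda>u v. g (\<phi>\<^sub>2 u) v) u v w z = 0"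
    using w(1)[of u v w z] w(2)[of u v w z] by (simp_all add: quat)
qed

end

text \<open>Only the metric is fixed: the hypo equations concern exterior derivatives alone. A
  connection comes in as an argument of \<open>nabla_phi2\<close>.\<close>

locale su2_structure_chart = riemannian_chart V g
  for V :: "'v::euclidean_space set" and g +
  fixes \<phi>\<^sub>1 \<phi>\<^sub>2 \<phi>\<^sub>3 :: "'v \<Rightarrow> 'v \<Rightarrow> 'v" and \<xi> :: "'v \<Rightarrow> 'v" and \<eta> :: "'v \<Rightarrow> 'v \<Rightarrow> real" and l :: real
  assumes endo: "endo_on V \<phi>\<^sub>1" "endo_on V \<phi>\<^sub>2" "endo_on V \<phi>\<^sub>3" and smooth_xi: "smooth_on V \<xi>"
    and smooth_eta: "smooth_on V (\<lambda>x. \<eta> x u)"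
    and su2: "x \<in> V \<Longrightarrow> su2_form (g x) (\<phi>\<^sub>1 x) (\<phi>\<^sub>2 x) (\<phi>\<^sub>3 x) (\<xi> x) (\<eta> x)"
    and l_nonzero: "l \<noteq> 0"
    and d_eta: "x \<in> V \<Longrightarrow> cd1 \<eta> x u v = - 2 * l * g x (\<phi>\<^sub>3 x u) v"
    and d_omega1: "x \<in> V \<Longrightarrow> cd2 (\<lambda>x u v. g x (\<phi>\<^sub>1 x u) v) x u v w =
      3 * l * wedge_1_2 \<eta> (\<lambda>x u v. g x (\<phi>\<^sub>2 x u) v) x u v w"
    and d_omega2: "x \<in> V \<Longrightarrow> cd2 (\<lambda>x u v. g x (\<phi>\<^sub>2 x u) v) x u v w =
      - 3 * l * wedge_1_2 \<eta> (\<lambda>x u v. g x (\<phi>\<^sub>1 x u) v) x u v w"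
begin

lemma contact: "x \<in> V \<Longrightarrow> contact_form (g x) (\<phi>\<^sub>1 x) (\<xi> x) (\<eta> x)"
  "x \<in> V \<Longrightarrow> contact_form (g x) (\<phi>\<^sub>2 x) (\<xi> x) (\<eta> x)"
  "x \<in> V \<Longrightarrow> contact_form (g x) (\<phi>\<^sub>3 x) (\<xi> x) (\<eta> x)"
  using su2 by (auto simp: su2_form_def)

lemma skew:
  assumes x: "x \<in> V"
  shows "g x (\<phi>\<^sub>1 x u) v = - g x (\<phi>\<^sub>1 x v) u" "g x (\<phi>\<^sub>2 x u) v = - g x (\<phi>\<^sub>2 x v) u"
    "g x (\<phi>\<^sub>3 x u) v = - g x (\<phi>\<^sub>3 x v) u"
proof -
  interpret su2_form "g x" "\<phi>\<^sub>1 x" "\<phi>\<^sub>2 x" "\<phi>\<^sub>3 x" "\<xi> x" "\<eta> x" by (rule su2[OF x])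
  show "g x (\<phi>\<^sub>1 x u) v = - g x (\<phi>\<^sub>1 x v) u" "g x (\<phi>\<^sub>2 x u) v = - g x (\<phi>\<^sub>2 x v) u"
    "g x (\<phi>\<^sub>3 x u) v = - g x (\<phi>\<^sub>3 x v) u"
    using C1.skew[of u v] C2.skew[of u v] C3.skew[of u v] C1.sym[of u "\<phi>\<^sub>1 x v"] C1.sym[of u "\<phi>\<^sub>2 x v"]
      C1.sym[of u "\<phi>\<^sub>3 x v"] by linarith+
qed

text \<open>The third form is a nonzero multiple of d\<eta>, and d d\<eta> = 0.\<close>

lemma d_omega3:
  assumes x: "x \<in> V"
  shows "cd2 (\<lambda>x u v. g x (\<phi>\<^sub>3 x u) v) x u v w = 0"
proof -
  have d: "(\<lambda>y. g y (\<phi>\<^sub>3 y u) v) differentiable (at x)" for u v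
    by (rule smooth_on_differentiable[OF form_smooth[OF endo(3)] x])
  have "- 2 * l * cd2 (\<lambda>x u v. g x (\<phi>\<^sub>3 x u) v) x u v w = cd2 (\<lambda>x u v. - 2 * l * g x (\<phi>\<^sub>3 x u) v) x u v w"
    by (rule cd2_cmult[OF d, symmetric])
  also have "\<dots> = cd2 (cd1 \<eta>) x u v w"
    by (rule cd2_cong[OF open_V x]) (use d d_eta in auto)
  also have "\<dots> = 0" by (rule cd2_cd1[OF open_V x smooth_eta])
  finally show ?thesis using l_nonzero by simp
qed

text \<open>d\<eta> \<and> \<omega> vanishes by the orthogonality of the fundamental forms, and
  \<eta> \<and> d\<omega> because d\<omega> already has the factor \<eta>.\<close>

lemma d_eta_omega:
  assumes x: "x \<in> V"
  shows "cd3 (wedge_1_2 \<eta> (\<lambda>x u v. g x (\<phi>\<^sub>1 x u) v)) x u v w z = 0"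
    "cd3 (wedge_1_2 \<eta> (\<lambda>x u v. g x (\<phi>\<^sub>2 x u) v)) x u v w z = 0"
proof -
  interpret su2_form "g x" "\<phi>\<^sub>1 x" "\<phi>\<^sub>2 x" "\<phi>\<^sub>3 x" "\<xi> x" "\<eta> x" by (rule su2[OF x])
  have scale: "wedge_2_2 (cd1 \<eta> x) \<sigma> u v w z = - 2 * l * wedge_2_2 (\<lambda>u v. g x (\<phi>\<^sub>3 x u) v) \<sigma> u v w z" for \<sigma>
    by (simp add: wedge_2_2_def d_eta[OF x] algebra_simps)
  have zero: "wedge_1_3 (\<eta> x) (\<lambda>u v w. k * wedge_1_2 \<eta> \<sigma> x u v w) u v w z = 0"
    if "\<And>u v. \<sigma> x u v = - \<sigma> x v u" for \<sigma> k
    using that[of w v] that[of w u] that[of v u] that[of z u] that[of z v] that[of z w]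
    by (simp add: wedge_1_3_def wedge_1_2_def algebra_simps)
  note de = smooth_on_differentiable[OF smooth_eta x] and
    do = smooth_on_differentiable[OF form_smooth[OF endo(1)] x] smooth_on_differentiable[OF form_smooth[OF endo(2)] x]
  have c: "cd2 (\<lambda>x u v. g x (\<phi>\<^sub>1 x u) v) x = (\<lambda>u v w. 3 * l * wedge_1_2 \<eta> (\<lambda>x u v. g x (\<phi>\<^sub>2 x u) v) x u v w)"
    "cd2 (\<lambda>x u v. g x (\<phi>\<^sub>2 x u) v) x = (\<lambda>u v w. - 3 * l * wedge_1_2 \<eta> (\<lambda>x u v. g x (\<phi>\<^sub>1 x u) v) x u v w)"
    using d_omega1[OF x] d_omega2[OF x] by (auto simp: fun_eq_iff)
  have "cd3 (wedge_1_2 \<eta> (\<lambda>x u v. g x (\<phi>\<^sub>1 x u) v)) x u v w z =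
      wedge_2_2 (cd1 \<eta> x) (\<lambda>u v. g x (\<phi>\<^sub>1 x u) v) u v w z
      - wedge_1_3 (\<eta> x) (cd2 (\<lambda>x u v. g x (\<phi>\<^sub>1 x u) v) x) u v w z"
    by (rule cd3_wedge_1_2[OF open_V x de do(1) skew(1)])
  then show "cd3 (wedge_1_2 \<eta> (\<lambda>x u v. g x (\<phi>\<^sub>1 x u) v)) x u v w z = 0"
    unfolding c scale wedge_zero using zero[where \<sigma>="\<lambda>x u v. g x (\<phi>\<^sub>2 x u) v", OF skew(2)[OF x]] by simp
  have "cd3 (wedge_1_2 \<eta> (\<lambda>x u v. g x (\<phi>\<^sub>2 x u) v)) x u v w z =
      wedge_2_2 (cd1 \<eta> x) (\<lambda>u v. g x (\<phi>\<^sub>2 x u) v) u v w z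
      - wedge_1_3 (\<eta> x) (cd2 (\<lambda>x u v. g x (\<phi>\<^sub>2 x u) v) x) u v w z"
    by (rule cd3_wedge_1_2[OF open_V x de do(2) skew(2)])
  then show "cd3 (wedge_1_2 \<eta> (\<lambda>x u v. g x (\<phi>\<^sub>2 x u) v)) x u v w z = 0"
    unfolding c scale wedge_zero using zero[where \<sigma>="\<lambda>x u v. g x (\<phi>\<^sub>1 x u) v" and k="- 3 * l", OF skew(1)[OF x]] by simp
qed

text \<open>At each point the three structures share \<open>nabla_vec \<xi> x\<close> as their
  \<open>h\<close>, which is what couples the equations into the linear system of
  \<open>su2_derivative\<close>.\<close>

lemma nabla_phi2:
  assumes D: "levi_civita_on V g D" and x: "x \<in> V"
  shows "metric_chart.nabla D \<phi>\<^sub>2 x u v =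
    - l *\<^sub>R (\<eta> x u *\<^sub>R \<phi>\<^sub>1 x v - \<eta> x v *\<^sub>R \<phi>\<^sub>1 x u + g x (\<phi>\<^sub>1 x u) v *\<^sub>R \<xi> x)"
proof -
  interpret M: metric_chart V g D
    by (rule metric_chart.intro[OF riemannian_chart_axioms metric_chart_axioms.intro[OF D]])
  interpret M1: contact_chart V g D \<phi>\<^sub>1 \<xi> \<eta>
    by (intro contact_chart.intro M.metric_chart_axioms contact_chart_axioms.intro endo smooth_xi contact)
  interpret M2: contact_chart V g D \<phi>\<^sub>2 \<xi> \<eta>
    by (intro contact_chart.intro M.metric_chart_axioms contact_chart_axioms.intro endo smooth_xi contact)
  interpret M3: contact_chart V g D \<phi>\<^sub>3 \<xi> \<eta>
    by (intro contact_chart.intro M.metric_chart_axioms contact_chart_axioms.intro endo smooth_xi contact)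
  interpret S: su2_form "g x" "\<phi>\<^sub>1 x" "\<phi>\<^sub>2 x" "\<phi>\<^sub>3 x" "\<xi> x" "\<eta> x" by (rule su2[OF x])
  interpret su2_derivative "g x" "\<phi>\<^sub>1 x" "\<phi>\<^sub>2 x" "\<phi>\<^sub>3 x" "\<xi> x" "\<eta> x" "M.nabla_vec \<xi> x"
    "M.nabla \<phi>\<^sub>1 x" "M.nabla \<phi>\<^sub>2 x" "M.nabla \<phi>\<^sub>3 x" l
  proof (intro su2_derivative.intro su2_derivative_axioms.intro S.su2_form_axioms
      M1.contact_derivative M2.contact_derivative M3.contact_derivative x)
    fix u v w
    have q: "\<phi>\<^sub>1 y (\<phi>\<^sub>2 y u) = \<phi>\<^sub>3 y u" if "y \<in> V" for y u
      using su2_form.quat(1)[OF su2[OF that]] .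
    show "M.nabla \<phi>\<^sub>1 x w (\<phi>\<^sub>2 x u) + \<phi>\<^sub>1 x (M.nabla \<phi>\<^sub>2 x w u) = M.nabla \<phi>\<^sub>3 x w u"
      using M.nabla_comp[OF endo(1,2) x, of w u] M.nabla_cong[OF endo_on_comp[OF open_V endo(1,2)] q x, of w u]
      by simp
    show "g x (M.nabla_vec \<xi> x u) v - g x (M.nabla_vec \<xi> x v) u = - 2 * l * g x (\<phi>\<^sub>3 x u) v"
      using M1.cd1_eta[OF x, of u v] d_eta[OF x] by simp
    show "g x (M.nabla \<phi>\<^sub>1 x u v) w + g x (M.nabla \<phi>\<^sub>1 x v w) u + g x (M.nabla \<phi>\<^sub>1 x w u) v =
      3 * l * (\<eta> x u * g x (\<phi>\<^sub>2 x v) w + \<eta> x v * g x (\<phi>\<^sub>2 x w) u + \<eta> x w * g x (\<phi>\<^sub>2 x u) v)"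
      using M.cd2_form[OF endo(1) x skew(1), of u v w] d_omega1[OF x, of u v w] by (simp add: wedge_1_2_def)
    show "g x (M.nabla \<phi>\<^sub>2 x u v) w + g x (M.nabla \<phi>\<^sub>2 x v w) u + g x (M.nabla \<phi>\<^sub>2 x w u) v =
      - 3 * l * (\<eta> x u * g x (\<phi>\<^sub>1 x v) w + \<eta> x v * g x (\<phi>\<^sub>1 x w) u + \<eta> x w * g x (\<phi>\<^sub>1 x u) v)"
      using M.cd2_form[OF endo(2) x skew(2), of u v w] d_omega2[OF x, of u v w] by (simp add: wedge_1_2_def)
    show "g x (M.nabla \<phi>\<^sub>3 x u v) w + g x (M.nabla \<phi>\<^sub>3 x v w) u + g x (M.nabla \<phi>\<^sub>3 x w u) v = 0"
      using M.cd2_form[OF endo(3) x skew(3), of u v w] d_omega3[OF x, of u v w] by simp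
  qed
  show ?thesis by (rule h_N2_eq(2))
qed

end

section \<open>Charts and tensor fields on the manifold\<close>

lemma chart_image_open: "smooth_atlas A \<Longrightarrow> c \<in> A \<Longrightarrow> open (chart_image c)"
  by (simp add: smooth_atlas_def is_chart_def)

lemma chart_inj:
  assumes "is_chart c"
  shows "inj_on (snd c) (fst c)"
proof -
  obtain k where k: "homeomorphism (fst c) (chart_image c) (snd c) k"
    using assms by (auto simp: is_chart_def)
  show ?thesis
    by (rule inj_on_inverseI[of _ k]) (use k in \<open>simp add: homeomorphism_def\<close>)
qed

lemma transition_chart:
  assumes "is_chart c" "p \<in> fst c"
  shows "transition c d (snd c p) = snd d p"
  using inv_into_f_f[OF chart_inj[OF assms(1)] assms(2)] by (simp add: transition_def)

lemma overlap_cases: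
  assumes "is_chart c" "x \<in> overlap c d"
  obtains p where "p \<in> fst c" "p \<in> fst d" "x = snd c p" "transition c d x = snd d p"
proof -
  obtain p where p: "p \<in> fst c" "p \<in> fst d" "x = snd c p"
    using assms(2) by (auto simp: overlap_def)
  then show ?thesis
    using that transition_chart[OF assms(1) p(1)] by simp
qed

lemma overlap_open:
  assumes c: "is_chart c" and d: "is_chart d"
  shows "open (overlap c d)"
proof -
  obtain k where k: "homeomorphism (fst c) (chart_image c) (snd c) k"
    using c by (auto simp: is_chart_def)
  have "openin (top_of_set (fst c)) (fst c \<inter> fst d)"
    using d by (auto simp: is_chart_def openin_open)
  from homeomorphism_imp_open_map[OF k this] show ?thesis
    using c unfolding overlap_def is_chart_def by (metis openin_open_trans)
qed

lemma overlap_subset: "overlap c d \<subseteq> chart_image c"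
  by (auto simp: overlap_def chart_image_def)

text \<open>The chain rule for the mutually inverse transition maps gives a left inverse; equal
  dimensions give surjectivity.\<close>

lemma jacobian_bij:
  assumes A: "smooth_atlas A" and c: "c \<in> A" and d: "d \<in> A" and x: "x \<in> overlap c d"
  shows "linear (jacobian c d x)" "inj (jacobian c d x)" "surj (jacobian c d x)"
proof -
  have ic: "is_chart c" and id: "is_chart d" using A c d by (auto simp: smooth_atlas_def)
  have smc: "smooth_on (overlap c d) (transition c d)" and smd: "smooth_on (overlap d c) (transition d c)"
    using A c d by (auto simp: smooth_atlas_def)
  have in_dc: "transition c d y \<in> overlap d c \<and> transition d c (transition c d y) = y" if y: "y \<in> overlap c d" for y
    using ic y
  proof (rule overlap_cases)
    fix p assume "p \<in> fst c" "p \<in> fst d" "y = snd c p" "transition c d y = snd d p"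
    then show ?thesis
      using transition_chart[OF id, of p c] by (auto simp: overlap_def)
  qed
  have d1: "(transition c d has_derivative jacobian c d x) (at x)"
    using smooth_on_differentiable[OF smc x] by (simp add: jacobian_def frechet_derivative_works)
  have d2: "(transition d c has_derivative jacobian d c (transition c d x)) (at (transition c d x))"
    using smooth_on_differentiable[OF smd] in_dc[OF x] by (simp add: jacobian_def frechet_derivative_works)
  have "((\<lambda>y. transition d c (transition c d y)) has_derivative (\<lambda>u. jacobian d c (transition c d x) (jacobian c d x u))) (at x)"
    by (rule has_derivative_compose[OF d1 d2])
  moreover have "((\<lambda>y. transition d c (transition c d y)) has_derivative (\<lambda>u. u)) (at x)"
    by (rule has_derivative_transform_within_open[OF has_derivative_ident overlap_open[OF ic id] x])
      (simp add: in_dc)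
  ultimately have inv: "jacobian d c (transition c d x) (jacobian c d x u) = u" for u
    using has_derivative_unique by (metis (no_types, lifting))
  show lin: "linear (jacobian c d x)"
    using d1 by (rule has_derivative_linear)
  show inj: "inj (jacobian c d x)"
    using inv by (metis injI)
  show "surj (jacobian c d x)"
    by (rule linear_injective_imp_surjective[OF lin inj refl])
qed

section \<open>Pointwise and chartwise structures obtained from tensor fields\<close>

lemma endo_field_endo_on: "endo_field A \<phi> \<Longrightarrow> c \<in> A \<Longrightarrow> endo_on (chart_image c) (\<phi> c)"
  by (simp add: endo_field_def endo_on_def)

lemma riemannian_metric_inner_form:
  "riemannian_metric A g \<Longrightarrow> c \<in> A \<Longrightarrow> x \<in> chart_image c \<Longrightarrow> inner_form (g c x)"
  unfolding riemannian_metric_def cov2_field_def inner_form_def by metis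

lemma riemannian_metric_chart:
  assumes "smooth_atlas A" "riemannian_metric A g" "c \<in> A"
  shows "riemannian_chart (chart_image c) (g c)"
  using assms riemannian_metric_inner_form[OF assms(2,3)] chart_image_open[OF assms(1,3)]
  by (simp add: riemannian_chart_def riemannian_metric_def cov2_field_def)

lemma almost_contact_metric_contact_form:
  fixes g :: "('a::topological_space, 5) cov2_rep"
  assumes acm: "almost_contact_metric A \<phi> \<xi> \<eta> g" and c: "c \<in> A" and x: "x \<in> chart_image c"
  shows "contact_form (g c x) (\<phi> c x) (\<xi> c x) (\<eta> c x)"
proof (intro contact_form.intro contact_form_axioms.intro)
  show "inner_form (g c x)"
    using acm c x by (auto simp: almost_contact_metric_def intro: riemannian_metric_inner_form)
  show "DIM(real^5) = 5" by simp
  show "linear (\<phi> c x)" "linear (\<eta> c x)"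
    using acm c x by (auto simp: almost_contact_metric_def endo_field_def one_form_def)
qed (use acm c x in \<open>auto simp: almost_contact_metric_def\<close>)

lemma almost_contact_metric_chart:
  fixes g :: "('a::topological_space, 5) cov2_rep"
  assumes A: "smooth_atlas A" and acm: "almost_contact_metric A \<phi> \<xi> \<eta> g" and D: "levi_civita A g D"
    and c: "c \<in> A"
  shows "contact_chart (chart_image c) (g c) (D c) (\<phi> c) (\<xi> c) (\<eta> c)"
proof (intro contact_chart.intro metric_chart.intro metric_chart_axioms.intro contact_chart_axioms.intro)
  show "riemannian_chart (chart_image c) (g c)"
    using acm by (intro riemannian_metric_chart[OF A _ c]) (simp add: almost_contact_metric_def)
  show "levi_civita_on (chart_image c) (g c) (D c)"
    using D c by (simp add: levi_civita_def)
  show "endo_on (chart_image c) (\<phi> c)"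
    using acm c by (intro endo_field_endo_on) (auto simp: almost_contact_metric_def)
  show "smooth_on (chart_image c) (\<xi> c)"
    using acm c by (simp add: almost_contact_metric_def vector_field_def)
qed (rule almost_contact_metric_contact_form[OF acm c])

lemma wedge12_eq: "wedge12 \<alpha> \<omega> c = wedge_1_2 (\<alpha> c) (\<omega> c)"
  by (simp add: fun_eq_iff wedge12_def wedge_1_2_def)

text \<open>Constant fields realise all tangent vectors, and tensoriality returns from them to
  arbitrary fields.\<close>

lemma has_ext_deriv1_iff:
  assumes A: "smooth_atlas A" and \<alpha>: "one_form A \<alpha>"
  shows "has_ext_deriv1 A \<alpha> \<beta> \<longleftrightarrow> (\<forall>c\<in>A. \<forall>x\<in>chart_image c. \<forall>u v. cd1 (\<alpha> c) x u v = \<beta> c x u v)"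
proof -
  have eq: "ext_d1 (\<alpha> c) X Y x = cd1 (\<alpha> c) x (X x) (Y x)"
    if "c \<in> A" "X \<in> vfields (chart_image c)" "Y \<in> vfields (chart_image c)" "x \<in> chart_image c" for c X Y x
    by (rule ext_d1_eq_cd1[OF chart_image_open[OF A that(1)] that(4) _ _ that(2,3)])
      (use \<alpha> that in \<open>auto simp: one_form_def\<close>)
  have k: "(\<lambda>_. u) \<in> vfields W" for u :: "real^'b" and W by (simp add: vfields_def)
  show ?thesis
  proof
    assume *: "has_ext_deriv1 A \<alpha> \<beta>"
    show "\<forall>c\<in>A. \<forall>x\<in>chart_image c. \<forall>u v. cd1 (\<alpha> c) x u v = \<beta> c x u v"
    proof (intro ballI allI)
      fix c x u v assume c: "c \<in> A" and x: "x \<in> chart_image c"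
      then have "ext_d1 (\<alpha> c) (\<lambda>_. u) (\<lambda>_. v) x = \<beta> c x u v"
        using * k unfolding has_ext_deriv1_def by fast
      then show "cd1 (\<alpha> c) x u v = \<beta> c x u v" using eq[OF c k k x] by simp
    qed
  qed (simp add: has_ext_deriv1_def eq)
qed

lemma has_ext_deriv2_iff:
  assumes A: "smooth_atlas A" and bil: "\<And>c x. c \<in> A \<Longrightarrow> x \<in> chart_image c \<Longrightarrow> bilinear (\<alpha> c x)"
    and sm: "\<And>c u v. c \<in> A \<Longrightarrow> smooth_on (chart_image c) (\<lambda>x. \<alpha> c x u v)"
    and anti: "\<And>c x u v. c \<in> A \<Longrightarrow> x \<in> chart_image c \<Longrightarrow> \<alpha> c x u v = - \<alpha> c x v u"
  shows "has_ext_deriv2 A \<alpha> \<beta> \<longleftrightarrow> (\<forall>c\<in>A. \<forall>x\<in>chart_image c. \<forall>u v w. cd2 (\<alpha> c) x u v w = \<beta> c x u v w)"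
proof -
  have eq: "ext_d2 (\<alpha> c) X Y Z x = cd2 (\<alpha> c) x (X x) (Y x) (Z x)"
    if "c \<in> A" "X \<in> vfields (chart_image c)" "Y \<in> vfields (chart_image c)" "Z \<in> vfields (chart_image c)"
      "x \<in> chart_image c" for c X Y Z x
    by (rule ext_d2_eq_cd2[OF chart_image_open[OF A that(1)] that(5) bil[OF that(1)] sm[OF that(1)]
          that(2,3,4) anti[OF that(1,5)]])
  have k: "(\<lambda>_. u) \<in> vfields W" for u :: "real^'b" and W by (simp add: vfields_def)
  show ?thesis
  proof
    assume *: "has_ext_deriv2 A \<alpha> \<beta>"
    show "\<forall>c\<in>A. \<forall>x\<in>chart_image c. \<forall>u v w. cd2 (\<alpha> c) x u v w = \<beta> c x u v w"
    proof (intro ballI allI)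
      fix c x u v w assume c: "c \<in> A" and x: "x \<in> chart_image c"
      then have "ext_d2 (\<alpha> c) (\<lambda>_. u) (\<lambda>_. v) (\<lambda>_. w) x = \<beta> c x u v w"
        using * k unfolding has_ext_deriv2_def by fast
      then show "cd2 (\<alpha> c) x u v w = \<beta> c x u v w" using eq[OF c k k k x] by simp
    qed
  qed (simp add: has_ext_deriv2_def eq)
qed

lemma has_ext_deriv3_wedge12:
  assumes A: "smooth_atlas A" and \<eta>: "one_form A \<eta>"
    and bil: "\<And>c x. c \<in> A \<Longrightarrow> x \<in> chart_image c \<Longrightarrow> bilinear (\<omega> c x)"
    and sm: "\<And>c u v. c \<in> A \<Longrightarrow> smooth_on (chart_image c) (\<lambda>x. \<omega> c x u v)"
    and anti: "\<And>c x u v. c \<in> A \<Longrightarrow> x \<in> chart_image c \<Longrightarrow> \<omega> c x u v = - \<omega> c x v u"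
    and zero: "\<And>c x u v w z. c \<in> A \<Longrightarrow> x \<in> chart_image c \<Longrightarrow> cd3 (wedge_1_2 (\<eta> c) (\<omega> c)) x u v w z = 0"
  shows "has_ext_deriv3 A (wedge12 \<eta> \<omega>) (\<lambda>c x u v w z. 0)"
  unfolding has_ext_deriv3_def wedge12_eq
proof (intro ballI)
  fix c X Y Z W x
  assume c: "c \<in> A" and X: "X \<in> vfields (chart_image c)" "Y \<in> vfields (chart_image c)"
    "Z \<in> vfields (chart_image c)" "W \<in> vfields (chart_image c)" and x: "x \<in> chart_image c"
  have e: "linear (\<eta> c y)" if "y \<in> chart_image c" for y using \<eta> c that by (simp add: one_form_def)
  note open_c = chart_image_open[OF A c]
  have lin: "linear (\<lambda>w. wedge_1_2 (\<eta> c) (\<omega> c) y w u v)" "linear (\<lambda>w. wedge_1_2 (\<eta> c) (\<omega> c) y u w v)"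
     "linear (\<lambda>w. wedge_1_2 (\<eta> c) (\<omega> c) y u v w)"
    if y: "y \<in> chart_image c" for y u v
    unfolding wedge_1_2_def
    by (rule linearI; simp add: linear_expand[OF e[OF y]] bilinear_expand[OF bil[OF c y]] algebra_simps)+
  have "ext_d3 (wedge_1_2 (\<eta> c) (\<omega> c)) X Y Z W x = cd3 (wedge_1_2 (\<eta> c) (\<omega> c)) x (X x) (Y x) (Z x) (W x)"
  proof (rule ext_d3_eq_cd3[OF open_c x _ lin(1) _ X])
    show "bilinear (wedge_1_2 (\<eta> c) (\<omega> c) y u)" if "y \<in> chart_image c" for y u
      using lin(2,3)[OF that] by (simp add: bilinear_def)
    show "smooth_on (chart_image c) (\<lambda>y. wedge_1_2 (\<eta> c) (\<omega> c) y u v w)" for u v w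
      unfolding wedge_1_2_def using \<eta> c
      by (intro smooth_on_add smooth_on_mult open_c sm) (auto simp: one_form_def)
    show "wedge_1_2 (\<eta> c) (\<omega> c) x u v w = - wedge_1_2 (\<eta> c) (\<omega> c) x v u w"
      "wedge_1_2 (\<eta> c) (\<omega> c) x u v w = - wedge_1_2 (\<eta> c) (\<omega> c) x u w v" for u v w
      using anti[OF c x, of w v] anti[OF c x, of w u] anti[OF c x, of v u]
      by (simp_all add: wedge_1_2_def algebra_simps)
  qed
  then show "ext_d3 (wedge_1_2 (\<eta> c) (\<omega> c)) X Y Z W x = 0"
    by (simp add: zero[OF c x])
qed

lemma fundamental_form_eq: "fundamental_form g \<phi> c = (\<lambda>x u v. g c x (\<phi> c x u) v)"
  by (simp add: fun_eq_iff fundamental_form_def)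

lemma fundamental_form_2form:
  fixes g :: "('a::topological_space, 5) cov2_rep"
  assumes A: "smooth_atlas A" and acm: "almost_contact_metric A \<phi> \<xi> \<eta> g" and c: "c \<in> A"
  shows "x \<in> chart_image c \<Longrightarrow> bilinear (fundamental_form g \<phi> c x)"
    and "smooth_on (chart_image c) (\<lambda>x. fundamental_form g \<phi> c x u v)"
    and "x \<in> chart_image c \<Longrightarrow> fundamental_form g \<phi> c x u v = - fundamental_form g \<phi> c x v u"
proof -
  have R: "riemannian_chart (chart_image c) (g c)"
    using acm by (intro riemannian_metric_chart[OF A _ c]) (simp add: almost_contact_metric_def)
  have E: "endo_on (chart_image c) (\<phi> c)"
    using acm c by (intro endo_field_endo_on) (auto simp: almost_contact_metric_def)
  show "smooth_on (chart_image c) (\<lambda>x. fundamental_form g \<phi> c x u v)"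
    unfolding fundamental_form_eq by (rule riemannian_chart.form_smooth[OF R E])
  assume x: "x \<in> chart_image c"
  interpret contact_form "g c x" "\<phi> c x" "\<xi> c x" "\<eta> c x"
    by (rule almost_contact_metric_contact_form[OF acm c x])
  show "bilinear (fundamental_form g \<phi> c x)"
    unfolding bilinear_def fundamental_form_eq
    by (intro conjI allI linearI) (simp_all add: expand linear_expand[OF linear_phi])
  show "fundamental_form g \<phi> c x u v = - fundamental_form g \<phi> c x v u"
    unfolding fundamental_form_eq using skew[of u v] sym[of u "\<phi> c x v"] by linarith
qed

lemma structure_equations_iff:
  assumes A: "smooth_atlas A" and su2: "su2_structure A \<phi>\<^sub>1 \<phi>\<^sub>2 \<phi>\<^sub>3 \<xi> \<eta> g"
  shows "structure_equations A l \<eta> (fundamental_form g \<phi>\<^sub>1) (fundamental_form g \<phi>\<^sub>2) (fundamental_form g \<phi>\<^sub>3) \<longleftrightarrow>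
    (\<forall>c\<in>A. \<forall>x\<in>chart_image c.
      (\<forall>u v. cd1 (\<eta> c) x u v = - 2 * l * g c x (\<phi>\<^sub>3 c x u) v) \<and>
      (\<forall>u v w. cd2 (\<lambda>x u v. g c x (\<phi>\<^sub>1 c x u) v) x u v w =
         3 * l * wedge_1_2 (\<eta> c) (\<lambda>x u v. g c x (\<phi>\<^sub>2 c x u) v) x u v w) \<and>
      (\<forall>u v w. cd2 (\<lambda>x u v. g c x (\<phi>\<^sub>2 c x u) v) x u v w =
         - 3 * l * wedge_1_2 (\<eta> c) (\<lambda>x u v. g c x (\<phi>\<^sub>1 c x u) v) x u v w))"
proof -
  have acm: "almost_contact_metric A \<phi>\<^sub>1 \<xi> \<eta> g" "almost_contact_metric A \<phi>\<^sub>2 \<xi> \<eta> g"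
    using su2 by (auto simp: su2_structure_def)
  have \<eta>: "one_form A \<eta>" using acm(1) by (simp add: almost_contact_metric_def)
  have 1: "has_ext_deriv2 A (fundamental_form g \<phi>\<^sub>1) \<beta> \<longleftrightarrow>
      (\<forall>c\<in>A. \<forall>x\<in>chart_image c. \<forall>u v w. cd2 (fundamental_form g \<phi>\<^sub>1 c) x u v w = \<beta> c x u v w)" for \<beta>
    by (rule has_ext_deriv2_iff[OF A fundamental_form_2form[OF A acm(1)]])
  have 2: "has_ext_deriv2 A (fundamental_form g \<phi>\<^sub>2) \<beta> \<longleftrightarrow>
      (\<forall>c\<in>A. \<forall>x\<in>chart_image c. \<forall>u v w. cd2 (fundamental_form g \<phi>\<^sub>2 c) x u v w = \<beta> c x u v w)" for \<beta>
    by (rule has_ext_deriv2_iff[OF A fundamental_form_2form[OF A acm(2)]])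
  show ?thesis
    unfolding structure_equations_def has_ext_deriv1_iff[OF A \<eta>] 1 2 wedge12_eq fundamental_form_eq
    by blast
qed

lemma su2_structure_form:
  assumes su2: "su2_structure A \<phi>\<^sub>1 \<phi>\<^sub>2 \<phi>\<^sub>3 \<xi> \<eta> g" and c: "c \<in> A" and x: "x \<in> chart_image c"
  shows "su2_form (g c x) (\<phi>\<^sub>1 c x) (\<phi>\<^sub>2 c x) (\<phi>\<^sub>3 c x) (\<xi> c x) (\<eta> c x)"
proof (intro su2_form.intro su2_form_axioms.intro)
  show "contact_form (g c x) (\<phi>\<^sub>1 c x) (\<xi> c x) (\<eta> c x)" "contact_form (g c x) (\<phi>\<^sub>2 c x) (\<xi> c x) (\<eta> c x)"
    "contact_form (g c x) (\<phi>\<^sub>3 c x) (\<xi> c x) (\<eta> c x)"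
    using su2 by (auto simp: su2_structure_def intro: almost_contact_metric_contact_form[OF _ c x])
  fix u
  have q: "\<phi>\<^sub>1 c x (\<phi>\<^sub>2 c x u) = \<phi>\<^sub>3 c x u" "\<phi>\<^sub>3 c x u = - \<phi>\<^sub>2 c x (\<phi>\<^sub>1 c x u)"
    "\<phi>\<^sub>2 c x (\<phi>\<^sub>3 c x u) = \<phi>\<^sub>1 c x u" "\<phi>\<^sub>1 c x u = - \<phi>\<^sub>3 c x (\<phi>\<^sub>2 c x u)"
    "\<phi>\<^sub>3 c x (\<phi>\<^sub>1 c x u) = \<phi>\<^sub>2 c x u" "\<phi>\<^sub>2 c x u = - \<phi>\<^sub>1 c x (\<phi>\<^sub>3 c x u)"
    using su2 c x unfolding su2_structure_def by blast+
  show "\<phi>\<^sub>1 c x (\<phi>\<^sub>2 c x u) = \<phi>\<^sub>3 c x u" "\<phi>\<^sub>2 c x (\<phi>\<^sub>3 c x u) = \<phi>\<^sub>1 c x u" "\<phi>\<^sub>3 c x (\<phi>\<^sub>1 c x u) = \<phi>\<^sub>2 c x u"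
    by (rule q)+
  show "\<phi>\<^sub>2 c x (\<phi>\<^sub>1 c x u) = - \<phi>\<^sub>3 c x u" by (subst q(2)) simp
  show "\<phi>\<^sub>3 c x (\<phi>\<^sub>2 c x u) = - \<phi>\<^sub>1 c x u" by (subst q(4)) simp
  show "\<phi>\<^sub>1 c x (\<phi>\<^sub>3 c x u) = - \<phi>\<^sub>2 c x u" by (subst q(6)) simp
qed

lemma su2_structure_chart:
  assumes A: "smooth_atlas A" and su2: "su2_structure A \<phi>\<^sub>1 \<phi>\<^sub>2 \<phi>\<^sub>3 \<xi> \<eta> g" and l: "l \<noteq> 0"
    and eqs: "structure_equations A l \<eta> (fundamental_form g \<phi>\<^sub>1) (fundamental_form g \<phi>\<^sub>2) (fundamental_form g \<phi>\<^sub>3)"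
    and c: "c \<in> A"
  shows "su2_structure_chart (chart_image c) (g c) (\<phi>\<^sub>1 c) (\<phi>\<^sub>2 c) (\<phi>\<^sub>3 c) (\<xi> c) (\<eta> c) l"
proof -
  have acm: "almost_contact_metric A \<phi>\<^sub>1 \<xi> \<eta> g" "almost_contact_metric A \<phi>\<^sub>2 \<xi> \<eta> g" "almost_contact_metric A \<phi>\<^sub>3 \<xi> \<eta> g"
    using su2 by (auto simp: su2_structure_def)
  note e = eqs[unfolded structure_equations_iff[OF A su2], rule_format, OF c]
  show ?thesis
  proof (intro su2_structure_chart.intro su2_structure_chart_axioms.intro su2_structure_form[OF su2 c] l)
    show "riemannian_chart (chart_image c) (g c)"
      using acm(1) by (intro riemannian_metric_chart[OF A _ c]) (simp add: almost_contact_metric_def)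
    show "endo_on (chart_image c) (\<phi>\<^sub>1 c)" "endo_on (chart_image c) (\<phi>\<^sub>2 c)" "endo_on (chart_image c) (\<phi>\<^sub>3 c)"
      using acm c by (auto simp: almost_contact_metric_def intro: endo_field_endo_on)
    show "smooth_on (chart_image c) (\<xi> c)" "smooth_on (chart_image c) (\<lambda>x. \<eta> c x u)" for u
      using acm(1) c by (auto simp: almost_contact_metric_def vector_field_def one_form_def)
  qed (use e in blast)+
qed

lemma su2_structure_hypo:
  assumes A: "smooth_atlas A" and su2: "su2_structure A \<phi>\<^sub>1 \<phi>\<^sub>2 \<phi>\<^sub>3 \<xi> \<eta> g" and l: "l \<noteq> 0"
    and eqs: "structure_equations A l \<eta> (fundamental_form g \<phi>\<^sub>1) (fundamental_form g \<phi>\<^sub>2) (fundamental_form g \<phi>\<^sub>3)"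
  shows "hypo A \<eta> (fundamental_form g \<phi>\<^sub>1) (fundamental_form g \<phi>\<^sub>2) (fundamental_form g \<phi>\<^sub>3)"
proof -
  have acm: "almost_contact_metric A \<phi>\<^sub>1 \<xi> \<eta> g" "almost_contact_metric A \<phi>\<^sub>2 \<xi> \<eta> g" "almost_contact_metric A \<phi>\<^sub>3 \<xi> \<eta> g"
    using su2 by (auto simp: su2_structure_def)
  have \<eta>: "one_form A \<eta>" using acm(1) by (simp add: almost_contact_metric_def)
  note C = su2_structure_chart[OF assms]
  show ?thesis
    unfolding hypo_def
  proof (intro conjI)
    show "has_ext_deriv2 A (fundamental_form g \<phi>\<^sub>3) (\<lambda>c x u v w. 0)"
      by (subst has_ext_deriv2_iff[OF A fundamental_form_2form[OF A acm(3)]])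
        (simp_all add: fundamental_form_eq su2_structure_chart.d_omega3[OF C])
    show "has_ext_deriv3 A (wedge12 \<eta> (fundamental_form g \<phi>\<^sub>1)) (\<lambda>c x u v w z. 0)"
      by (rule has_ext_deriv3_wedge12[OF A \<eta> fundamental_form_2form[OF A acm(1)]])
        (simp_all add: fundamental_form_eq su2_structure_chart.d_eta_omega(1)[OF C])
    show "has_ext_deriv3 A (wedge12 \<eta> (fundamental_form g \<phi>\<^sub>2)) (\<lambda>c x u v w z. 0)"
      by (rule has_ext_deriv3_wedge12[OF A \<eta> fundamental_form_2form[OF A acm(2)]])
        (simp_all add: fundamental_form_eq su2_structure_chart.d_eta_omega(2)[OF C])
  qed
qed

lemma su2_structure_nearly_cosymplectic:
  fixes A :: "('a::topological_space, 5) chart set"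
  assumes A: "smooth_atlas A" and su2: "su2_structure A \<phi>\<^sub>1 \<phi>\<^sub>2 \<phi>\<^sub>3 \<xi> \<eta> g" and l: "l \<noteq> 0"
    and eqs: "structure_equations A l \<eta> (fundamental_form g \<phi>\<^sub>1) (fundamental_form g \<phi>\<^sub>2) (fundamental_form g \<phi>\<^sub>3)"
    and D: "levi_civita A g D"
  shows "nearly_cosymplectic A D \<phi>\<^sub>2 \<xi> \<eta> g" "\<not> cokaehler A D \<phi>\<^sub>2 \<xi> \<eta> g"
proof -
  have acm: "almost_contact_metric A \<phi>\<^sub>2 \<xi> \<eta> g"
    using su2 by (auto simp: su2_structure_def)
  have nabla: "cov_deriv_endo (D c) (\<phi>\<^sub>2 c) X Y x =
      - l *\<^sub>R (\<eta> c x (X x) *\<^sub>R \<phi>\<^sub>1 c x (Y x) - \<eta> c x (Y x) *\<^sub>R \<phi>\<^sub>1 c x (X x) + g c x (\<phi>\<^sub>1 c x (X x)) (Y x) *\<^sub>R \<xi> c x)"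
    if c: "c \<in> A" and X: "X \<in> vfields (chart_image c)" "Y \<in> vfields (chart_image c)" and x: "x \<in> chart_image c"
    for c X Y x
  proof -
    interpret contact_chart "chart_image c" "g c" "D c" "\<phi>\<^sub>2 c" "\<xi> c" "\<eta> c"
      by (rule almost_contact_metric_chart[OF A acm D c])
    show ?thesis
      unfolding cov_deriv_endo_eq[OF phi_endo X x]
      by (rule su2_structure_chart.nabla_phi2[OF su2_structure_chart[OF A su2 l eqs c] levi_civita x])
  qed
  have skew: "g c x (\<phi>\<^sub>1 c x u) v = - g c x (\<phi>\<^sub>1 c x v) u" if "c \<in> A" "x \<in> chart_image c" for c x u v
    using su2_structure_chart.skew(1)[OF su2_structure_chart[OF A su2 l eqs that(1)] that(2)] .
  show "nearly_cosymplectic A D \<phi>\<^sub>2 \<xi> \<eta> g"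
    unfolding nearly_cosymplectic_def
  proof (intro conjI ballI acm)
    fix c X Y x
    assume c: "c \<in> A" and X: "X \<in> vfields (chart_image c)" "Y \<in> vfields (chart_image c)" and x: "x \<in> chart_image c"
    show "cov_deriv_endo (D c) (\<phi>\<^sub>2 c) X Y x + cov_deriv_endo (D c) (\<phi>\<^sub>2 c) Y X x = 0"
      unfolding nabla[OF c X x] nabla[OF c X(2,1) x] skew[OF c x, of "Y x" "X x"]
      by (simp add: algebra_simps)
  qed
  show "\<not> cokaehler A D \<phi>\<^sub>2 \<xi> \<eta> g"
  proof
    assume ck: "cokaehler A D \<phi>\<^sub>2 \<xi> \<eta> g"
    \<comment> \<open>A type is nonempty and the charts cover it, so there is a point to test
      at.\<close>
    obtain c p where c: "c \<in> A" and "p \<in> fst c"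
      using A unfolding smooth_atlas_def by blast
    then have x: "snd c p \<in> chart_image c" by (simp add: chart_image_def)
    let ?x = "snd c p"
    interpret su2_form "g c ?x" "\<phi>\<^sub>1 c ?x" "\<phi>\<^sub>2 c ?x" "\<phi>\<^sub>3 c ?x" "\<xi> c ?x" "\<eta> c ?x"
      by (rule su2_structure_form[OF su2 c x])
    obtain e where e: "\<eta> c ?x e = 0" "C1.orthonormal_frame (\<xi> c ?x) e (\<phi>\<^sub>1 c ?x e) (\<phi>\<^sub>2 c ?x e) (\<phi>\<^sub>3 c ?x e)"
      by (rule su2_frame)
    have k: "(\<lambda>_. u) \<in> vfields (chart_image c)" for u by (simp add: vfields_def)
    \<comment> \<open>For this pair the formula \<open>nabla\<close> collapses to
      \<open>- l *\<^sub>R \<phi>\<^sub>1 c ?x e\<close>, a nonzero vector.\<close>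
    have "cov_deriv_endo (D c) (\<phi>\<^sub>2 c) (\<lambda>_. \<xi> c ?x) (\<lambda>_. e) ?x = 0"
      using ck c x k unfolding cokaehler_def by blast
    then have "\<phi>\<^sub>1 c ?x e = 0"
      using l e(1) by (simp add: nabla[OF c k k x] C1.eta_xi C1.phi_xi C1.zero_left)
    then show False
      using e(2) by (simp add: C1.orthonormal_frame_def C1.zero_left)
  qed
qed

section \<open>Globalising \<open>h\<close> and \<open>L\<close>, and the SU(2)-structure of a
  nearly cosymplectic manifold\<close>

locale nearly_cosymplectic_manifold =
  fixes A :: "('a::topological_space, 5) chart set" and \<phi> :: "('a, 5) endo_rep" and \<xi> :: "('a, 5) vector_rep"
    and \<eta> :: "('a, 5) cov1_rep" and g :: "('a, 5) cov2_rep" and D :: "('a, 5) connection_rep"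
  assumes atlas: "smooth_atlas A" and connected: "connected (UNIV :: 'a set)"
    and nearly: "nearly_cosymplectic A D \<phi> \<xi> \<eta> g" and levi_civita: "levi_civita A g D"
begin

lemma acm: "almost_contact_metric A \<phi> \<xi> \<eta> g"
  using nearly by (simp add: nearly_cosymplectic_def)

lemma is_chart: "c \<in> A \<Longrightarrow> is_chart c"
  using atlas by (simp add: smooth_atlas_def)

lemma nearly_chart:
  assumes c: "c \<in> A"
  shows "nearly_chart (chart_image c) (g c) (D c) (\<phi> c) (\<xi> c) (\<eta> c)"
proof -
  interpret contact_chart "chart_image c" "g c" "D c" "\<phi> c" "\<xi> c" "\<eta> c"
    by (rule almost_contact_metric_chart[OF atlas acm levi_civita c])
  show ?thesis
  proof (intro nearly_chart.intro contact_chart_axioms nearly_chart_axioms.intro)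
    fix x u v assume x: "x \<in> chart_image c"
    have "cov_deriv_endo (D c) (\<phi> c) (\<lambda>_. u) (\<lambda>_. v) x + cov_deriv_endo (D c) (\<phi> c) (\<lambda>_. v) (\<lambda>_. u) x = 0"
      using nearly c x const_vfields unfolding nearly_cosymplectic_def by blast
    then show "nabla (\<phi> c) x u v = - nabla (\<phi> c) x v u"
      by (simp add: cov_deriv_endo_eq[OF phi_endo const_vfields const_vfields x] eq_neg_iff_add_eq_0)
  qed
qed

definition h :: "('a, 5) endo_rep" where "h c = metric_chart.nabla_vec (D c) (\<xi> c)"

definition L :: "('a, 5) chart \<Rightarrow> real ^ 5 \<Rightarrow> real" where "L c = nearly_chart.L (D c) (\<xi> c)"

lemma nearly_form:
  assumes "c \<in> A" "x \<in> chart_image c"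
  shows "nearly_cosymplectic_form (g c x) (\<phi> c x) (\<xi> c x) (\<eta> c x) (h c x) (metric_chart.nabla (D c) (\<phi> c) x)"
  unfolding h_def by (rule nearly_chart.nearly_form[OF nearly_chart[OF assms(1)] assms(2)])

lemma h_square:
  assumes "c \<in> A" "x \<in> chart_image c"
  shows "h c x (h c x u) = - L c x *\<^sub>R (u - \<eta> c x u *\<^sub>R \<xi> c x)" "0 \<le> L c x"
  unfolding h_def L_def by (rule nearly_chart.h_square[OF nearly_chart[OF assms(1)] assms(2)])+

lemma invariance:
  assumes c: "c \<in> A" and d: "d \<in> A" and x: "x \<in> overlap c d"
  shows "\<eta> d (transition c d x) (jacobian c d x u) = \<eta> c x u"
    and "g d (transition c d x) (jacobian c d x u) (jacobian c d x v) = g c x u v"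
    and "\<xi> d (transition c d x) = jacobian c d x (\<xi> c x)"
    and "\<phi> d (transition c d x) (jacobian c d x u) = jacobian c d x (\<phi> c x u)"
proof -
  have t: "one_form A \<eta>" "cov2_field A g" "vector_field A \<xi>" "endo_field A \<phi>"
    using acm by (simp_all add: almost_contact_metric_def riemannian_metric_def)
  show "\<eta> d (transition c d x) (jacobian c d x u) = \<eta> c x u"
    using t(1) c d x by (simp add: one_form_def)
  show "g d (transition c d x) (jacobian c d x u) (jacobian c d x v) = g c x u v"
    using t(2) c d x by (simp add: cov2_field_def)
  show "\<xi> d (transition c d x) = jacobian c d x (\<xi> c x)"
    using t(3) c d x by (simp add: vector_field_def)
  show "\<phi> d (transition c d x) (jacobian c d x u) = jacobian c d x (\<phi> c x u)"
    using t(4) c d x by (simp add: endo_field_def)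
qed

lemma transition_image: "c \<in> A \<Longrightarrow> x \<in> overlap c d \<Longrightarrow> transition c d x \<in> chart_image d"
  by (erule overlap_cases[OF is_chart]) (auto simp: chart_image_def)

text \<open>\<open>h\<close> is a tensor field because \<open>g (h u) v\<close> is half of \<open>d\<eta>\<close>, and the exterior derivative is natural.\<close>

lemma h_invariance:
  assumes c: "c \<in> A" and d: "d \<in> A" and x: "x \<in> overlap c d"
  shows "h d (transition c d x) (jacobian c d x u) = jacobian c d x (h c x u)"
proof -
  let ?y = "transition c d x" and ?J = "jacobian c d x"
  have xc: "x \<in> chart_image c" using overlap_subset x by blast
  have yd: "?y \<in> chart_image d" by (rule transition_image[OF c x])
  interpret inner_form "g d ?y"
    using acm by (intro riemannian_metric_inner_form[OF _ d yd]) (simp add: almost_contact_metric_def)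
  have pull: "cd1 (\<eta> d) ?y (?J u) (?J v) = cd1 (\<eta> c) x u v" for v
    unfolding jacobian_def
  proof (rule cd1_pullback[OF overlap_open[OF is_chart[OF c] is_chart[OF d]] x chart_image_open[OF atlas d]])
    show "smooth_on (overlap c d) (transition c d)"
      using atlas c d by (simp add: smooth_atlas_def)
    show "transition c d y \<in> chart_image d" if "y \<in> overlap c d" for y
      by (rule transition_image[OF c that])
    show "linear (\<eta> d y)" if "y \<in> chart_image d" for y
      using acm d that by (simp add: almost_contact_metric_def one_form_def)
    show "smooth_on (chart_image d) (\<lambda>y. \<eta> d y u)" for u
      using acm d by (simp add: almost_contact_metric_def one_form_def)
    show "smooth_on (overlap c d) (\<lambda>y. \<eta> c y u)" for u
      using acm c by (intro smooth_on_subset[OF _ overlap_subset]) (simp add: almost_contact_metric_def one_form_def)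
    show "\<eta> d (transition c d y) (frechet_derivative (transition c d) (at y) u) = \<eta> c y u"
      if "y \<in> overlap c d" for y u
      using invariance(1)[OF c d that] by (simp add: jacobian_def)
  qed
  show ?thesis
  proof (rule eqI)
    fix w
    \<comment> \<open>Every test vector is the image of one in the chart \<open>c\<close>, so the
      metric pairing with these images determines the vector.\<close>
    obtain v where w: "w = ?J v"
      using jacobian_bij(3)[OF atlas c d x] by (metis surjD)
    have "2 * g d ?y (h d ?y (?J u)) (?J v) = 2 * g c x (h c x u) v"
      using pull[of v] nearly_chart.cd1_eta_eq[OF nearly_chart[OF c] xc, of u v]
        nearly_chart.cd1_eta_eq[OF nearly_chart[OF d] yd, of "?J u" "?J v"]
      by (simp add: h_def)
    then show "g d ?y (h d ?y (?J u)) w = g d ?y (?J (h c x u)) w"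
      by (simp add: w invariance(2)[OF c d x])
  qed
qed

text \<open>The Jacobian intertwines the squares of \<open>h\<close> and preserves ker \<eta>, where
  they are scalar; one nonzero horizontal vector suffices for comparing the scalars.\<close>

lemma L_invariance:
  assumes c: "c \<in> A" and d: "d \<in> A" and x: "x \<in> overlap c d"
  shows "L d (transition c d x) = L c x"
proof -
  let ?y = "transition c d x" and ?J = "jacobian c d x"
  have xc: "x \<in> chart_image c" using overlap_subset x by blast
  have yd: "?y \<in> chart_image d" by (rule transition_image[OF c x])
  note J = jacobian_bij[OF atlas c d x]
  interpret contact_form "g c x" "\<phi> c x" "\<xi> c x" "\<eta> c x"
    by (rule almost_contact_metric_contact_form[OF acm c xc])
  obtain e f where e: "\<eta> c x e = 0" and fr: "orthonormal_frame (\<xi> c x) e (\<phi> c x e) f (\<phi> c x f)"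
    using exists_frame by blast
  have "e \<noteq> 0" using fr by (auto simp: orthonormal_frame_def zero_left)
  then have Je: "?J e \<noteq> 0" using J(1,2) by (metis linear_injective_0)
  have "h d ?y (h d ?y (?J e)) = ?J (h c x (h c x e))"
    by (simp add: h_invariance[OF c d x])
  then have "L d ?y *\<^sub>R ?J e = L c x *\<^sub>R ?J e"
    by (simp add: h_square[OF c xc] h_square[OF d yd] invariance[OF c d x] e linear_expand[OF J(1)])
  then show ?thesis using Je by simp
qed

lemma L_constant:
  obtains K where "\<And>c x. c \<in> A \<Longrightarrow> x \<in> chart_image c \<Longrightarrow> L c x = K"
proof -
  \<comment> \<open>\<open>F\<close> is the function on the manifold with chart expressions
    \<open>L c\<close>; by \<open>L_invariance\<close> the chosen chart is immaterial.\<close>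
  define F where "F p = L (SOME c. c \<in> A \<and> p \<in> fst c) (snd (SOME c. c \<in> A \<and> p \<in> fst c) p)" for p
  have F: "F p = L c (snd c p)" if c: "c \<in> A" "p \<in> fst c" for p c
  proof -
    define d where "d = (SOME c. c \<in> A \<and> p \<in> fst c)"
    have d: "d \<in> A \<and> p \<in> fst d" unfolding d_def by (rule someI[of _ c]) (use c in simp)
    have "snd c p \<in> overlap c d" using c d by (auto simp: overlap_def)
    then show ?thesis
      using L_invariance[OF c(1) _ , of d "snd c p"] d transition_chart[OF is_chart[OF c(1)] c(2), of d]
      by (simp add: F_def d_def[symmetric])
  qed
  have "eventually (\<lambda>q. F p = F q) (at p within UNIV)" for p
  proof -
    obtain c where c: "c \<in> A" "p \<in> fst c"
      using atlas unfolding smooth_atlas_def by blast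
    then have x: "snd c p \<in> chart_image c" by (simp add: chart_image_def)
    obtain r where r: "0 < r" "ball (snd c p) r \<subseteq> chart_image c"
      using openE[OF chart_image_open[OF atlas c(1)] x] by blast
    interpret N: nearly_chart "chart_image c" "g c" "D c" "\<phi> c" "\<xi> c" "\<eta> c" by (rule nearly_chart[OF c(1)])
    \<comment> \<open>A ball is convex, so a vanishing derivative makes \<open>L c\<close> constant
      on it; its preimage is the neighbourhood needed for local constancy of
      \<open>F\<close>.\<close>
    have "(L c has_derivative (\<lambda>_. 0)) (at y within ball (snd c p) r)" if "y \<in> ball (snd c p) r" for y
    proof -
      have y: "y \<in> chart_image c" using r that by blast
      have "frechet_derivative (L c) (at y) = (\<lambda>_. 0)"
        using N.L_derivative[OF y] unfolding L_def by blast
      moreover have "L c differentiable (at y)"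
        unfolding L_def by (rule smooth_on_differentiable[OF N.smooth_L y])
      ultimately show ?thesis
        by (metis frechet_derivative_works has_derivative_at_withinI)
    qed
    then obtain k where k: "\<And>y. y \<in> ball (snd c p) r \<Longrightarrow> L c y = k"
      using has_derivative_zero_constant[OF convex_ball, of "snd c p" r "L c"] by blast
    have cont: "continuous_on (fst c) (snd c)" "open (fst c)"
      using is_chart[OF c(1)] by (auto simp: is_chart_def homeomorphism_def)
    have "open (fst c \<inter> snd c -` ball (snd c p) r)"
      by (rule continuous_open_preimage[OF cont open_ball])
    moreover have "p \<in> fst c \<inter> snd c -` ball (snd c p) r" using c r by simp
    moreover have "F p = F q" if "q \<in> fst c \<inter> snd c -` ball (snd c p) r" for q
      using that F[OF c] F[OF c(1), of q] k r by simp
    ultimately show ?thesis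
      unfolding eventually_at_topological by blast
  qed
  then have const: "F p = F q" for p q
    using connected_local_const[OF connected UNIV_I UNIV_I] by blast
  show ?thesis
  proof
    \<comment> \<open>\<open>undefined\<close> is merely an arbitrary base point.\<close>
    show "L c x = F undefined" if "c \<in> A" "x \<in> chart_image c" for c x
    proof -
      obtain p where "p \<in> fst c" "x = snd c p" using \<open>x \<in> chart_image c\<close> by (auto simp: chart_image_def)
      then show ?thesis using F[OF \<open>c \<in> A\<close>, of p] const by metis
    qed
  qed
qed

lemma h_endo_field: "endo_field A h"
  unfolding endo_field_def
proof (intro conjI ballI allI)
  show "linear (h c x)" if "c \<in> A" "x \<in> chart_image c" for c x
    using contact_derivative.linear_h[OF nearly_cosymplectic_form.axioms(1)[OF nearly_form[OF that]]] .
  show "smooth_on (chart_image c) (\<lambda>x. h c x u)" if c: "c \<in> A" for c u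
  proof -
    interpret N: nearly_chart "chart_image c" "g c" "D c" "\<phi> c" "\<xi> c" "\<eta> c" by (rule nearly_chart[OF c])
    show ?thesis unfolding h_def by (rule endo_onD(2)[OF N.h_endo])
  qed
qed (rule h_invariance)

text \<open>If \<open>L\<close> vanishes, so does \<open>g (h u) (h u) = - g (h (h u)) u\<close>;
  hence \<open>h\<close> is zero, and \<open>N_eq\<close> expresses \<nabla>\<phi> through
  \<open>h\<close>.\<close>

lemma nabla_zero_if_L_zero:
  assumes "c \<in> A" "x \<in> chart_image c" "L c x = 0"
  shows "metric_chart.nabla (D c) (\<phi> c) x u v = 0"
proof -
  interpret nearly_cosymplectic_form "g c x" "\<phi> c x" "\<xi> c x" "\<eta> c x" "h c x" "metric_chart.nabla (D c) (\<phi> c) x"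
    by (rule nearly_form[OF assms(1,2)])
  have "g c x (h c x u) (h c x u) = 0" for u
    using h_skew[of u "h c x u"] by (simp add: h_square[OF assms(1,2)] assms(3) zero_left)
  then have "h c x u = 0" for u by (simp add: eq_zero_iff)
  then show ?thesis
    by (intro eqI) (simp add: N_eq linear_expand[OF linear_phi] zero_left)
qed

lemma su2_structure_exists:
  assumes "\<not> cokaehler A D \<phi> \<xi> \<eta> g"
  shows "\<exists>\<phi>\<^sub>1 \<phi>\<^sub>3 l. l \<noteq> 0 \<and> su2_structure A \<phi>\<^sub>1 \<phi> \<phi>\<^sub>3 \<xi> \<eta> g \<and>
    structure_equations A l \<eta> (fundamental_form g \<phi>\<^sub>1) (fundamental_form g \<phi>) (fundamental_form g \<phi>\<^sub>3)"
proof -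
  obtain c0 X Y x0 where c0: "c0 \<in> A" "X \<in> vfields (chart_image c0)" "Y \<in> vfields (chart_image c0)"
    and x0: "x0 \<in> chart_image c0" and ne: "cov_deriv_endo (D c0) (\<phi> c0) X Y x0 \<noteq> 0"
    using assms acm unfolding cokaehler_def by blast
  obtain K where K: "\<And>c x. c \<in> A \<Longrightarrow> x \<in> chart_image c \<Longrightarrow> L c x = K"
    by (rule L_constant) blast
  interpret C0: nearly_chart "chart_image c0" "g c0" "D c0" "\<phi> c0" "\<xi> c0" "\<eta> c0" by (rule nearly_chart[OF c0(1)])
  \<comment> \<open>As \<open>L\<close> is constant, one point with \<nabla>\<phi> nonzero excludes
    zero everywhere.\<close>
  have "K \<noteq> 0"
    using ne nabla_zero_if_L_zero[OF c0(1) x0] K[OF c0(1) x0]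
    by (auto simp: C0.cov_deriv_endo_eq[OF C0.phi_endo c0(2,3) x0])
  moreover have "0 \<le> K" using h_square(2)[OF c0(1) x0] K[OF c0(1) x0] by simp
  ultimately have "0 < K" by simp
  \<comment> \<open>The negative root would serve equally, with \<open>\<phi>\<^sub>1\<close> and
    \<open>\<phi>\<^sub>3\<close> replaced by their negatives.\<close>
  define l where "l = sqrt K"
  have l: "l \<noteq> 0" "l\<^sup>2 = K" using \<open>0 < K\<close> by (simp_all add: l_def)
  define \<phi>\<^sub>1 where "\<phi>\<^sub>1 c x u = (- 1 / l) *\<^sub>R \<phi> c x (h c x u)" for c x u
  define \<phi>\<^sub>3 where "\<phi>\<^sub>3 c x u = (- 1 / l) *\<^sub>R h c x u" for c x u
  have form: "su2_form (g c x) (\<phi>\<^sub>1 c x) (\<phi> c x) (\<phi>\<^sub>3 c x) (\<xi> c x) (\<eta> c x)"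
    if c: "c \<in> A" and x: "x \<in> chart_image c" for c x
    unfolding \<phi>\<^sub>1_def[abs_def] \<phi>\<^sub>3_def[abs_def]
    by (rule nearly_cosymplectic_form.su2_form_of_h[OF nearly_form[OF c x] _ l(1)])
      (simp add: h_square[OF c x] K[OF c x] l(2))
  have lin: "linear (jacobian c d x)" if "c \<in> A" "d \<in> A" "x \<in> overlap c d" for c d x
    by (rule jacobian_bij(1)[OF atlas that])
  have phi_field: "endo_field A \<phi>" using acm by (simp add: almost_contact_metric_def)
  have on: "endo_on (chart_image c) (\<phi>\<^sub>1 c)" "endo_on (chart_image c) (\<phi>\<^sub>3 c)" if c: "c \<in> A" for c
    unfolding \<phi>\<^sub>1_def[abs_def] \<phi>\<^sub>3_def[abs_def]
    by (rule endo_on_scale[OF chart_image_open[OF atlas c] endo_on_comp[OF chart_image_open[OF atlas c]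
            endo_field_endo_on[OF phi_field c] endo_field_endo_on[OF h_endo_field c]]],
        rule endo_on_scale[OF chart_image_open[OF atlas c] endo_field_endo_on[OF h_endo_field c]])
  have fields: "endo_field A \<phi>\<^sub>1" "endo_field A \<phi>\<^sub>3"
    unfolding endo_field_def using on
    by (auto simp: endo_on_def \<phi>\<^sub>1_def \<phi>\<^sub>3_def h_invariance invariance linear_scale[OF lin]
        linear_neg[OF lin])
  have acm': "almost_contact_metric A \<psi> \<xi> \<eta> g"
    if \<psi>: "endo_field A \<psi>" and cf: "\<And>c x. c \<in> A \<Longrightarrow> x \<in> chart_image c \<Longrightarrow> contact_form (g c x) (\<psi> c x) (\<xi> c x) (\<eta> c x)"
    for \<psi>
    using acm \<psi> contact_form.phi_phi[OF cf] contact_form.compatible[OF cf]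
    unfolding almost_contact_metric_def by blast
  have su2: "su2_structure A \<phi>\<^sub>1 \<phi> \<phi>\<^sub>3 \<xi> \<eta> g"
    unfolding su2_structure_def
  proof (intro conjI ballI allI)
    show "almost_contact_metric A \<phi>\<^sub>1 \<xi> \<eta> g" "almost_contact_metric A \<phi>\<^sub>3 \<xi> \<eta> g"
      using form by (auto intro!: acm' fields simp: su2_form_def)
    show "almost_contact_metric A \<phi> \<xi> \<eta> g" by (rule acm)
  qed (simp_all add: su2_form.quat[OF form])
  have "structure_equations A l \<eta> (fundamental_form g \<phi>\<^sub>1) (fundamental_form g \<phi>) (fundamental_form g \<phi>\<^sub>3)"
    unfolding structure_equations_iff[OF atlas su2]
  proof (intro ballI conjI allI)
    fix c x u v w assume c: "c \<in> A" and x: "x \<in> chart_image c"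
    interpret C: nearly_chart "chart_image c" "g c" "D c" "\<phi> c" "\<xi> c" "\<eta> c" by (rule nearly_chart[OF c])
    interpret inner_form "g c x" by (rule C.inner_form[OF x])
    have Lc: "C.L x = l\<^sup>2" using K[OF c x] by (simp add: L_def l(2))
    have a: "g c y (\<phi>\<^sub>1 c y u) v = (- 1 / l) * C.\<alpha> y u v" if "y \<in> chart_image c" for y u v
      using inner_form.scale_left[OF C.inner_form[OF that], of "- 1 / l"] by (simp add: \<phi>\<^sub>1_def C.\<alpha>_def h_def)
    have w: "(\<lambda>y u v. g c y (\<phi> c y u) v) = C.\<omega>"
      by (simp add: fun_eq_iff C.\<omega>_def)
    have da: "(\<lambda>y. (- 1 / l) * C.\<alpha> y u v) differentiable (at x)" for u v
      by (rule differentiable_mult[OF differentiable_const smooth_on_differentiable[OF C.smooth_alpha x]])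
    have da': "(\<lambda>y. g c y (\<phi>\<^sub>1 c y u) v) differentiable (at x)" for u v
      by (rule smooth_on_differentiable[OF C.form_smooth[OF on(1)[OF c]] x])
    show "cd1 (\<eta> c) x u v = - 2 * l * g c x (\<phi>\<^sub>3 c x u) v"
      using l by (simp add: C.cd1_eta_eq[OF x] \<phi>\<^sub>3_def h_def scale_left minus_left)
    have "cd2 (\<lambda>y u v. g c y (\<phi>\<^sub>1 c y u) v) x u v w = cd2 (\<lambda>y u v. (- 1 / l) * C.\<alpha> y u v) x u v w"
      by (rule cd2_cong[OF C.open_V x da' a])
    also have "\<dots> = (- 1 / l) * cd2 C.\<alpha> x u v w"
      by (rule cd2_cmult[OF smooth_on_differentiable[OF C.smooth_alpha x]])
    \<comment> \<open>The coefficient \<open>- 3 * l\<^sup>2\<close> of \<open>cd2_alpha\<close>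
      divided by \<open>- l\<close>.\<close>
    also have "\<dots> = 3 * l * wedge_1_2 (\<eta> c) C.\<omega> x u v w"
      using l(1) by (simp add: C.cd2_alpha[OF x] Lc power2_eq_square)
    finally show "cd2 (\<lambda>y u v. g c y (\<phi>\<^sub>1 c y u) v) x u v w =
        3 * l * wedge_1_2 (\<eta> c) (\<lambda>y u v. g c y (\<phi> c y u) v) x u v w"
      by (simp only: w)
    show "cd2 (\<lambda>y u v. g c y (\<phi> c y u) v) x u v w =
        - 3 * l * wedge_1_2 (\<eta> c) (\<lambda>y u v. g c y (\<phi>\<^sub>1 c y u) v) x u v w"
      unfolding w C.cd2_omega[OF x] wedge_1_2_def a[OF x] using l by (simp add: field_simps)
  qed
  then show ?thesis using l(1) su2 by blast
qed

end

theorem theorem5p1: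
  fixes A :: "('a::{t2_space,second_countable_topology}, 5) chart set"
  assumes "connected_manifold A"
  shows
    "(\<forall>\<phi> \<xi> \<eta> g D. almost_contact_metric A \<phi> \<xi> \<eta> g \<and> levi_civita A g D \<longrightarrow>
        (nearly_cosymplectic A D \<phi> \<xi> \<eta> g \<and> \<not> cokaehler A D \<phi> \<xi> \<eta> g \<longleftrightarrow>
          (\<exists>\<phi>\<^sub>1 \<phi>\<^sub>2 \<phi>\<^sub>3 l. \<phi>\<^sub>2 = \<phi> \<and> l \<noteq> 0 \<and> su2_structure A \<phi>\<^sub>1 \<phi>\<^sub>2 \<phi>\<^sub>3 \<xi> \<eta> g \<and>
             structure_equations A l \<eta>
               (fundamental_form g \<phi>\<^sub>1) (fundamental_form g \<phi>\<^sub>2) (fundamental_form g \<phi>\<^sub>3))))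
   \<and> (\<forall>\<phi>\<^sub>1 \<phi>\<^sub>2 \<phi>\<^sub>3 \<xi> \<eta> g l. l \<noteq> 0 \<and> su2_structure A \<phi>\<^sub>1 \<phi>\<^sub>2 \<phi>\<^sub>3 \<xi> \<eta> g \<and>
        structure_equations A l \<eta>
          (fundamental_form g \<phi>\<^sub>1) (fundamental_form g \<phi>\<^sub>2) (fundamental_form g \<phi>\<^sub>3) \<longrightarrow>
        hypo A \<eta> (fundamental_form g \<phi>\<^sub>1) (fundamental_form g \<phi>\<^sub>2) (fundamental_form g \<phi>\<^sub>3))"
proof -
  have A: "smooth_atlas A" "connected (UNIV :: 'a set)"
    using assms by (simp_all add: connected_manifold_def)
  show ?thesis
  proof (intro conjI allI impI iffI)
    fix \<phi> \<xi> \<eta> g D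
    assume D: "almost_contact_metric A \<phi> \<xi> \<eta> g \<and> levi_civita A g D"
    {
      assume N: "nearly_cosymplectic A D \<phi> \<xi> \<eta> g \<and> \<not> cokaehler A D \<phi> \<xi> \<eta> g"
      \<comment> \<open>Connectedness enters here, through the constancy of
        \<open>L\<close>.\<close>
      interpret nearly_cosymplectic_manifold A \<phi> \<xi> \<eta> g D
        using A N D by (simp add: nearly_cosymplectic_manifold_def)
      show "\<exists>\<phi>\<^sub>1 \<phi>\<^sub>2 \<phi>\<^sub>3 l. \<phi>\<^sub>2 = \<phi> \<and> l \<noteq> 0 \<and> su2_structure A \<phi>\<^sub>1 \<phi>\<^sub>2 \<phi>\<^sub>3 \<xi> \<eta> g \<and>
          structure_equations A l \<eta>
            (fundamental_form g \<phi>\<^sub>1) (fundamental_form g \<phi>\<^sub>2) (fundamental_form g \<phi>\<^sub>3)"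
        using su2_structure_exists N by blast
    }
    assume "\<exists>\<phi>\<^sub>1 \<phi>\<^sub>2 \<phi>\<^sub>3 l. \<phi>\<^sub>2 = \<phi> \<and> l \<noteq> 0 \<and> su2_structure A \<phi>\<^sub>1 \<phi>\<^sub>2 \<phi>\<^sub>3 \<xi> \<eta> g \<and>
          structure_equations A l \<eta>
            (fundamental_form g \<phi>\<^sub>1) (fundamental_form g \<phi>\<^sub>2) (fundamental_form g \<phi>\<^sub>3)"
    then obtain \<phi>\<^sub>1 \<phi>\<^sub>3 l where "su2_structure A \<phi>\<^sub>1 \<phi> \<phi>\<^sub>3 \<xi> \<eta> g" "l \<noteq> 0"
      "structure_equations A l \<eta> (fundamental_form g \<phi>\<^sub>1) (fundamental_form g \<phi>) (fundamental_form g \<phi>\<^sub>3)"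
      by blast
    note S = su2_structure_nearly_cosymplectic[OF A(1) this conjunct2[OF D]]
    show "nearly_cosymplectic A D \<phi> \<xi> \<eta> g" "\<not> cokaehler A D \<phi> \<xi> \<eta> g"
      by (rule S)+
  next
    fix \<phi>\<^sub>1 \<phi>\<^sub>2 \<phi>\<^sub>3 \<xi> \<eta> g l
    assume "l \<noteq> 0 \<and> su2_structure A \<phi>\<^sub>1 \<phi>\<^sub>2 \<phi>\<^sub>3 \<xi> \<eta> g \<and>
      structure_equations A l \<eta>
        (fundamental_form g \<phi>\<^sub>1) (fundamental_form g \<phi>\<^sub>2) (fundamental_form g \<phi>\<^sub>3)"
    then show "hypo A \<eta> (fundamental_form g \<phi>\<^sub>1) (fundamental_form g \<phi>\<^sub>2) (fundamental_form g \<phi>\<^sub>3)"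
      by (intro su2_structure_hypo[OF A(1)]) auto
  qed
qed

end
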